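(* For $i=1,2$, let $K_i$ be a locally compact Hausdorff space, let $E_i$ be a real reflexive Banach lattice satisfying $\lambda^+(E_i)>1$, and let $\mathcal{H}_i$ be a closed linear subspace of $\mathcal{C}_0(K_i,E_i)$. Assume that, for $i=1,2$, each point of the Choquet boundary $\operatorname{Ch}_{\mathcal{H}_i}K_i$ of $\mathcal{H}_i$ is a weak peak point (with respect to $\mathcal{H}_i$). Let $T\colon \mathcal{H}_1\to\mathcal{H}_2$ be an isomorphism satisfying $$\|T\|\cdot\|T^{-1}\|<\min\{\lambda^+(E_1),\lambda^+(E_2)\}$$ and such that $T$ and $T^{-1}$ preserve positive elements, that is, for every $f\in\mathcal{H}_1$, $$f\in\mathcal{H}_1^+\quad\text{if and only if}\quad T(f)\in\mathcal{H}_2^+ .$$ Then $\operatorname{Ch}_{\mathcal{H}_1}K_1$ is homeomorphic to $\operatorname{Ch}_{\mathcal{H}_2}K_2$ (each with the subspace topology inherited from $K_i$).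
   Context: All Banach spaces and Banach lattices are real. It is assumed throughout that the spaces $E_i$ and $\mathcal{H}_i$ have dimension at least $1$. An isomorphism is a bounded linear bijection with bounded inverse. For a Banach space $E$, $S_E$ is its unit sphere, $B_E$ its closed unit ball, $E^*$ its dual, and $\langle\cdot,\cdot\rangle$ the duality. For a Banach lattice $E$, $E^+$ is the set of its positive elements. For a locally compact Hausdorff space $K$, $\mathcal{C}_0(K,E)$ is the space of continuous $E$-valued functions on $K$ vanishing at infinity, with norm $\|f\|_{\sup}=\sup_{x\in K}\|f(x)\|$. For a Banach lattice $E$, $$\lambda^+(E)=\inf\{\max\{\|e_1+e_2\|,\|e_1-e_2\|\}: e_1,e_2\in S_E,\ e_1,e_2\ge 0\}.$$ Let $\mathcal{H}$ be a closed linear subspace of $\mathcal{C}_0(K,E)$ (not necessarily a sublattice). - $\mathcal{H}^+=\{f\in\mathcal{H}: f(x)\in E^+\text{ for all }x\in K\}$. - For $h\in\mathcal{H}$ and $e^*\in E^*$ let $e^*(h)\in\mathcal{C}_0(K,\mathbb{R})$ be given by $e^*(h)(x)=\langle e^*,h(x)\rangle$. The canonical scalar function space $\mathcal{A}\subset\mathcal{C}_0(K,\mathbb{R})$ of $\mathcal{H}$ is the closed linear span of $\{e^*(h): e^*\in E^*,\ h\in\mathcal{H}\}$. - Let $i\colon K\to B_{\mathcal{A}^*}$ be the evaluation map, $\langle i(x),a\rangle=a(x)$ for $a\in\mathcal{A}$. The Choquet boundary $\operatorname{Ch}_{\mathcal{H}}K$ is the set of those $x\in K$ such that $i(x)$ is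 an extreme point of $B_{\mathcal{A}^*}$. - For $f\colon K\to\mathbb{R}$ and $e\in E$, $f\otimes e\colon K\to E$ is the function $(f\otimes e)(x)=f(x)e$. - A point $x\in\operatorname{Ch}_{\mathcal{H}}K$ is a weak peak point if for each neighbourhood $U$ of $x$, each $\varepsilon\in(0,1)$ and each $e\in E^+$ there exists a function $h_{U,\varepsilon}\in\mathcal{A}$ such that $h_{U,\varepsilon}(x)>1-\varepsilon$, $h_{U,\varepsilon}<\varepsilon$ on $\operatorname{Ch}_{\mathcal{H}}K\setminus U$, $0\le h_{U,\varepsilon}\le1$ on $K$, and $h_{U,\varepsilon}\otimes e\in\mathcal{H}$. *)

theory Defs
  imports "HOL-Analysis.Analysis" "HOL-Library.Function_Algebras"
begin

section \<open>Banach lattices\<close>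

class banach_lattice = banach + ordered_real_vector + lattice +
  assumes norm_lattice_mono: "sup x (- x) \<le> sup y (- y) \<Longrightarrow> norm x \<le> norm y"

instance real :: banach_lattice
  by standard (auto simp: sup_real_def max_def split: if_splits)

text \<open>The constant below does not depend on the value of its argument, which only carries
  the space \<^typ>\<open>'e\<close>.\<close>

definition lambda_plus :: "'e::banach_lattice itself \<Rightarrow> real" where
  "lambda_plus _ = Inf {max (norm (e1 + e2)) (norm (e1 - e2)) | e1 e2 :: 'e.
      e1 \<in> sphere 0 1 \<and> e2 \<in> sphere 0 1 \<and> 0 \<le> e1 \<and> 0 \<le> e2}"

text \<open>Surjectivity of the canonical embedding into the bidual.\<close>

definition reflexive_space :: "'e::real_normed_vector itself \<Rightarrow> bool" where
  "reflexive_space _ \<longleftrightarrow>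
     (\<forall>\<phi> :: ('e \<Rightarrow>\<^sub>L real) \<Rightarrow>\<^sub>L real. \<exists>e :: 'e. \<forall>f :: 'e \<Rightarrow>\<^sub>L real.
        blinfun_apply \<phi> f = blinfun_apply f e)"


section \<open>Bounded linear maps between linear subspaces\<close>

text \<open>Maps defined on a linear subspace \<^term>\<open>S\<close> are total functions of which only the values
  on \<^term>\<open>S\<close> matter.\<close>

definition bounded_linear_map_on ::
    "'a::real_normed_vector set \<Rightarrow> ('a \<Rightarrow> 'b::real_normed_vector) \<Rightarrow> bool" where
  "bounded_linear_map_on S f \<longleftrightarrow>
     (\<forall>x\<in>S. \<forall>y\<in>S. f (x + y) = f x + f y) \<and>
     (\<forall>c. \<forall>x\<in>S. f (c *\<^sub>R x) = c *\<^sub>R f x) \<and>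
     (\<exists>B. \<forall>x\<in>S. norm (f x) \<le> B * norm x)"

definition onorm_on ::
    "'a::real_normed_vector set \<Rightarrow> ('a \<Rightarrow> 'b::real_normed_vector) \<Rightarrow> real" where
  "onorm_on S f = (SUP x \<in> S \<inter> cball 0 1. norm (f x))"

definition isomorphism_between ::
    "'a::real_normed_vector set \<Rightarrow> 'b::real_normed_vector set \<Rightarrow> ('a \<Rightarrow> 'b) \<Rightarrow> bool" where
  "isomorphism_between S S' T \<longleftrightarrow>
     bij_betw T S S' \<and> bounded_linear_map_on S T \<and> bounded_linear_map_on S' (inv_into S T)"

text \<open>Pointwise scalar multiplication; it makes \<^const>\<open>extreme_point_of\<close> applicable to sets of
  functionals.\<close>

instantiation "fun" :: (type, real_vector) real_vector
begin

definition scaleR_fun :: "real \<Rightarrow> ('a \<Rightarrow> 'b) \<Rightarrow> 'a \<Rightarrow> 'b" where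
  "scaleR_fun c f = (\<lambda>x. c *\<^sub>R f x)"

instance
  by standard (auto simp: scaleR_fun_def fun_eq_iff scaleR_add_right scaleR_add_left)

end

text \<open>The dual of a linear subspace \<^term>\<open>A\<close>. To have one representative per functional, a
  functional on \<^term>\<open>A\<close> is extended by \<open>0\<close> outside \<^term>\<open>A\<close> (this extension is in general not
  linear on the whole type, but sums and scalar multiples are computed correctly).\<close>

definition dual_of :: "'a::real_normed_vector set \<Rightarrow> ('a \<Rightarrow> real) set" where
  "dual_of A = {\<phi>. bounded_linear_map_on A \<phi> \<and> (\<forall>a. a \<notin> A \<longrightarrow> \<phi> a = 0)}"

definition dual_ball :: "'a::real_normed_vector set \<Rightarrow> ('a \<Rightarrow> real) set" where
  "dual_ball A = {\<phi> \<in> dual_of A. onorm_on A \<phi> \<le> 1}"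


section \<open>Spaces of vector-valued functions vanishing at infinity\<close>

text \<open>\<open>C\<^sub>0(K,E)\<close> as a subset of the type of bounded continuous functions, whose norm is the
  supremum norm.\<close>

definition C0 :: "('k::topological_space \<Rightarrow>\<^sub>C 'e::real_normed_vector) set" where
  "C0 = {f. \<forall>\<epsilon>>0. \<exists>C. compact C \<and> (\<forall>x. x \<notin> C \<longrightarrow> norm (apply_bcontfun f x) < \<epsilon>)}"

text \<open>No continuous function vanishing at infinity is lost by this encoding.\<close>

lemma C0_complete:
  fixes f :: "'k::topological_space \<Rightarrow> 'e::real_normed_vector"
  assumes cont: "continuous_on UNIV f"
    and van: "\<forall>\<epsilon>>0. \<exists>C. compact C \<and> (\<forall>x. x \<notin> C \<longrightarrow> norm (f x) < \<epsilon>)"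
  shows "\<exists>g\<in>C0. apply_bcontfun g = f"
proof -
  obtain C where C: "compact C" "\<And>x. x \<notin> C \<Longrightarrow> norm (f x) < 1"
    using van zero_less_one by blast
  have "compact (f ` C)"
    using C(1) cont by (meson compact_continuous_image continuous_on_subset subset_UNIV)
  then have "bounded (f ` C \<union> ball 0 1)"
    by (simp add: compact_imp_bounded)
  moreover have "range f \<subseteq> f ` C \<union> ball 0 1"
    using C(2) by (force simp: mem_ball_0)
  ultimately have "bounded (range f)"
    by (rule bounded_subset)
  then have "f \<in> bcontfun"
    using cont by (simp add: bcontfun_def)
  then have "apply_bcontfun (Bcontfun f) = f"
    by (rule Bcontfun_inverse)
  then show ?thesis
    using van by (intro bexI[of _ "Bcontfun f"]) (simp_all add: C0_def)
qed

definition positive_part ::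
    "('k::topological_space \<Rightarrow>\<^sub>C 'e::banach_lattice) set \<Rightarrow> ('k \<Rightarrow>\<^sub>C 'e) set" where
  "positive_part H = {f \<in> H. \<forall>x. 0 \<le> apply_bcontfun f x}"

text \<open>The scalar function \<open>e\<^sup>*(h)\<close>.\<close>

definition scalarize ::
    "('e::real_normed_vector \<Rightarrow>\<^sub>L real) \<Rightarrow> ('k::topological_space \<Rightarrow>\<^sub>C 'e) \<Rightarrow> ('k \<Rightarrow>\<^sub>C real)" where
  "scalarize e' h = Bcontfun (\<lambda>x. blinfun_apply e' (apply_bcontfun h x))"

lemma scalarize_apply [simp]:
  "apply_bcontfun (scalarize e' h) x = blinfun_apply e' (apply_bcontfun h x)"
proof -
  have "bounded (blinfun_apply e' ` range (apply_bcontfun h))"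
    by (intro bounded_linear_image bounded_apply_bcontfun blinfun.bounded_linear_right)
  moreover have "continuous_on UNIV (\<lambda>x. blinfun_apply e' (apply_bcontfun h x))"
    by (intro continuous_intros continuous_on_apply_bcontfun)
  ultimately have "(\<lambda>x. blinfun_apply e' (apply_bcontfun h x)) \<in> bcontfun"
    by (simp add: bcontfun_def image_image)
  then show ?thesis
    by (simp add: scalarize_def Bcontfun_inverse)
qed

text \<open>The function \<open>f \<otimes> e\<close>.\<close>

definition tensor ::
    "('k::topological_space \<Rightarrow>\<^sub>C real) \<Rightarrow> 'e::real_normed_vector \<Rightarrow> ('k \<Rightarrow>\<^sub>C 'e)" where
  "tensor f e = Bcontfun (\<lambda>x. apply_bcontfun f x *\<^sub>R e)"

lemma tensor_apply [simp]: "apply_bcontfun (tensor f e) x = apply_bcontfun f x *\<^sub>R e"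
proof -
  have "bounded ((\<lambda>r. r *\<^sub>R e) ` range (apply_bcontfun f))"
    by (intro bounded_linear_image bounded_apply_bcontfun bounded_linear_scaleR_left)
  moreover have "continuous_on UNIV (\<lambda>x. apply_bcontfun f x *\<^sub>R e)"
    by (intro continuous_intros continuous_on_apply_bcontfun)
  ultimately have "(\<lambda>x. apply_bcontfun f x *\<^sub>R e) \<in> bcontfun"
    by (simp add: bcontfun_def image_image)
  then show ?thesis
    by (simp add: tensor_def Bcontfun_inverse)
qed

definition scalar_space ::
    "('k::topological_space \<Rightarrow>\<^sub>C 'e::real_normed_vector) set \<Rightarrow> ('k \<Rightarrow>\<^sub>C real) set" where
  "scalar_space H = closure (span {scalarize e' h | e' h. h \<in> H})"

definition eval_functional ::
    "('k::topological_space \<Rightarrow>\<^sub>C real) set \<Rightarrow> 'k \<Rightarrow> ('k \<Rightarrow>\<^sub>C real) \<Rightarrow> real" where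
  "eval_functional A x = (\<lambda>a. if a \<in> A then apply_bcontfun a x else 0)"

definition choquet_boundary ::
    "('k::topological_space \<Rightarrow>\<^sub>C 'e::real_normed_vector) set \<Rightarrow> 'k set" where
  "choquet_boundary H =
     {x. eval_functional (scalar_space H) x extreme_point_of dual_ball (scalar_space H)}"

definition weak_peak_point ::
    "('k::topological_space \<Rightarrow>\<^sub>C 'e::banach_lattice) set \<Rightarrow> 'k \<Rightarrow> bool" where
  "weak_peak_point H x \<longleftrightarrow>
     x \<in> choquet_boundary H \<and>
     (\<forall>U \<epsilon> e. x \<in> interior U \<longrightarrow> 0 < \<epsilon> \<longrightarrow> \<epsilon> < 1 \<longrightarrow> 0 \<le> e \<longrightarrow>
        (\<exists>h \<in> scalar_space H.
           apply_bcontfun h x > 1 - \<epsilon> \<and>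
           (\<forall>y \<in> choquet_boundary H - U. apply_bcontfun h y < \<epsilon>) \<and>
           (\<forall>y. 0 \<le> apply_bcontfun h y \<and> apply_bcontfun h y \<le> 1) \<and>
           tensor h e \<in> H))"

end

theory Submission
  imports Defs
begin

text \<open>Let \<open>Q\<close> be the limit in the bidual of \<open>h \<otimes> e\<close> over peak functions \<open>h\<close> at a point \<open>x\<close> of the
  Choquet boundary; its image under \<open>T\<^sup>*\<^sup>*\<close> is an affine function on the dual ball of \<open>H\<^sub>2\<close>. It need
  not be semicontinuous, but after adding a small \<open>a \<otimes> e \<in> H\<^sub>1\<close> it attains its maximum on a closed
  face: near-maximizers of almost maximal dual norm are almost positive near \<open>x\<close>, and iterating
  this gives \<open>a\<close> by a variational argument. By Milman's theorem the face contains some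
  \<open>e\<^sup>* \<otimes> \<delta>\<^sub>y\<close> with \<open>y\<close> in the Choquet boundary of \<open>H\<^sub>2\<close>, so peaks at \<open>x\<close> have an image which stays
  large at \<open>y\<close>. The sum of two positive vectors has norm at least \<open>\<lambda>\<^sup>+\<close> times the smaller norm,
  hence at most one \<open>x\<close> belongs to each \<open>y\<close>. The same holds for the inverse, and a reflection
  argument (reflexivity provides limit values of the peaks) shows that the two relations contain
  a common bijection, which is a homeomorphism.\<close>

section \<open>Sublinear functionals\<close>

text \<open>Let \<open>J1\<close> be \<open>T\<close> times the norm of its inverse and
  \<open>J2\<close> the inverse times the norm of \<open>T\<close>. Both multiply norms by a factor
  between 1 and \<open>c\<close>, the product of the two norms, and they are inverse to each other
  up to the factor \<open>c\<close>. A peak at a point has an image of norm almost 1 at least, but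
  the place where this norm is attained may move while the peak shrinks, and the peaks converge only
  in the bidual. One \<open>y\<close> that serves all small peaks has to be found at once; hence a
  face of the dual ball is studied instead of the norms of single images. Positions are measured
  against a level \<open>r\<close> with c/\<lambda> < r < 1: the upper bound lets positions exist,
  the lower one makes them exclusive. Exclusiveness alone does not show that a position of the peaks
  at \<open>y\<close> leads back to \<open>y\<close>: every point has a position, but going there
  and back could end elsewhere. The reflection closes this gap. It requires c < 2, which holds
  because a positive unit vector paired with itself shows \<lambda> \<le> 2.\<close>

definition functional_on :: "'a::real_vector set \<Rightarrow> ('a \<Rightarrow> real) \<Rightarrow> bool" where
  "functional_on S f \<longleftrightarrow>
     (\<forall>x\<in>S. \<forall>y\<in>S. f (x + y) = f x + f y) \<and> (\<forall>c. \<forall>x\<in>S. f (c *\<^sub>R x) = c * f x)"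

definition sublinear_on :: "'a::real_vector set \<Rightarrow> ('a \<Rightarrow> real) \<Rightarrow> bool" where
  "sublinear_on S p \<longleftrightarrow>
     (\<forall>x\<in>S. \<forall>y\<in>S. p (x + y) \<le> p x + p y) \<and> (\<forall>t\<ge>0. \<forall>x\<in>S. p (t *\<^sub>R x) = t * p x)"

lemma sublinear_on_add: "sublinear_on S p \<Longrightarrow> x \<in> S \<Longrightarrow> y \<in> S \<Longrightarrow> p (x + y) \<le> p x + p y"
  and sublinear_on_scale: "sublinear_on S p \<Longrightarrow> x \<in> S \<Longrightarrow> 0 \<le> t \<Longrightarrow> p (t *\<^sub>R x) = t * p x"
  by (auto simp: sublinear_on_def)

lemma sublinear_on_zero: "subspace S \<Longrightarrow> sublinear_on S p \<Longrightarrow> p 0 = 0"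
  using sublinear_on_scale[of S p 0 0] by (simp add: subspace_0)

lemma sublinear_on_neg_le:
  assumes "subspace S" "sublinear_on S p" "x \<in> S"
  shows "- p (- x) \<le> p x"
  using sublinear_on_add[OF assms(2,3), of "- x"] sublinear_on_zero[OF assms(1,2)] assms
  by (simp add: subspace_neg)

lemma functional_on_sublinear: "functional_on S f \<Longrightarrow> sublinear_on S f"
  by (auto simp: functional_on_def sublinear_on_def)

lemma functional_on_add:
    "functional_on S f \<Longrightarrow> x \<in> S \<Longrightarrow> y \<in> S \<Longrightarrow> f (x + y) = f x + f y"
  and functional_on_scale:
    "functional_on S f \<Longrightarrow> x \<in> S \<Longrightarrow> f (c *\<^sub>R x) = c * f x"
  by (auto simp: functional_on_def)

lemma functional_on_neg:
  assumes "functional_on S f" "x \<in> S"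
  shows "f (- x) = - f x"
  using functional_on_scale[OF assms, of "-1"] by simp

lemma functional_on_diff:
  assumes "subspace S" "functional_on S f" "x \<in> S" "y \<in> S"
  shows "f (x - y) = f x - f y"
  using functional_on_add[OF assms(2,3), of "- y"] functional_on_neg[OF assms(2,4)] assms
  by (simp add: subspace_neg)

text \<open>What makes the infimum sublinear is that the family is closed under sums and dilations
  up to passing to smaller values; its members need not be sublinear, for example
  \<open>q (x + t *\<^sub>R z) - t * q z\<close>. The lower bound of a chain, the lowering along a
  direction, the splitting and the separation below are all instances.\<close>

lemma sublinear_on_Inf:
  fixes g :: "'i \<Rightarrow> 'a::real_vector \<Rightarrow> real"
  assumes I: "I \<noteq> {}" and S: "subspace S"
    and bdd: "\<And>x. x \<in> S \<Longrightarrow> bdd_below ((\<lambda>i. g i x) ` I)"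
    and add: "\<And>i j x y. i \<in> I \<Longrightarrow> j \<in> I \<Longrightarrow> x \<in> S \<Longrightarrow> y \<in> S \<Longrightarrow>
      \<exists>k\<in>I. g k (x + y) \<le> g i x + g j y"
    and scale: "\<And>i t x. i \<in> I \<Longrightarrow> t > 0 \<Longrightarrow> x \<in> S \<Longrightarrow> \<exists>k\<in>I. g k (t *\<^sub>R x) \<le> t * g i x"
    and zero: "\<And>i. i \<in> I \<Longrightarrow> 0 \<le> g i 0" "\<exists>i\<in>I. g i 0 = 0"
  shows "sublinear_on S (\<lambda>x. INF i\<in>I. g i x)"
proof -
  have lower: "(INF i\<in>I. g i x) \<le> g i x" if "i \<in> I" "x \<in> S" for i x
    by (rule cINF_lower[OF bdd]) (use that in auto)
  have z: "(INF i\<in>I. g i 0) = 0"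
  proof (rule antisym)
    show "(INF i\<in>I. g i 0) \<le> 0"
      using lower[OF _ subspace_0[OF S]] zero(2) by metis
    show "0 \<le> (INF i\<in>I. g i 0)"
      by (rule cINF_greatest[OF I]) (use zero in auto)
  qed
  have sc: "(INF i\<in>I. g i (t *\<^sub>R x)) \<le> t * (INF i\<in>I. g i x)" if tx: "t > 0" "x \<in> S" for t x
  proof -
    have "(INF i\<in>I. g i (t *\<^sub>R x)) / t \<le> (INF i\<in>I. g i x)"
    proof (rule cINF_greatest[OF I])
      fix i assume "i \<in> I"
      then obtain k where "k \<in> I" "g k (t *\<^sub>R x) \<le> t * g i x"
        using scale tx by blast
      then have "(INF i\<in>I. g i (t *\<^sub>R x)) \<le> t * g i x"
        using lower[of k "t *\<^sub>R x"] tx S by (meson order_trans subspace_scale)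
      then show "(INF i\<in>I. g i (t *\<^sub>R x)) / t \<le> g i x"
        using tx by (simp add: field_simps)
    qed
    then show ?thesis
      using that by (simp add: field_simps)
  qed
  have sc': "t * (INF i\<in>I. g i x) \<le> (INF i\<in>I. g i (t *\<^sub>R x))" if "t > 0" "x \<in> S" for t x
    using sc[of "1/t" "t *\<^sub>R x"] that S by (simp add: subspace_scale field_simps)
  have ad: "(INF i\<in>I. g i (x + y)) \<le> (INF i\<in>I. g i x) + (INF i\<in>I. g i y)"
    if "x \<in> S" "y \<in> S" for x y
  proof -
    have "(INF i\<in>I. g i (x + y)) - g j y \<le> (INF i\<in>I. g i x)" if j: "j \<in> I" for j
    proof (rule cINF_greatest[OF I])
      fix i assume "i \<in> I"
      then obtain k where "k \<in> I" "g k (x + y) \<le> g i x + g j y"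
        using add j \<open>x \<in> S\<close> \<open>y \<in> S\<close> by blast
      then show "(INF i\<in>I. g i (x + y)) - g j y \<le> g i x"
        using lower[of k "x + y"] \<open>x \<in> S\<close> \<open>y \<in> S\<close> S by (smt (verit) subspace_add)
    qed
    then have "(INF i\<in>I. g i (x + y)) - (INF i\<in>I. g i x) \<le> (INF i\<in>I. g i y)"
      by (intro cINF_greatest[OF I]) (smt (verit))
    then show ?thesis by simp
  qed
  show ?thesis
    unfolding sublinear_on_def
  proof (intro conjI ballI allI impI)
    fix t :: real and x assume "0 \<le> t" "x \<in> S"
    then show "(INF i\<in>I. g i (t *\<^sub>R x)) = t * (INF i\<in>I. g i x)"
      using z sc[of t x] sc'[of t x] by (cases "t = 0") auto
  qed (use ad in auto)
qed

text \<open>Hahn-Banach: Zorn's lemma gives a minimal sublinear function below \<open>p\<close>, and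
  minimality forces it to be odd, hence linear.\<close>

theorem sublinear_dominates_linear:
  assumes S: "subspace S" and p: "sublinear_on S p"
  obtains l where "functional_on S l" "\<And>x. x \<in> S \<Longrightarrow> l x \<le> p x"
proof -
  \<comment> \<open>Prescribing 0 off \<open>S\<close> makes equality of total functions the same as
    equality on \<open>S\<close>, so the pointwise order can be used directly.\<close>
  define A where "A = {q. sublinear_on S q \<and> (\<forall>x. x \<notin> S \<longrightarrow> q x = 0) \<and> (\<forall>x\<in>S. q x \<le> p x)}"
  define p0 where "p0 x = (if x \<in> S then p x else 0)" for x
  have p0: "p0 \<in> A"
    using p S by (auto simp: A_def p0_def sublinear_on_def subspace_add subspace_scale)
  have "\<exists>m\<in>A. \<forall>a\<in>A. a \<le> m \<longrightarrow> a = m"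
  proof (rule predicate_Zorn)
    show "partial_order_on A (relation_of (\<lambda>m a. a \<le> m) A)"
      by (auto simp: partial_order_on_def preorder_on_def refl_on_def relation_of_def trans_def
          antisym_def)
    fix C assume C: "C \<in> Chains (relation_of (\<lambda>m a::'a \<Rightarrow> real. a \<le> m) A)"
    then have CA: "C \<subseteq> A" and tot: "\<And>q r. q \<in> C \<Longrightarrow> r \<in> C \<Longrightarrow> q \<le> r \<or> r \<le> q"
      by (auto simp: Chains_def relation_of_def)
    show "\<exists>u\<in>A. \<forall>a\<in>C. u \<le> a"
    proof (cases "C = {}")
      case True
      then show ?thesis using p0 by blast
    next
      case False
      have low: "- p (- x) \<le> q x" if "q \<in> C" "x \<in> S" for q x
      proof -
        have "q \<in> A" using that CA by auto
        then have "- q (- x) \<le> q x" "q (- x) \<le> p (- x)"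
          using sublinear_on_neg_le[OF S, of q x] that S by (auto simp: A_def subspace_neg)
        then show ?thesis by simp
      qed
      have bdd: "bdd_below ((\<lambda>q. q x) ` C)" if "x \<in> S" for x
        using low that by (auto intro!: bdd_belowI[of _ "- p (- x)"])
      have sub: "sublinear_on S (\<lambda>x. INF q\<in>C. q x)"
      proof (rule sublinear_on_Inf[OF False S bdd])
        fix q r x y assume *: "q \<in> C" "r \<in> C" "x \<in> S" "y \<in> S"
        define m where "m = (if q \<le> r then q else r)"
        have m: "m \<in> C" "m \<le> q" "m \<le> r"
          using * tot[of q r] by (auto simp: m_def)
        have "m (x + y) \<le> m x + m y"
          using m CA * by (auto simp: A_def sublinear_on_def)
        also have "\<dots> \<le> q x + r y"
          using m by (intro add_mono) (auto simp: le_fun_def)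
        finally show "\<exists>k\<in>C. k (x + y) \<le> q x + r y" using m by blast
      next
        fix q t x assume "q \<in> C" "(t::real) > 0" "x \<in> S"
        then show "\<exists>k\<in>C. k (t *\<^sub>R x) \<le> t * q x"
          using CA by (intro bexI[of _ q]) (auto simp: A_def sublinear_on_def)
      next
        have z: "q 0 = 0" if "q \<in> C" for q
          using that CA sublinear_on_zero[OF S] by (auto simp: A_def)
        show "0 \<le> q 0" if "q \<in> C" for q using z[OF that] by simp
        show "\<exists>q\<in>C. q 0 = 0" using z False by blast
      qed auto
      define u where "u x = (INF q\<in>C. q x)" for x
      have le: "u x \<le> q x" if "q \<in> C" for q x
      proof (cases "x \<in> S")
        case True
        then show ?thesis unfolding u_def by (intro cINF_lower bdd) (use that in auto)
      next
        case False
        then have "u x = (INF q\<in>C. 0)" unfolding u_def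
          using CA by (intro INF_cong) (auto simp: A_def)
        then show ?thesis using False that CA \<open>C \<noteq> {}\<close> by (auto simp: A_def)
      qed
      have "u \<in> A"
        unfolding A_def
      proof (intro CollectI conjI allI impI ballI)
        show "sublinear_on S u" using sub by (simp add: u_def[abs_def])
        fix x show "u x = 0" if "x \<notin> S"
        proof -
          have "u x = (INF q\<in>C. 0)" unfolding u_def
            using CA that by (intro INF_cong) (auto simp: A_def)
          then show ?thesis using \<open>C \<noteq> {}\<close> by simp
        qed
        show "u x \<le> p x" if "x \<in> S"
        proof -
          obtain q where "q \<in> C" using False by auto
          then show ?thesis using le[of q x] CA that by (force simp: A_def)
        qed
      qed
      then show ?thesis using le by (auto simp: le_fun_def)
    qed
  qed
  then obtain q where q: "q \<in> A" and qmin: "\<And>a. a \<in> A \<Longrightarrow> a \<le> q \<Longrightarrow> a = q" by blast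
  have qs: "sublinear_on S q" and q0: "\<And>x. x \<notin> S \<Longrightarrow> q x = 0" and qp: "\<And>x. x \<in> S \<Longrightarrow> q x \<le> p x"
    using q by (auto simp: A_def)
  have odd: "q (- z) = - q z" if z: "z \<in> S" for z
  proof -
    \<comment> \<open>This lowers \<open>q\<close> in the direction \<open>z\<close>: the infimum
      over \<open>t\<close> is sublinear and at most \<open>q\<close> (take \<open>t = 0\<close>),
      so by minimality it equals \<open>q\<close>. Its term \<open>t = 1\<close> at
      \<open>- z\<close> is \<open>q 0 - q z\<close>, which gives
      \<open>q (- z) \<le> - q z\<close>.\<close>
    let ?g = "\<lambda>t x. q (x + t *\<^sub>R z) - t * q z"
    have low: "- q (- x) \<le> ?g t x" if "t \<ge> 0" "x \<in> S" for t x
      using sublinear_on_add[OF qs, of "x + t *\<^sub>R z" "- x"] sublinear_on_scale[OF qs z that(1)]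
        that z S by (simp add: subspace_add subspace_scale subspace_neg)
    have bdd: "bdd_below ((\<lambda>t. ?g t x) ` {0..})" if "x \<in> S" for x
      using low that by (auto intro!: bdd_belowI[of _ "- q (- x)"])
    have sub: "sublinear_on S (\<lambda>x. INF t\<in>{0..}. ?g t x)"
    proof (rule sublinear_on_Inf[OF _ S bdd])
      fix s t x y assume *: "s \<in> {0::real..}" "t \<in> {0::real..}" "x \<in> S" "y \<in> S"
      have "q ((x + s *\<^sub>R z) + (y + t *\<^sub>R z)) \<le> q (x + s *\<^sub>R z) + q (y + t *\<^sub>R z)"
        using * z S by (intro sublinear_on_add[OF qs]) (auto simp: subspace_add subspace_scale)
      then show "\<exists>k\<in>{0..}. ?g k (x + y) \<le> ?g s x + ?g t y"
        using * by (intro bexI[of _ "s + t"]) (auto simp: algebra_simps)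
    next
      fix s t x assume *: "s \<in> {0::real..}" "0 < (t::real)" "x \<in> S"
      have "q (t *\<^sub>R (x + s *\<^sub>R z)) = t * q (x + s *\<^sub>R z)"
        using * z S by (intro sublinear_on_scale[OF qs]) (auto simp: subspace_add subspace_scale)
      then show "\<exists>k\<in>{0..}. ?g k (t *\<^sub>R x) \<le> t * ?g s x"
        using * by (intro bexI[of _ "t * s"]) (auto simp: algebra_simps)
    next
      show "\<exists>t\<in>{0..}. ?g t 0 = 0"
        using sublinear_on_zero[OF S qs] by (intro bexI[of _ 0]) auto
      fix t :: real assume "t \<in> {0..}"
      then show "0 \<le> ?g t 0" using low[of t 0] sublinear_on_zero[OF S qs] S by (simp add: subspace_0)
    qed auto
    define u where "u x = (if x \<in> S then INF t\<in>{0..}. ?g t x else 0)" for x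
    have ule: "u x \<le> ?g t x" if "t \<ge> 0" "x \<in> S" for t x
      unfolding u_def using that by (auto intro!: cINF_lower bdd)
    have uq: "u \<le> q"
      using ule[of 0] q0 by (auto simp: le_fun_def u_def)
    have "sublinear_on S u"
      using sub S by (auto simp: sublinear_on_def u_def subspace_add subspace_scale)
    moreover have "u x \<le> p x" if "x \<in> S" for x
      using uq qp[OF that] by (meson le_funD order_trans)
    ultimately have "u \<in> A"
      by (auto simp: A_def u_def)
    then have "u = q" using qmin uq by blast
    then have "q (- z) \<le> - q z"
      using ule[of 1 "- z"] z S sublinear_on_zero[OF S qs] by (simp add: subspace_neg)
    then show ?thesis
      using sublinear_on_neg_le[OF S qs z] by simp
  qed
  have "functional_on S q"
    unfolding functional_on_def
  proof (intro conjI ballI allI)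
    fix x y assume xy: "x \<in> S" "y \<in> S"
    have "q (- x + - y) \<le> q (- x) + q (- y)"
      using xy S by (intro sublinear_on_add[OF qs]) (auto simp: subspace_neg)
    moreover have "q (- x + - y) = - q (x + y)"
      using odd[of "x + y"] xy S by (simp add: subspace_add)
    ultimately show "q (x + y) = q x + q y"
      using odd xy sublinear_on_add[OF qs xy] by simp
  next
    fix c x assume x: "x \<in> S"
    show "q (c *\<^sub>R x) = c * q x"
    proof (cases "c \<ge> 0")
      case True
      then show ?thesis using sublinear_on_scale[OF qs x] by simp
    next
      case False
      then have "q ((- c) *\<^sub>R x) = - c * q x" using sublinear_on_scale[OF qs x, of "- c"] by simp
      then show ?thesis using odd[of "c *\<^sub>R x"] x S by (simp add: subspace_scale)
    qed
  qed
  with qp that show ?thesis by blast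
qed

text \<open>The infimum over \<open>b\<close> encodes exactly the constraints on a coefficient \<open>\<lambda>\<close> and a
  linear \<open>\<alpha>\<close> with \<open>\<alpha> \<le> \<lambda> p\<close> and \<open>\<phi> - \<alpha> \<le> (1 - \<lambda>) q\<close>, so one dominated functional on
  \<open>S \<times> \<real>\<close> yields both.\<close>

lemma le_max_sublinear_split:
  assumes S: "subspace S" and p: "sublinear_on S p" and q: "sublinear_on S q"
    and f: "functional_on S f" and le: "\<And>x. x \<in> S \<Longrightarrow> f x \<le> max (p x) (q x)"
  obtains l \<alpha> where "0 \<le> l" "l \<le> 1" "functional_on S \<alpha>" "\<And>x. x \<in> S \<Longrightarrow> \<alpha> x \<le> l * p x"
    "\<And>x. x \<in> S \<Longrightarrow> f x - \<alpha> x \<le> (1 - l) * q x"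
proof -
  let ?W = "S \<times> (UNIV :: real set)"
  let ?g = "\<lambda>b (w::'a \<times> real). max (q b) (snd w + p (fst w + b)) - f b"
  have W: "subspace ?W" using S by (simp add: subspace_Times)
  have p0: "p 0 = 0" and q0: "q 0 = 0" and f0: "f 0 = 0"
    using S p q f by (auto intro: sublinear_on_zero functional_on_sublinear)
  have SI: "S \<noteq> {}" using S subspace_0 by auto
  have low: "- (\<bar>p (- fst w)\<bar> + \<bar>snd w\<bar>) \<le> ?g b w" if "w \<in> ?W" "b \<in> S" for b w
  proof -
    have "p ((fst w + b) + - fst w) \<le> p (fst w + b) + p (- fst w)"
      using that S by (intro sublinear_on_add[OF p]) (auto simp: subspace_add subspace_neg)
    then have "p b \<le> p (fst w + b) + \<bar>p (- fst w)\<bar>" by simp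
    moreover have "f b \<le> max (p b) (q b)" by (rule le) fact
    ultimately show ?thesis by (auto simp: max_def abs_if split: if_splits)
  qed
  have bdd: "bdd_below ((\<lambda>b. ?g b w) ` S)" if "w \<in> ?W" for w
    using low that by (auto intro!: bdd_belowI[of _ "- (\<bar>p (- fst w)\<bar> + \<bar>snd w\<bar>)"])
  have "sublinear_on ?W (\<lambda>w. INF b\<in>S. ?g b w)"
  proof (rule sublinear_on_Inf[OF SI W bdd])
    fix a b v w assume *: "a \<in> S" "b \<in> S" "v \<in> ?W" "w \<in> ?W"
    have "q (a + b) \<le> q a + q b" using * by (intro sublinear_on_add[OF q]) auto
    moreover have "p ((fst v + a) + (fst w + b)) \<le> p (fst v + a) + p (fst w + b)"
      using * S by (intro sublinear_on_add[OF p]) (auto simp: subspace_add)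
    ultimately have "?g (a + b) (v + w) \<le> ?g a v + ?g b w"
      using functional_on_add[OF f *(1,2)]
      by (auto simp: max_def algebra_simps split: if_splits)
    then show "\<exists>k\<in>S. ?g k (v + w) \<le> ?g a v + ?g b w"
      using * S by (intro bexI[of _ "a + b"]) (auto simp: subspace_add)
  next
    fix b t w assume *: "b \<in> S" "0 < (t::real)" "w \<in> ?W"
    have "q (t *\<^sub>R b) = t * q b" using * by (intro sublinear_on_scale[OF q]) auto
    moreover have "p (t *\<^sub>R (fst w + b)) = t * p (fst w + b)"
      using * S by (intro sublinear_on_scale[OF p]) (auto simp: subspace_add)
    ultimately have "?g (t *\<^sub>R b) (t *\<^sub>R w) = t * ?g b w"
      using * functional_on_scale[OF f, of b t]
      by (simp add: right_diff_distrib max_mult_distrib_left scaleR_add_right distrib_left)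
    then show "\<exists>k\<in>S. ?g k (t *\<^sub>R w) \<le> t * ?g b w"
      using * S by (intro bexI[of _ "t *\<^sub>R b"]) (auto simp: subspace_scale)
  next
    show "\<exists>b\<in>S. ?g b 0 = 0"
      using p0 q0 f0 subspace_0[OF S] by (intro bexI[of _ 0]) auto
    fix b assume "b \<in> S"
    then show "0 \<le> ?g b 0" using le[of b] by (simp add: max.commute)
  qed auto
  then obtain L where L: "functional_on ?W L"
    and Lle: "\<And>w. w \<in> ?W \<Longrightarrow> L w \<le> (INF b\<in>S. ?g b w)"
    using sublinear_dominates_linear[OF W] by blast
  have Lg: "L w \<le> ?g b w" if "w \<in> ?W" "b \<in> S" for w b
    using Lle[OF that(1)] cINF_lower[OF bdd[OF that(1)] that(2)] by linarith
  define l where "l = L (0, 1)"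
  define \<alpha> where "\<alpha> x = L (x, 0)" for x
  have dec: "L (x, t) = \<alpha> x + t * l" if "x \<in> S" for x t
    using functional_on_add[OF L, of "(x, 0)" "t *\<^sub>R (0, 1)"]
      functional_on_scale[OF L, of "(0, 1)" t] that S
    by (simp add: l_def \<alpha>_def subspace_0)
  have S0: "0 \<in> S" using S by (rule subspace_0)
  show ?thesis
  proof (rule that)
    show \<alpha>: "functional_on S \<alpha>"
      unfolding functional_on_def
    proof (intro conjI ballI allI)
      fix x y assume "x \<in> S" "y \<in> S"
      then show "\<alpha> (x + y) = \<alpha> x + \<alpha> y"
        using functional_on_add[OF L, of "(x, 0)" "(y, 0)"] by (simp add: \<alpha>_def)
    next
      fix c x assume "x \<in> S"
      then show "\<alpha> (c *\<^sub>R x) = c * \<alpha> x"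
        using functional_on_scale[OF L, of "(x, 0)" c] by (simp add: \<alpha>_def)
    qed
    have \<alpha>0: "\<alpha> 0 = 0"
      using sublinear_on_zero[OF S functional_on_sublinear[OF \<alpha>]] .
    show "l \<le> 1" "0 \<le> l"
      using Lg[of "(0, 1)" 0] Lg[of "(0, -1)" 0] dec[OF S0, of 1] dec[OF S0, of "-1"] \<alpha>0 S0 p0 q0 f0
      by auto
    fix x assume x: "x \<in> S"
    \<comment> \<open>Both bounds evaluate \<open>L\<close> at a point and a \<open>b\<close> for
      which the two entries of the maximum coincide.\<close>
    show "\<alpha> x \<le> l * p x"
      using Lg[of "(x, - p x)" 0] dec[OF x, of "- p x"] x S0 q0 f0 by (simp add: algebra_simps)
    show "f x - \<alpha> x \<le> (1 - l) * q x"
      using Lg[of "(- x, q x)" x] dec[of "- x" "q x"] x S p0 functional_on_neg[OF \<alpha> x]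
      by (simp add: subspace_neg algebra_simps)
  qed
qed

text \<open>A functional below the infimum of \<open>norm (x + t *\<^sub>R c) - t * d\<close> is
  bounded by the norm (take \<open>t = 0\<close>), and at \<open>- c\<close> with
  \<open>t = 1\<close> it is at most \<open>- d\<close>. Convexity of \<open>C\<close> merges two
  nonnegative multiples of its points into one.\<close>

corollary separate_convex_from_zero:
  fixes C :: "'a::real_normed_vector set"
  assumes "convex C" and "C \<noteq> {}" and d: "\<And>c. c \<in> C \<Longrightarrow> d \<le> norm c"
  obtains f :: "'a \<Rightarrow>\<^sub>L real" where "norm f \<le> 1" "\<And>c. c \<in> C \<Longrightarrow> d \<le> f c"
proof -
  let ?I = "C \<times> {0::real..}"
  let ?g = "\<lambda>(c, t) x. norm (x + t *\<^sub>R c) - t * d"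
  have I: "?I \<noteq> {}" using assms by auto
  have low: "- norm x \<le> ?g i x" if i: "i \<in> ?I" for i x
  proof -
    obtain c t where i': "i = (c, t)" "c \<in> C" "t \<ge> 0" using i by auto
    have "t * d \<le> t * norm c" using i' d by (simp add: mult_left_mono)
    also have "\<dots> = norm ((x + t *\<^sub>R c) - x)" using i' by simp
    also have "\<dots> \<le> norm (x + t *\<^sub>R c) + norm x" by (rule norm_triangle_ineq4)
    finally show ?thesis using i' by simp
  qed
  have bdd: "bdd_below ((\<lambda>i. ?g i x) ` ?I)" for x
    using low by (auto intro!: bdd_belowI[of _ "- norm x"])
  have "sublinear_on UNIV (\<lambda>x. INF i\<in>?I. ?g i x)"
  proof (rule sublinear_on_Inf[OF I subspace_UNIV bdd])
    fix i j x y assume ij: "i \<in> ?I" "j \<in> ?I"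
    obtain c s where i: "i = (c, s)" "c \<in> C" "s \<ge> 0" using ij by auto
    obtain e t where j: "j = (e, t)" "e \<in> C" "t \<ge> 0" using ij by auto
    have "\<exists>m\<in>C. (s + t) *\<^sub>R m = s *\<^sub>R c + t *\<^sub>R e"
    proof (cases "s + t = 0")
      case True
      then have "s = 0" "t = 0" using i j by auto
      then show ?thesis using i by auto
    next
      case False
      then have "s + t > 0" using i j by simp
      let ?m = "(s / (s + t)) *\<^sub>R c + (t / (s + t)) *\<^sub>R e"
      have "s / (s + t) + t / (s + t) = 1"
        using \<open>s + t > 0\<close> by (simp add: add_divide_distrib[symmetric])
      then have "?m \<in> C"
        using i j \<open>s + t > 0\<close> by (intro convexD[OF \<open>convex C\<close>]) simp_all
      moreover have "(s + t) *\<^sub>R ?m = s *\<^sub>R c + t *\<^sub>R e"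
        using \<open>s + t > 0\<close> by (simp add: scaleR_add_right)
      ultimately show ?thesis by blast
    qed
    then obtain m where m: "m \<in> C" "(s + t) *\<^sub>R m = s *\<^sub>R c + t *\<^sub>R e" by blast
    have "norm (x + y + (s + t) *\<^sub>R m) \<le> norm (x + s *\<^sub>R c) + norm (y + t *\<^sub>R e)"
      unfolding m using norm_triangle_ineq[of "x + s *\<^sub>R c" "y + t *\<^sub>R e"] by (simp add: algebra_simps)
    then have "?g (m, s + t) (x + y) \<le> ?g i x + ?g j y"
      unfolding i j prod.case distrib_right by linarith
    moreover have "(m, s + t) \<in> ?I" using i j m by simp
    ultimately show "\<exists>k\<in>?I. ?g k (x + y) \<le> ?g i x + ?g j y" by blast
  next
    fix i t x assume i: "i \<in> ?I" and t: "0 < (t::real)"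
    obtain c s where i: "i = (c, s)" "c \<in> C" "s \<ge> 0" using i by auto
    have "norm (t *\<^sub>R x + (t * s) *\<^sub>R c) = t * norm (x + s *\<^sub>R c)"
      using t norm_scaleR[of t "x + s *\<^sub>R c"] by (simp add: scaleR_add_right)
    then have "?g (c, t * s) (t *\<^sub>R x) = t * ?g i x"
      unfolding i prod.case by (simp add: right_diff_distrib)
    moreover have "(c, t * s) \<in> ?I" using i t by simp
    ultimately show "\<exists>k\<in>?I. ?g k (t *\<^sub>R x) \<le> t * ?g i x"
      by (intro bexI[of _ "(c, t * s)"]) auto
  next
    fix i assume "i \<in> ?I" then show "0 \<le> ?g i 0" using low[of i 0] by simp
  next
    obtain c where "c \<in> C" using assms by blast
    then show "\<exists>i\<in>?I. ?g i 0 = 0" by (intro bexI[of _ "(c, 0)"]) auto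
  qed
  then obtain l where l: "functional_on UNIV l"
    and le': "\<And>x. x \<in> UNIV \<Longrightarrow> l x \<le> (INF i\<in>?I. ?g i x)"
    using sublinear_dominates_linear[OF subspace_UNIV] by blast
  note le = le'[OF UNIV_I]
  have lg: "l x \<le> ?g i x" if "i \<in> ?I" for i x
    using le[of x] cINF_lower[OF bdd that, of x] by linarith
  obtain c0 where c0: "c0 \<in> C" using assms by blast
  have ln: "l x \<le> norm x" for x using lg[of "(c0, 0)" x] c0 by simp
  have labs: "\<bar>l x\<bar> \<le> norm x" for x
    using ln[of x] ln[of "- x"] functional_on_neg[OF l, of x] by auto
  have bl: "bounded_linear l"
    using l labs by (intro bounded_linear_intro[of _ 1]) (auto simp: functional_on_def)
  show ?thesis
  proof (rule that[of "Blinfun l"])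
    show "norm (Blinfun l) \<le> 1"
      using labs by (intro norm_blinfun_bound) (auto simp: bounded_linear_Blinfun_apply[OF bl])
    fix c assume "c \<in> C"
    then show "d \<le> Blinfun l c"
      using lg[of "(c, 1)" "- c"] functional_on_neg[OF l, of c]
      by (simp add: bounded_linear_Blinfun_apply[OF bl])
  qed
qed

corollary norming_functional:
  fixes x :: "'a::real_normed_vector"
  obtains f :: "'a \<Rightarrow>\<^sub>L real" where "norm f \<le> 1" "f x = norm x"
proof -
  obtain f :: "'a \<Rightarrow>\<^sub>L real" where f: "norm f \<le> 1" "norm x \<le> f x"
    using separate_convex_from_zero[of "{x}" "norm x"] by auto
  have "f x \<le> norm f * norm x" using norm_blinfun[of f x] by simp
  also have "\<dots> \<le> norm x" using f by (simp add: mult_left_le_one_le)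
  finally show ?thesis using f that by force
qed

section \<open>The Krein-Milman and Milman theorems for dual balls\<close>

lemma compact_closed_fun:
  fixes K :: "('a \<Rightarrow> 'b::t2_space) set"
  assumes "compact K"
  shows "closed K"
proof -
  have "Hausdorff_space (euclidean :: 'b topology)"
    unfolding Hausdorff_space_def
  proof (intro allI impI)
    fix x y :: 'b
    assume "x \<in> topspace euclidean \<and> y \<in> topspace euclidean \<and> x \<noteq> y"
    then obtain U V where "open U" "open V" "x \<in> U" "y \<in> V" "U \<inter> V = {}"
      using hausdorff[of x y] by auto
    then show "\<exists>U V. openin euclidean U \<and> openin euclidean V \<and> x \<in> U \<and> y \<in> V \<and> disjnt U V"
      by (auto simp: disjnt_def)
  qed
  then have "Hausdorff_space (product_topology (\<lambda>_::'a. euclidean :: 'b topology) UNIV)"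
    by (simp add: Hausdorff_space_product_topology)
  then have "Hausdorff_space (euclidean :: ('a \<Rightarrow> 'b) topology)"
    by (simp add: euclidean_product_topology)
  then show ?thesis
    using assms compactin_imp_closedin[of euclidean K] by simp
qed

lemma continuous_on_eval [continuous_intros]:
  "continuous_on A (\<lambda>f :: 'a \<Rightarrow> 'b::topological_space. f i)"
  by (rule continuous_on_subset[OF continuous_on_product_coordinates]) simp

lemma compact_box: "compact (PiE UNIV (\<lambda>a. {- r a..r a :: real}))"
proof -
  have "compactin (product_topology (\<lambda>_. euclidean) UNIV) (PiE UNIV (\<lambda>a. {- r a..r a}))"
    by (simp add: compactin_PiE)
  then show ?thesis by (simp add: euclidean_product_topology)
qed

lemma minimal_set_exists:
  assumes "\<F> \<noteq> {}"
    and "\<And>\<C>. \<C> \<noteq> {} \<Longrightarrow> subset.chain \<F> \<C> \<Longrightarrow> \<Inter>\<C> \<in> \<F>"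
  obtains F where "F \<in> \<F>" "\<And>X. X \<in> \<F> \<Longrightarrow> X \<subseteq> F \<Longrightarrow> X = F"
proof -
  have "\<exists>m\<in>\<F>. \<forall>a\<in>\<F>. a \<subseteq> m \<longrightarrow> a = m"
  proof (rule predicate_Zorn)
    show "partial_order_on \<F> (relation_of (\<lambda>m a. a \<subseteq> m) \<F>)"
      by (auto simp: partial_order_on_def preorder_on_def refl_on_def relation_of_def trans_def
          antisym_def)
    fix C assume C: "C \<in> Chains (relation_of (\<lambda>m a. a \<subseteq> m) \<F>)"
    then have ch: "subset.chain \<F> C"
      by (auto simp: Chains_def relation_of_def subset_chain_def)
    show "\<exists>u\<in>\<F>. \<forall>a\<in>C. u \<subseteq> a"
      using assms(2)[OF _ ch] assms(1) by (cases "C = {}") auto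
  qed
  then show ?thesis using that by blast
qed

lemma compact_chain_Inter:
  assumes K: "compact K" and ne: "\<C> \<noteq> {}"
    and tot: "\<And>X Y. X \<in> \<C> \<Longrightarrow> Y \<in> \<C> \<Longrightarrow> X \<subseteq> Y \<or> Y \<subseteq> X"
    and "\<And>F. F \<in> \<C> \<Longrightarrow> closed F \<and> F \<noteq> {} \<and> F \<subseteq> K"
  shows "\<Inter>\<C> \<noteq> {}"
proof -
  have "K \<inter> \<Inter>\<C> \<noteq> {}"
  proof (rule compact_imp_fip[OF K])
    fix F' assume F': "finite F'" "F' \<subseteq> \<C>"
    show "K \<inter> \<Inter>F' \<noteq> {}"
    proof (cases "F' = {}")
      case True
      then show ?thesis using ne assms(4) by blast
    next
      case False
      have "subset.chain UNIV F'"
        unfolding subset_chain_def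
      proof (intro conjI ballI)
        fix X Y assume "X \<in> F'" "Y \<in> F'"
        then show "X \<subseteq> Y \<or> Y \<subseteq> X" by (intro tot) (use F' in auto)
      qed simp
      then have "\<Inter>F' \<in> F'" using F' False by (intro Inter_in_chain)
      then show ?thesis using F' assms(4) by blast
    qed
  qed (use assms in auto)
  then show ?thesis by blast
qed

lemma onorm_on_bound:
  assumes S: "subspace S" and f: "bounded_linear_map_on S f" and a: "a \<in> S"
  shows "norm (f a) \<le> onorm_on S f * norm a"
proof (cases "a = 0")
  case True
  then have "f a = 0 *\<^sub>R f a" using f a by (metis bounded_linear_map_on_def scaleR_zero_left)
  then show ?thesis using True by simp
next
  case False
  obtain B where B: "\<And>x. x \<in> S \<Longrightarrow> norm (f x) \<le> B * norm x"
    using f by (force simp: bounded_linear_map_on_def)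
  have bdd: "bdd_above ((\<lambda>x. norm (f x)) ` (S \<inter> cball 0 1))"
  proof (rule bdd_aboveI2)
    fix x assume x: "x \<in> S \<inter> cball 0 1"
    have "norm (f x) \<le> B * norm x" using B x by blast
    also have "\<dots> \<le> \<bar>B\<bar> * norm x" by (intro mult_right_mono) auto
    also have "\<dots> \<le> \<bar>B\<bar>" using x by (simp add: mult_left_le)
    finally show "norm (f x) \<le> \<bar>B\<bar>" .
  qed
  have "norm (f ((1 / norm a) *\<^sub>R a)) \<le> onorm_on S f"
    unfolding onorm_on_def using a S False by (intro cSUP_upper bdd) (auto simp: subspace_scale)
  moreover have "f ((1 / norm a) *\<^sub>R a) = (1 / norm a) *\<^sub>R f a"
    using f a by (simp add: bounded_linear_map_on_def)
  ultimately show ?thesis using False by (simp add: field_simps)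
qed

text \<open>A one-sided bound suffices because \<open>S\<close> is symmetric. In this form each
  condition involves only finitely many values of \<open>\<phi>\<close>, as the compactness proof
  requires.\<close>

lemma dual_ball_iff:
  assumes S: "subspace S"
  shows "\<phi> \<in> dual_ball S \<longleftrightarrow>
    functional_on S \<phi> \<and> (\<forall>a. a \<notin> S \<longrightarrow> \<phi> a = 0) \<and> (\<forall>a\<in>S. \<phi> a \<le> norm a)"
    (is "?L \<longleftrightarrow> ?R")
proof
  assume L: ?L
  then have lin: "functional_on S \<phi>" and out: "\<forall>a. a \<notin> S \<longrightarrow> \<phi> a = 0"
    and le1: "onorm_on S \<phi> \<le> 1"
    by (auto simp: dual_ball_def dual_of_def bounded_linear_map_on_def functional_on_def)
  have bl: "bounded_linear_map_on S \<phi>" using L by (simp add: dual_ball_def dual_of_def)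
  have "\<phi> a \<le> norm a" if a: "a \<in> S" for a
  proof -
    have "\<bar>\<phi> a\<bar> \<le> onorm_on S \<phi> * norm a" using onorm_on_bound[OF S bl a] by simp
    also have "\<dots> \<le> 1 * norm a" using le1 by (intro mult_right_mono) auto
    finally show ?thesis by simp
  qed
  then show ?R using lin out by blast
next
  assume R: ?R
  then have lin: "functional_on S \<phi>" by blast
  have ab: "norm (\<phi> a) \<le> norm a" if "a \<in> S" for a
  proof -
    have "\<phi> a \<le> norm a" "\<phi> (- a) \<le> norm (- a)" using R that subspace_neg[OF S that] by blast+
    then show ?thesis using functional_on_neg[OF lin that] by (simp add: abs_le_iff)
  qed
  have "onorm_on S \<phi> \<le> 1"
    unfolding onorm_on_def
  proof (rule cSUP_least)
    show "S \<inter> cball 0 1 \<noteq> {}" using subspace_0[OF S] by auto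
    fix x assume "x \<in> S \<inter> cball 0 1"
    then show "norm (\<phi> x) \<le> 1" using ab[of x] by simp
  qed
  moreover have "\<exists>B. \<forall>x\<in>S. norm (\<phi> x) \<le> B * norm x" using ab by (intro exI[of _ 1]) auto
  ultimately show ?L using R
    by (auto simp: dual_ball_def dual_of_def bounded_linear_map_on_def functional_on_def)
qed

lemma
  assumes S: "subspace S" and f: "\<phi> \<in> dual_ball S"
  shows dual_ball_linear: "functional_on S \<phi>"
    and dual_ball_outside: "a \<notin> S \<Longrightarrow> \<phi> a = 0"
    and dual_ball_le: "a \<in> S \<Longrightarrow> \<phi> a \<le> norm a"
    and dual_ball_abs_le: "a \<in> S \<Longrightarrow> \<bar>\<phi> a\<bar> \<le> norm a"
proof -
  show lin: "functional_on S \<phi>" and "a \<notin> S \<Longrightarrow> \<phi> a = 0"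
    and le: "a \<in> S \<Longrightarrow> \<phi> a \<le> norm a" for a
    using f by (auto simp: dual_ball_iff[OF S])
  show "a \<in> S \<Longrightarrow> \<bar>\<phi> a\<bar> \<le> norm a"
    using le[of a] le[of "- a"] functional_on_neg[OF lin, of a] S by (auto simp: subspace_neg)
qed

text \<open>Banach-Alaoglu: functions carry the topology of pointwise convergence, which on the dual
  ball is the weak-star topology. Linearity and vanishing off \<open>S\<close> are closed conditions
  inside a product of compact intervals.\<close>

lemma compact_dual_ball:
  fixes S :: "'a::real_normed_vector set"
  assumes S: "subspace S"
  shows "compact (dual_ball S)"
proof -
  let ?B = "PiE UNIV (\<lambda>a::'a. {- norm a..norm a})"
  have B: "compact ?B" by (rule compact_box)
  have "dual_ball S = ?B \<inter>
      ((\<Inter>x\<in>S. \<Inter>y\<in>S. {\<phi>. \<phi> (x + y) = \<phi> x + \<phi> y}) \<inter> (\<Inter>c. \<Inter>x\<in>S. {\<phi>. \<phi> (c *\<^sub>R x) = c * \<phi> x})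
        \<inter> (\<Inter>a\<in>-S. {\<phi>. \<phi> a = 0}))"
    (is "_ = ?B \<inter> ?C")
  proof (intro equalityI subsetI)
    fix \<phi> assume f: "\<phi> \<in> dual_ball S"
    have "\<bar>\<phi> a\<bar> \<le> norm a" for a
      using dual_ball_abs_le[OF S f, of a] dual_ball_outside[OF S f, of a] by (cases "a \<in> S") auto
    then have "- norm a \<le> \<phi> a \<and> \<phi> a \<le> norm a" for a by (simp only: abs_le_iff minus_le_iff)
    then have "\<phi> \<in> ?B" by (simp add: PiE_UNIV_domain)
    then show "\<phi> \<in> ?B \<inter> ?C"
      using f by (auto simp: dual_ball_iff[OF S] functional_on_def)
  next
    fix \<phi> assume "\<phi> \<in> ?B \<inter> ?C"
    then show "\<phi> \<in> dual_ball S"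
      by (auto simp: dual_ball_iff[OF S] functional_on_def PiE_UNIV_domain Pi_def)
  qed
  moreover have "closed ?C"
    by (intro closed_Int closed_INT ballI closed_Collect_eq continuous_intros)
  ultimately show ?thesis
    using B by (simp add: compact_Int_closed)
qed

lemma convex_dual_ball:
  fixes S :: "'a::real_normed_vector set"
  assumes S: "subspace S"
  shows "convex (dual_ball S)"
proof (rule convexI)
  fix \<phi> \<psi> :: "'a \<Rightarrow> real" and u v :: real
  assume f: "\<phi> \<in> dual_ball S" and g: "\<psi> \<in> dual_ball S" and uv: "0 \<le> u" "0 \<le> v" "u + v = 1"
  have "u * \<phi> a + v * \<psi> a \<le> norm a" if "a \<in> S" for a
    by (rule convex_bound_le[OF dual_ball_le[OF S f that] dual_ball_le[OF S g that] uv])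
  then show "u *\<^sub>R \<phi> + v *\<^sub>R \<psi> \<in> dual_ball S"
    using f g by (auto simp: dual_ball_iff[OF S] functional_on_def scaleR_fun_def algebra_simps)
qed

text \<open>\<open>L\<close> is only asked to be affine on \<open>F\<close>. This matters because it
  will be a limit in the bidual, which need not be weak-star continuous; closedness of the face is
  then a separate question.\<close>

lemma face_of_maximum:
  assumes F: "convex F" and le: "\<And>x. x \<in> F \<Longrightarrow> L x \<le> (m::real)"
    and aff: "\<And>x y u. x \<in> F \<Longrightarrow> y \<in> F \<Longrightarrow> 0 \<le> u \<Longrightarrow> u \<le> 1 \<Longrightarrow>
      L ((1 - u) *\<^sub>R x + u *\<^sub>R y) = (1 - u) * L x + u * L y"
  shows "{x\<in>F. L x = m} face_of F"
  unfolding face_of_def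
proof (intro conjI ballI impI)
  show "convex {x\<in>F. L x = m}"
    unfolding convex_alt
  proof (intro ballI allI impI CollectI)
    fix x y u assume "x \<in> {x\<in>F. L x = m}" "y \<in> {x\<in>F. L x = m}" "0 \<le> (u::real) \<and> u \<le> 1"
    then show "(1 - u) *\<^sub>R x + u *\<^sub>R y \<in> F \<and> L ((1 - u) *\<^sub>R x + u *\<^sub>R y) = m"
      using aff[of x y u] F by (auto simp: convex_alt algebra_simps)
  qed
  fix a b x assume ab: "a \<in> F" "b \<in> F" "x \<in> {x\<in>F. L x = m}" "x \<in> open_segment a b"
  then obtain u where u: "0 < u" "u < 1" "x = (1 - u) *\<^sub>R a + u *\<^sub>R b" by (auto simp: in_segment)
  have eq: "(1 - u) * (m - L a) + u * (m - L b) = 0"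
    using aff[of a b u] u(1,2) ab(1-3) unfolding u(3) by (simp add: algebra_simps)
  have "(1 - u) * (m - L a) \<ge> 0" "u * (m - L b) \<ge> 0"
    using u le[of a] le[of b] ab by auto
  then have "(1 - u) * (m - L a) = 0" "u * (m - L b) = 0" using eq by linarith+
  then show "a \<in> {x\<in>F. L x = m}" "b \<in> {x\<in>F. L x = m}" using u ab by auto
qed auto

text \<open>Compactness provides a minimal closed face inside \<open>\<Phi>\<close>. Every
  evaluation is constant on it, since the points where an evaluation is largest form a closed face
  again; so it consists of a single point.\<close>

theorem closed_face_has_extreme_point:
  fixes S :: "'a::real_normed_vector set"
  assumes S: "subspace S" and \<Phi>: "\<Phi> face_of dual_ball S" "closed \<Phi>" "\<Phi> \<noteq> {}"
  obtains \<phi> where "\<phi> \<in> \<Phi>" "\<phi> extreme_point_of dual_ball S"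
proof -
  let ?D = "dual_ball S"
  have D: "compact ?D" by (rule compact_dual_ball[OF S])
  define \<F> where "\<F> = {F. F face_of ?D \<and> closed F \<and> F \<noteq> {} \<and> F \<subseteq> \<Phi>}"
  obtain F where F: "F \<in> \<F>" and Fmin: "\<And>X. X \<in> \<F> \<Longrightarrow> X \<subseteq> F \<Longrightarrow> X = F"
  proof (rule minimal_set_exists[of \<F>])
    show "\<F> \<noteq> {}" using \<Phi> by (auto simp: \<F>_def)
    fix \<C> assume C: "\<C> \<noteq> {}" "subset.chain \<F> \<C>"
    then have sub: "\<C> \<subseteq> \<F>" by (auto simp: subset_chain_def)
    have "\<Inter>\<C> \<noteq> {}"
    proof (rule compact_chain_Inter[OF D C(1)])
      show "X \<subseteq> Y \<or> Y \<subseteq> X" if "X \<in> \<C>" "Y \<in> \<C>" for X Y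
        using C(2) that by (simp add: subset_chain_def)
      show "closed F \<and> F \<noteq> {} \<and> F \<subseteq> ?D" if "F \<in> \<C>" for F
        using sub that face_of_imp_subset by (auto simp: \<F>_def)
    qed
    moreover have "\<Inter>\<C> face_of ?D" using sub C by (intro face_of_Inter) (auto simp: \<F>_def)
    moreover have "closed (\<Inter>\<C>)" "\<Inter>\<C> \<subseteq> \<Phi>" using sub C by (auto simp: \<F>_def)
    ultimately show "\<Inter>\<C> \<in> \<F>" by (simp add: \<F>_def)
  qed blast
  have face: "F face_of ?D" and cl: "closed F" and "F \<noteq> {}" and "F \<subseteq> \<Phi>" using F by (auto simp: \<F>_def)
  have cF: "compact F"
    using D cl face_of_imp_subset[OF face] by (metis compact_Int_closed inf.absorb_iff2)
  obtain \<phi> where p: "\<phi> \<in> F" using \<open>F \<noteq> {}\<close> by blast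
  have no: "\<not> \<xi> a < \<psi> a" if "\<xi> \<in> F" "\<psi> \<in> F" for \<xi> \<psi> a
  proof
    assume less: "\<xi> a < \<psi> a"
    obtain \<theta> where t: "\<theta> \<in> F" "\<And>\<eta>. \<eta> \<in> F \<Longrightarrow> \<eta> a \<le> \<theta> a"
      using continuous_attains_sup[OF cF \<open>F \<noteq> {}\<close> continuous_on_eval[of _ a]] by blast
    have "{\<eta>\<in>F. \<eta> a = \<theta> a} face_of F"
      using t face_of_imp_convex[OF face]
      by (intro face_of_maximum[where L = "\<lambda>\<eta>. \<eta> a"]) (auto simp: scaleR_fun_def)
    then have 1: "{\<eta>\<in>F. \<eta> a = \<theta> a} face_of ?D" using face face_of_trans by blast
    have "{\<eta>\<in>F. \<eta> a = \<theta> a} = F \<inter> {\<eta>. \<eta> a = \<theta> a}" by auto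
    moreover have "closed {\<eta>. \<eta> a = \<theta> a}" by (intro closed_Collect_eq continuous_intros)
    ultimately have 2: "closed {\<eta>\<in>F. \<eta> a = \<theta> a}" using cl by (simp add: closed_Int)
    have "{\<eta>\<in>F. \<eta> a = \<theta> a} \<in> \<F>" using 1 2 t \<open>F \<subseteq> \<Phi>\<close> by (auto simp: \<F>_def)
    then have "{\<eta>\<in>F. \<eta> a = \<theta> a} = F" by (rule Fmin) auto
    then have "\<xi> a = \<theta> a" using that by blast
    then show False using that less t(2)[of \<psi>] by simp
  qed
  have "F = {\<phi>}"
  proof (intro equalityI subsetI)
    fix \<psi> assume s: "\<psi> \<in> F"
    show "\<psi> \<in> {\<phi>}" using no[OF p s] no[OF s p] by (auto simp: fun_eq_iff intro: linorder_cases)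
  qed (use p in auto)
  then show ?thesis using face p \<open>F \<subseteq> \<Phi>\<close> that by (auto simp: face_of_singleton)
qed

text \<open>\<open>p\<close> is the support function of \<open>F\<close>. That it is attained turns
  a bound by \<open>p\<close> into a bound by a member of \<open>F\<close>.\<close>

lemma compact_sup_sublinear:
  assumes S: "subspace S" and F: "compact F" "F \<noteq> {}" "F \<subseteq> dual_ball S"
  obtains p where "sublinear_on S p" "\<And>\<xi> a. \<xi> \<in> F \<Longrightarrow> \<xi> a \<le> p a" "\<And>a. \<exists>\<xi>\<in>F. p a = \<xi> a"
proof -
  have "\<exists>\<xi>\<in>F. \<forall>\<eta>\<in>F. \<eta> a \<le> \<xi> a" for a
    using continuous_attains_sup[OF F(1,2) continuous_on_eval[of _ a]] by blast
  then obtain X where X: "\<And>a. X a \<in> F" "\<And>a \<eta>. \<eta> \<in> F \<Longrightarrow> \<eta> a \<le> X a a" by metis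
  have lin: "functional_on S \<xi>" if "\<xi> \<in> F" for \<xi>
    using that F dual_ball_linear[OF S] by blast
  have "sublinear_on S (\<lambda>a. X a a)"
    unfolding sublinear_on_def
  proof (intro conjI ballI allI impI)
    fix x y assume "x \<in> S" "y \<in> S"
    then have "X (x + y) (x + y) = X (x + y) x + X (x + y) y"
      by (rule functional_on_add[OF lin[OF X(1)]])
    then show "X (x + y) (x + y) \<le> X x x + X y y"
      using X(2)[OF X(1), of "x + y" x] X(2)[OF X(1), of "x + y" y] by linarith
  next
    fix t :: real and x assume t: "0 \<le> t" and x: "x \<in> S"
    have sc: "\<xi> (t *\<^sub>R x) = t * \<xi> x" if "\<xi> \<in> F" for \<xi>
      using lin[OF that] x by (simp add: functional_on_scale)
    show "X (t *\<^sub>R x) (t *\<^sub>R x) = t * X x x"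
    proof (rule antisym)
      show "X (t *\<^sub>R x) (t *\<^sub>R x) \<le> t * X x x"
        using X t by (simp add: sc mult_left_mono)
      show "t * X x x \<le> X (t *\<^sub>R x) (t *\<^sub>R x)"
        using X(2)[OF X(1)[of x], of "t *\<^sub>R x"] by (simp add: sc X(1))
    qed
  qed
  then show ?thesis using that X by blast
qed

text \<open>Milman's theorem. Take a minimal closed part \<open>F\<close> of \<open>M\<close> whose
  support function dominates \<open>\<phi>\<close>. If two members of \<open>F\<close> differ at
  some \<open>a\<close>, cut \<open>F\<close> into two closed halves there: \<open>\<phi>\<close> is
  dominated by the maximum of their support functions, hence is a convex combination of functionals
  dominated by one each. Extremality puts \<open>\<phi>\<close> below one of them, against
  minimality. So \<open>F\<close> is a single functional, and a linear \<open>\<phi>\<close> below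
  it equals it.\<close>

theorem extreme_point_in_norming_set:
  fixes S :: "'a::real_normed_vector set"
  assumes S: "subspace S" and M: "closed M" "M \<subseteq> dual_ball S"
    and norming: "\<And>a. a \<in> S \<Longrightarrow> \<exists>\<xi>\<in>M. norm a \<le> \<xi> a"
    and ext: "\<phi> extreme_point_of dual_ball S"
  shows "\<phi> \<in> M"
proof -
  let ?D = "dual_ball S"
  have D: "compact ?D" by (rule compact_dual_ball[OF S])
  have fD: "\<phi> \<in> ?D" using ext by (simp add: extreme_point_of_def)
  have flin: "functional_on S \<phi>" by (rule dual_ball_linear[OF S fD])
  define \<F> where "\<F> = {F. closed F \<and> F \<subseteq> M \<and> (\<forall>a\<in>S. \<exists>\<xi>\<in>F. \<phi> a \<le> \<xi> a)}"
  have cpt: "compact F" if "closed F" "F \<subseteq> M" for F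
    using D that M by (metis compact_Int_closed inf.absorb_iff2 order_trans)
  obtain F where F: "F \<in> \<F>" and Fmin: "\<And>X. X \<in> \<F> \<Longrightarrow> X \<subseteq> F \<Longrightarrow> X = F"
  proof (rule minimal_set_exists[of \<F>])
    have "\<exists>\<xi>\<in>M. \<phi> a \<le> \<xi> a" if "a \<in> S" for a
      using norming[OF that] dual_ball_le[OF S fD that] by (meson order_trans)
    then show "\<F> \<noteq> {}" using M by (auto simp: \<F>_def)
    fix \<C> assume C: "\<C> \<noteq> {}" "subset.chain \<F> \<C>"
    then have sub: "\<C> \<subseteq> \<F>" by (auto simp: subset_chain_def)
    have "\<exists>\<xi>\<in>\<Inter>\<C>. \<phi> a \<le> \<xi> a" if a: "a \<in> S" for a
    proof -
      let ?C = "(\<lambda>F. F \<inter> {\<xi>. \<phi> a \<le> \<xi> a}) ` \<C>"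
      have "\<Inter>?C \<noteq> {}"
      proof (rule compact_chain_Inter[OF D])
        show "?C \<noteq> {}" using C by auto
        fix X Y assume "X \<in> ?C" "Y \<in> ?C"
        then obtain F G where FG: "F \<in> \<C>" "G \<in> \<C>"
          "X = F \<inter> {\<xi>. \<phi> a \<le> \<xi> a}" "Y = G \<inter> {\<xi>. \<phi> a \<le> \<xi> a}" by auto
        then have "F \<subseteq> G \<or> G \<subseteq> F" using C(2) by (simp add: subset_chain_def)
        then show "X \<subseteq> Y \<or> Y \<subseteq> X" unfolding FG by auto
      next
        fix X assume "X \<in> ?C"
        then obtain F where FX: "F \<in> \<F>" "X = F \<inter> {\<xi>. \<phi> a \<le> \<xi> a}" using sub by auto
        have "closed {\<xi>. \<phi> a \<le> \<xi> a}" by (intro closed_Collect_le continuous_intros)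
        then show "closed X \<and> X \<noteq> {} \<and> X \<subseteq> ?D"
          using FX a M by (auto simp: \<F>_def intro!: closed_Int)
      qed
      then show ?thesis using C by auto
    qed
    moreover have "closed (\<Inter>\<C>)" "\<Inter>\<C> \<subseteq> M" using sub C by (auto simp: \<F>_def)
    ultimately show "\<Inter>\<C> \<in> \<F>" by (simp add: \<F>_def)
  qed blast
  have cl: "closed F" and FM: "F \<subseteq> M" and Fle: "\<And>a. a \<in> S \<Longrightarrow> \<exists>\<xi>\<in>F. \<phi> a \<le> \<xi> a"
    using F by (auto simp: \<F>_def)
  obtain \<xi> where c: "\<xi> \<in> F" using Fle[OF subspace_0[OF S]] by blast
  have no: "\<not> \<theta> a < \<eta> a" if \<theta>\<eta>: "\<theta> \<in> F" "\<eta> \<in> F" for \<theta> \<eta> a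
  proof
    assume less: "\<theta> a < \<eta> a"
    let ?t = "(\<theta> a + \<eta> a) / 2"
    let ?F1 = "F \<inter> {\<xi>. \<xi> a \<le> ?t}" and ?F2 = "F \<inter> {\<xi>. ?t \<le> \<xi> a}"
    have cl12: "closed ?F1" "closed ?F2"
      using cl by (auto intro!: closed_Int closed_Collect_le continuous_intros)
    have ne: "?F1 \<noteq> {}" "?F2 \<noteq> {}" "?F1 \<noteq> F" "?F2 \<noteq> F"
      using \<theta>\<eta> less by (auto simp: field_simps) (force)+
    have M12: "?F1 \<subseteq> M" "?F2 \<subseteq> M" using FM by auto
    then have D12: "?F1 \<subseteq> ?D" "?F2 \<subseteq> ?D" using M by auto
    obtain p where p: "sublinear_on S p" "\<And>\<xi> a. \<xi> \<in> ?F1 \<Longrightarrow> \<xi> a \<le> p a" "\<And>a. \<exists>\<xi>\<in>?F1. p a = \<xi> a"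
      using compact_sup_sublinear[OF S cpt[OF cl12(1) M12(1)] ne(1) D12(1)] by blast
    obtain q where q: "sublinear_on S q" "\<And>\<xi> a. \<xi> \<in> ?F2 \<Longrightarrow> \<xi> a \<le> q a" "\<And>a. \<exists>\<xi>\<in>?F2. q a = \<xi> a"
      using compact_sup_sublinear[OF S cpt[OF cl12(2) M12(2)] ne(2) D12(2)] by blast
    have le: "\<phi> x \<le> max (p x) (q x)" if x: "x \<in> S" for x
    proof -
      obtain \<xi> where "\<xi> \<in> F" "\<phi> x \<le> \<xi> x" using Fle[OF x] by blast
      then show ?thesis using p(2)[of \<xi> x] q(2)[of \<xi> x] by (cases "\<xi> a \<le> ?t") auto
    qed
    have pn: "p x \<le> norm x" "q x \<le> norm x" if "x \<in> S" for x
      using p(3)[of x] q(3)[of x] D12 dual_ball_le[OF S _ that] by fastforce+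
    obtain l \<alpha> where l: "0 \<le> l" "l \<le> 1" and \<alpha>: "functional_on S \<alpha>"
      and \<alpha>p: "\<And>x. x \<in> S \<Longrightarrow> \<alpha> x \<le> l * p x" and \<alpha>q: "\<And>x. x \<in> S \<Longrightarrow> \<phi> x - \<alpha> x \<le> (1 - l) * q x"
      using le_max_sublinear_split[OF S p(1) q(1) flin le] by blast
    have "(\<forall>x\<in>S. \<phi> x \<le> p x) \<or> (\<forall>x\<in>S. \<phi> x \<le> q x)"
    proof -
      consider "l = 0" | "l = 1" | "0 < l" "l < 1" using l by linarith
      then show ?thesis
      proof cases
        case 1
        have "\<phi> x \<le> q x" if "x \<in> S" for x
          using \<alpha>p[OF that] \<alpha>q[OF that] 1 by simp
        then show ?thesis by blast
      next
        case 2
        have "\<phi> x \<le> p x" if "x \<in> S" for x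
          using \<alpha>q[OF that] \<alpha>p[OF that] 2 by simp
        then show ?thesis by blast
      next
        case 3
        \<comment> \<open>These are the two summands of the decomposition, normalized. They lie in
          the dual ball because \<open>p\<close> and \<open>q\<close> are support functions of
          subsets of the ball and so are bounded by the norm.\<close>
        define f1 where "f1 x = (if x \<in> S then \<alpha> x / l else 0)" for x
        define f2 where "f2 x = (if x \<in> S then (\<phi> x - \<alpha> x) / (1 - l) else 0)" for x
        have le1: "f1 x \<le> p x" and le2: "f2 x \<le> q x" if "x \<in> S" for x
          using \<alpha>p[OF that] \<alpha>q[OF that] 3 that by (simp_all add: f1_def f2_def field_simps)
        have "functional_on S f1"
          using S \<alpha> by (auto simp: f1_def functional_on_def subspace_add subspace_scale
              add_divide_distrib)
        moreover have "f1 x \<le> norm x" if "x \<in> S" for x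
          using le1[OF that] pn(1)[OF that] by (rule order_trans)
        ultimately have "f1 \<in> ?D" by (simp add: dual_ball_iff[OF S] f1_def)
        have "functional_on S f2"
          using S \<alpha> flin by (auto simp: f2_def functional_on_def subspace_add subspace_scale
              add_divide_distrib diff_divide_distrib right_diff_distrib)
        then have "f2 \<in> ?D"
          using order_trans[OF le2 pn(2)] by (simp add: dual_ball_iff[OF S] f2_def)
        have dec: "\<phi> = (1 - l) *\<^sub>R f2 + l *\<^sub>R f1"
          using 3 dual_ball_outside[OF S fD] by (auto simp: fun_eq_iff scaleR_fun_def f1_def f2_def)
        have eq: "f1 = f2"
        proof (rule ccontr)
          assume "f1 \<noteq> f2"
          then have "\<phi> \<in> open_segment f2 f1" using dec 3 by (auto simp: in_segment)
          then show False using ext \<open>f1 \<in> ?D\<close> \<open>f2 \<in> ?D\<close> by (auto simp: extreme_point_of_def)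
        qed
        have "\<phi> = f1"
          using dec eq by (simp add: fun_eq_iff scaleR_fun_def algebra_simps)
        then show ?thesis using le1 by blast
      qed
    qed
    then have "?F1 \<in> \<F> \<or> ?F2 \<in> \<F>"
    proof (elim disjE)
      assume "\<forall>x\<in>S. \<phi> x \<le> p x"
      then have "\<exists>\<xi>\<in>?F1. \<phi> x \<le> \<xi> x" if "x \<in> S" for x
        using p(3)[of x] that by force
      then show ?thesis using cl12 M12 by (simp add: \<F>_def)
    next
      assume "\<forall>x\<in>S. \<phi> x \<le> q x"
      then have "\<exists>\<xi>\<in>?F2. \<phi> x \<le> \<xi> x" if "x \<in> S" for x
        using q(3)[of x] that by force
      then show ?thesis using cl12 M12 by (simp add: \<F>_def)
    qed
    then show False using Fmin[of ?F1] Fmin[of ?F2] ne by blast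
  qed
  have F1: "F = {\<xi>}"
  proof (intro equalityI subsetI)
    fix \<psi> assume s: "\<psi> \<in> F"
    show "\<psi> \<in> {\<xi>}" using no[OF c s] no[OF s c] by (auto simp: fun_eq_iff intro: linorder_cases)
  qed (use c in auto)
  have cD: "\<xi> \<in> ?D" using c FM M by blast
  have le: "\<phi> a \<le> \<xi> a" if "a \<in> S" for a using Fle[OF that] F1 by simp
  have "\<phi> a = \<xi> a" for a
  proof (cases "a \<in> S")
    case True
    then show ?thesis
      using le[of a] le[of "- a"] functional_on_neg[OF flin True]
        functional_on_neg[OF dual_ball_linear[OF S cD] True] S by (simp add: subspace_neg)
  next
    case False
    then show ?thesis using dual_ball_outside[OF S] fD cD by metis
  qed
  then have "\<phi> = \<xi>" by (simp add: fun_eq_iff)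
  then show ?thesis using c FM by blast
qed

section \<open>Extreme functionals and the Choquet boundary\<close>

declare plus_bcontfun.rep_eq [simp] minus_bcontfun.rep_eq [simp] scaleR_bcontfun.rep_eq [simp]
declare continuous_on_apply_bcontfun [continuous_intros]

section \<open>Functions vanishing at infinity and the scalar function space\<close>

lemma C0_attains_norm:
  fixes f :: "'k::topological_space \<Rightarrow>\<^sub>C 'e::real_normed_vector"
  assumes "f \<in> C0"
  obtains x where "norm (f x) = norm f"
proof (cases "f = 0")
  case True
  then show ?thesis using that by simp
next
  case False
  then have pos: "norm f / 2 > 0" by simp
  then obtain C where C: "compact C" "\<And>x. x \<notin> C \<Longrightarrow> norm (f x) < norm f / 2"
    using assms unfolding C0_def by blast
  have "C \<noteq> {}"
  proof
    assume "C = {}"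
    then have "norm f \<le> norm f / 2" using C(2) by (intro norm_bound) (auto intro: less_imp_le)
    then show False using pos by simp
  qed
  then obtain x where x: "x \<in> C" "\<And>z. z \<in> C \<Longrightarrow> norm (f z) \<le> norm (f x)"
    using continuous_attains_sup[OF C(1), of "\<lambda>z. norm (f z)"]
    by (auto intro!: continuous_intros)
  have "norm f \<le> max (norm (f x)) (norm f / 2)"
  proof (rule norm_bound)
    fix z show "norm (f z) \<le> max (norm (f x)) (norm f / 2)"
      using x(2)[of z] C(2)[of z] by (cases "z \<in> C") auto
  qed
  then have "norm f \<le> norm (f x)" using pos by (auto simp: max_def split: if_splits)
  then show ?thesis using that[of x] norm_bounded[of f x] by simp
qed

text \<open>Domination up to an arbitrary error, by a function whose values may lie in another
  space, treats scalar multiples, uniform limits and scalarizations in one argument.\<close>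

lemma C0_dominated:
  fixes f :: "'k::topological_space \<Rightarrow>\<^sub>C 'e::real_normed_vector"
  assumes dom: "\<And>\<epsilon>. 0 < \<epsilon> \<Longrightarrow>
      \<exists>g\<in>C0 :: ('k \<Rightarrow>\<^sub>C 'd::real_normed_vector) set. \<forall>x. norm (f x) \<le> K * norm (g x) + \<epsilon>" and K: "0 \<le> K"
  shows "f \<in> C0"
  unfolding C0_def
proof (intro CollectI allI impI)
  fix \<epsilon> :: real assume \<epsilon>: "0 < \<epsilon>"
  define \<eta> where "\<eta> = \<epsilon> / (2 * (K + 1))"
  have \<eta>: "0 < \<eta>" "\<eta> * (K + 1) = \<epsilon> / 2" using \<epsilon> K by (auto simp: \<eta>_def field_simps)
  obtain g :: "'k \<Rightarrow>\<^sub>C 'd" where g: "g \<in> C0" "\<And>x. norm (f x) \<le> K * norm (g x) + \<epsilon> / 2"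
    using dom[of "\<epsilon> / 2"] \<epsilon> by auto
  then obtain C where C: "compact C" "\<And>x. x \<notin> C \<Longrightarrow> norm (g x) < \<eta>"
    using \<eta>(1) unfolding C0_def by blast
  have "norm (f x) < \<epsilon>" if "x \<notin> C" for x
  proof -
    have "K * norm (g x) \<le> K * \<eta>" using C(2)[OF that] K by (intro mult_left_mono) auto
    then show ?thesis using g(2)[of x] \<eta> by (simp add: algebra_simps)
  qed
  then show "\<exists>C. compact C \<and> (\<forall>x. x \<notin> C \<longrightarrow> norm (f x) < \<epsilon>)" using C by blast
qed

lemma subspace_C0: "subspace (C0 :: ('k::topological_space \<Rightarrow>\<^sub>C 'e::real_normed_vector) set)"
proof (rule subspaceI)
  show "0 \<in> (C0 :: ('k \<Rightarrow>\<^sub>C 'e) set)"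
    by (auto simp: C0_def intro!: exI[of _ "{}"])
next
  fix f g :: "'k \<Rightarrow>\<^sub>C 'e" assume f: "f \<in> C0" and g: "g \<in> C0"
  show "f + g \<in> C0"
    unfolding C0_def
  proof (intro CollectI allI impI)
    fix \<eta> :: real assume "0 < \<eta>"
    then obtain C D where C: "compact C" "\<And>x. x \<notin> C \<Longrightarrow> norm (f x) < \<eta> / 2"
      and D: "compact D" "\<And>x. x \<notin> D \<Longrightarrow> norm (g x) < \<eta> / 2"
      using f g half_gt_zero unfolding C0_def by blast
    have "norm ((f + g) x) < \<eta>" if "x \<notin> C \<union> D" for x
      using C(2)[of x] D(2)[of x] that norm_triangle_ineq[of "f x" "g x"]
      by simp
    then show "\<exists>C. compact C \<and> (\<forall>x. x \<notin> C \<longrightarrow> norm ((f + g) x) < \<eta>)"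
      using C D compact_Un by blast
  qed
next
  fix c :: real and f :: "'k \<Rightarrow>\<^sub>C 'e" assume f: "f \<in> C0"
  show "c *\<^sub>R f \<in> C0"
  proof (rule C0_dominated[where 'd = 'e and K = "\<bar>c\<bar>"])
    fix \<eta> :: real assume "0 < \<eta>"
    then have "norm ((c *\<^sub>R f) x) \<le> \<bar>c\<bar> * norm (f x) + \<eta>" for x by simp
    with f show "\<exists>g\<in>C0 :: ('k \<Rightarrow>\<^sub>C 'e) set. \<forall>x. norm ((c *\<^sub>R f) x) \<le> \<bar>c\<bar> * norm (g x) + \<eta>" by blast
  qed simp
qed

lemma closed_C0: "closed (C0 :: ('k::topological_space \<Rightarrow>\<^sub>C 'e::real_normed_vector) set)"
proof -
  have "f \<in> C0" if f: "f \<in> closure C0" for f :: "'k \<Rightarrow>\<^sub>C 'e"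
  proof (rule C0_dominated[where 'd = 'e and K = 1])
    fix \<eta> :: real assume "0 < \<eta>"
    then obtain g where g: "g \<in> C0" "dist g f < \<eta>"
      using f unfolding closure_approachable by blast
    have "norm (f x) \<le> 1 * norm (g x) + \<eta>" for x
      using g(2) dist_bounded[of g x f] norm_triangle_sub[of "f x" "g x"]
      by (simp add: dist_norm norm_minus_commute)
    then show "\<exists>g\<in>C0 :: ('k \<Rightarrow>\<^sub>C 'e) set. \<forall>x. norm (f x) \<le> 1 * norm (g x) + \<eta>"
      using g(1) by blast
  qed simp
  then show ?thesis using closure_subset_eq by blast
qed

lemma abs_blinfun_le: "norm e \<le> 1 \<Longrightarrow> \<bar>e v\<bar> \<le> norm v" for e :: "'e::real_normed_vector \<Rightarrow>\<^sub>L real"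
  using norm_blinfun[of e v] mult_right_mono[of "norm e" 1 "norm v"] by simp

lemma norm_scalarize_le: "norm e \<le> 1 \<Longrightarrow> norm (scalarize e h) \<le> norm h"
  by (rule norm_bound) (auto intro: order_trans[OF abs_blinfun_le] norm_bounded)

lemma scalarize_C0:
  fixes h :: "'k::topological_space \<Rightarrow>\<^sub>C 'e::real_normed_vector"
  assumes "h \<in> C0"
  shows "scalarize e h \<in> C0"
proof (rule C0_dominated[where 'd = 'e and K = "norm e"])
  fix \<eta> :: real assume "0 < \<eta>"
  then have "norm (scalarize e h x) \<le> norm e * norm (h x) + \<eta>" for x
    using norm_blinfun[of e "h x"] by simp
  then show "\<exists>g\<in>C0 :: ('k \<Rightarrow>\<^sub>C 'e) set. \<forall>x. norm (scalarize e h x) \<le> norm e * norm (g x) + \<eta>"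
    using assms by blast
qed simp

lemma subspace_closure:
  fixes S :: "'a::real_normed_vector set"
  assumes S: "subspace S"
  shows "subspace (closure S)"
proof (rule subspaceI)
  show "0 \<in> closure S" using subspace_0[OF S] closure_subset by blast
next
  fix x y assume "x \<in> closure S" "y \<in> closure S"
  then obtain f g where fg: "\<And>n. f n \<in> S" "f \<longlonglongrightarrow> x" "\<And>n. g n \<in> S" "g \<longlonglongrightarrow> y"
    unfolding closure_sequential by blast
  have "\<forall>n. f n + g n \<in> S" using fg S by (simp add: subspace_add)
  moreover have "(\<lambda>n. f n + g n) \<longlonglongrightarrow> x + y" using fg by (intro tendsto_add)
  ultimately show "x + y \<in> closure S" unfolding closure_sequential by (intro exI conjI)
next
  fix c x assume "x \<in> closure S"
  then obtain f where f: "\<And>n. f n \<in> S" "f \<longlonglongrightarrow> x"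
    unfolding closure_sequential by blast
  have "\<forall>n. c *\<^sub>R f n \<in> S" using f S by (simp add: subspace_scale)
  moreover have "(\<lambda>n. c *\<^sub>R f n) \<longlonglongrightarrow> c *\<^sub>R x" using f by (intro tendsto_intros)
  ultimately show "c *\<^sub>R x \<in> closure S" unfolding closure_sequential by (intro exI conjI)
qed

lemma subspace_scalar_space: "subspace (scalar_space H)"
  unfolding scalar_space_def by (intro subspace_closure subspace_span)

lemma closed_scalar_space: "closed (scalar_space H)"
  by (simp add: scalar_space_def)

lemma scalarize_in: "h \<in> H \<Longrightarrow> scalarize e h \<in> scalar_space H"
  unfolding scalar_space_def by (rule closure_subset[THEN subsetD], rule span_base) blast

lemma scalar_space_C0: "H \<subseteq> C0 \<Longrightarrow> scalar_space H \<subseteq> C0"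
  unfolding scalar_space_def
  by (intro closure_minimal span_minimal subspace_C0 closed_C0) (auto intro: scalarize_C0)

text \<open>The functional e^* tensor delta_y on \<open>S\<close>, with the value 0 off
  \<open>S\<close> that \<open>dual_of\<close> prescribes.\<close>

definition eval_at ::
    "('k::topological_space \<Rightarrow>\<^sub>C 'e::real_normed_vector) set \<Rightarrow> ('e \<Rightarrow>\<^sub>L real) \<Rightarrow> 'k \<Rightarrow> ('k \<Rightarrow>\<^sub>C 'e) \<Rightarrow> real" where
  "eval_at S e y = (\<lambda>f. if f \<in> S then e (f y) else 0)"

lemma eval_at_dual_ball:
  assumes S: "subspace S" and e: "norm e \<le> 1"
  shows "eval_at S e y \<in> dual_ball S"
  unfolding dual_ball_iff[OF S]
proof (intro conjI allI impI ballI)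
  show "functional_on S (eval_at S e y)"
    using S by (auto simp: functional_on_def eval_at_def subspace_add subspace_scale
        blinfun.add_right blinfun.scaleR_right)
  fix a assume "a \<in> S"
  then show "eval_at S e y a \<le> norm a"
    using abs_blinfun_le[OF e, of "a y"] norm_bounded[of a y]
    by (simp add: eval_at_def)
qed (simp add: eval_at_def)

text \<open>The pairing of \<open>b\<close> and \<open>f y\<close> is jointly continuous on the dual
  ball, since \<open>b\<close> moves \<open>f y'\<close> and \<open>f y\<close> apart by at most
  \<open>norm (f y' - f y)\<close>, uniformly in \<open>b\<close>. Hence the set is a continuous
  image of a product of two compact sets.\<close>

lemma compact_eval_at:
  fixes S :: "('k::topological_space \<Rightarrow>\<^sub>C 'e::real_normed_vector) set"
  assumes C: "compact C"
  shows "compact {eval_at S e y | e y. norm e \<le> 1 \<and> y \<in> C}"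
proof -
  let ?B = "dual_ball (UNIV :: 'e set)"
  let ?G = "\<lambda>z :: ('e \<Rightarrow> real) \<times> 'k. \<lambda>f. if f \<in> S then fst z (f (snd z)) else 0"
  have lin: "functional_on UNIV b" and ab: "\<bar>b v\<bar> \<le> norm v" if "b \<in> ?B" for b and v :: 'e
    using dual_ball_linear[OF subspace_UNIV that] dual_ball_abs_le[OF subspace_UNIV that] by auto
  have "continuous_on (?B \<times> C) ?G"
  proof (rule continuous_on_coordinatewise_then_product)
    fix f
    show "continuous_on (?B \<times> C) (\<lambda>z. ?G z f)"
    proof (cases "f \<in> S")
      case True
      have "((\<lambda>z. fst z (f (snd z))) \<longlongrightarrow> b (f y))
          (at (b, y) within ?B \<times> C)" for b y
      proof -
        let ?F = "at (b, y) within ?B \<times> C"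
        have "((\<lambda>z. snd z) \<longlongrightarrow> y) ?F" by (rule tendsto_eq_intros | simp)+
        then have "((\<lambda>z. f (snd z)) \<longlongrightarrow> f y) ?F"
          using continuous_on_tendsto_compose[OF continuous_on_apply_bcontfun[of UNIV f]] by simp
        then have "((\<lambda>z. f (snd z) - f y) \<longlongrightarrow> 0) ?F"
          by (rule LIM_zero)
        moreover have "eventually (\<lambda>z. norm (fst z (f (snd z) - f y))
            \<le> norm (f (snd z) - f y)) ?F"
          by (auto simp: eventually_at_filter ab intro!: always_eventually)
        ultimately have 1: "((\<lambda>z. fst z (f (snd z) - f y)) \<longlongrightarrow> 0) ?F"
          using Lim_null_comparison[OF _ tendsto_norm_zero] by fast
        have "((\<lambda>z. fst z) \<longlongrightarrow> b) ?F" by (rule tendsto_eq_intros | simp)+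
        then have 2: "((\<lambda>z. fst z (f y)) \<longlongrightarrow> b (f y)) ?F"
          using continuous_on_tendsto_compose[OF continuous_on_eval[of UNIV "f y"]] by simp
        have 3: "eventually (\<lambda>z. fst z (f (snd z) - f y)
            + fst z (f y) = fst z (f (snd z))) ?F"
          unfolding eventually_at_filter
          by (rule always_eventually) (auto simp: functional_on_diff[OF subspace_UNIV lin])
        show ?thesis
          using Lim_transform_eventually[OF tendsto_add[OF 1 2] 3] by simp
      qed
      then show ?thesis using True by (auto simp: continuous_on_def)
    qed simp
  qed
  then have "compact (?G ` (?B \<times> C))"
    by (intro compact_continuous_image compact_Times C compact_dual_ball subspace_UNIV)
  moreover have "?G ` (?B \<times> C) = {eval_at S e y | e y. norm e \<le> 1 \<and> y \<in> C}"
  proof (intro equalityI subsetI)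
    fix g assume "g \<in> ?G ` (?B \<times> C)"
    then obtain b y where b: "b \<in> ?B" "y \<in> C" "g = ?G (b, y)" by auto
    have bl: "bounded_linear b"
      using lin[OF b(1)] ab[OF b(1)]
      by (intro bounded_linear_intro[of _ 1]) (auto simp: functional_on_def)
    have "norm (Blinfun b) \<le> 1"
      using ab[OF b(1)] by (intro norm_blinfun_bound) (auto simp: bounded_linear_Blinfun_apply[OF bl])
    moreover have "g = eval_at S (Blinfun b) y"
      by (auto simp: b(3) fun_eq_iff eval_at_def bounded_linear_Blinfun_apply[OF bl])
    ultimately show "g \<in> {eval_at S e y | e y. norm e \<le> 1 \<and> y \<in> C}" using b by blast
  next
    fix g assume "g \<in> {eval_at S e y | e y. norm e \<le> 1 \<and> y \<in> C}"
    then obtain e y where e: "norm e \<le> 1" "y \<in> C" "g = eval_at S e y" by auto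
    have "blinfun_apply e \<in> ?B"
      using abs_blinfun_le[OF e(1)]
      by (auto simp: dual_ball_iff functional_on_def blinfun.add_right blinfun.scaleR_right
          intro: order_trans[OF abs_ge_self])
    then show "g \<in> ?G ` (?B \<times> C)"
      using e by (intro image_eqI[of _ _ "(blinfun_apply e, y)"]) (auto simp: eval_at_def)
  qed
  ultimately show ?thesis by simp
qed

text \<open>By Milman's theorem \<open>\<phi>\<close> is a limit of evaluations. If
  \<open>\<phi> f\<close> is not 0, evaluations near \<open>\<phi>\<close> exceed half its modulus
  at \<open>f\<close>, so their points stay in a compact set, and the evaluations at points of a
  compact set already form a closed set.\<close>

lemma extreme_functional_is_eval:
  fixes S :: "('k::topological_space \<Rightarrow>\<^sub>C 'e::real_normed_vector) set"
  assumes S: "subspace S" and C0: "S \<subseteq> C0" and ext: "\<phi> extreme_point_of dual_ball S" and ne: "\<phi> \<noteq> 0"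
  obtains e y where "norm e \<le> 1" "\<phi> = eval_at S e y"
proof -
  let ?N = "{eval_at S e y | e y. norm e \<le> 1 \<and> y \<in> UNIV}"
  have ND: "?N \<subseteq> dual_ball S" using eval_at_dual_ball[OF S] by blast
  have "\<phi> \<in> closure ?N"
  proof (rule extreme_point_in_norming_set[OF S _ _ _ ext])
    show "closure ?N \<subseteq> dual_ball S"
      by (rule closure_minimal[OF ND compact_closed_fun[OF compact_dual_ball[OF S]]])
    fix a assume a: "a \<in> S"
    obtain y where y: "norm (a y) = norm a" using C0_attains_norm a C0 by blast
    obtain e where e: "norm e \<le> 1" "blinfun_apply e (a y) = norm (a y)"
      using norming_functional by blast
    have "eval_at S e y \<in> ?N" using e by blast
    moreover have "norm a \<le> eval_at S e y a" using a e y by (simp add: eval_at_def)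
    ultimately show "\<exists>\<xi>\<in>closure ?N. norm a \<le> \<xi> a"
      by (intro bexI[of _ "eval_at S e y"] subsetD[OF closure_subset])
  qed simp
  obtain f where f: "\<phi> f \<noteq> 0" using ne by (auto simp: fun_eq_iff)
  have fS: "f \<in> S" using f ext dual_ball_outside[OF S] by (auto simp: extreme_point_of_def)
  have d: "\<bar>\<phi> f\<bar> / 2 > 0" using f by simp
  then obtain C where C: "compact C" "\<And>x. x \<notin> C \<Longrightarrow> norm (f x) < \<bar>\<phi> f\<bar> / 2"
    using fS C0 unfolding C0_def by blast
  let ?K = "{eval_at S e y | e y. norm e \<le> 1 \<and> y \<in> C}"
  let ?W = "{\<xi>. \<bar>\<phi> f\<bar> / 2 < \<bar>\<xi> f\<bar>}"
  have W: "open ?W" by (intro open_Collect_less continuous_intros)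
  have "\<phi> \<in> ?W \<inter> closure ?N" using \<open>\<phi> \<in> closure ?N\<close> d by auto
  then have "\<phi> \<in> closure (?W \<inter> ?N)" using open_Int_closure_subset[OF W] by blast
  moreover have "?W \<inter> ?N \<subseteq> ?K"
  proof
    fix g assume "g \<in> ?W \<inter> ?N"
    then obtain e y where e: "norm e \<le> 1" "g = eval_at S e y" "\<bar>\<phi> f\<bar> / 2 < \<bar>g f\<bar>" by auto
    have "\<bar>g f\<bar> \<le> norm (f y)"
      using e abs_blinfun_le fS by (simp add: eval_at_def)
    then have "y \<in> C" using C(2)[of y] e(3) by force
    then show "g \<in> ?K" using e by blast
  qed
  ultimately have "\<phi> \<in> closure ?K" using closure_mono by blast
  moreover have "closure ?K = ?K"
    by (rule closure_closed[OF compact_closed_fun[OF compact_eval_at[OF C(1)]]])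
  ultimately have "\<phi> \<in> ?K" by (simp only:)
  then show ?thesis using that by blast
qed

lemma uminus_dual_ball: "subspace S \<Longrightarrow> \<phi> \<in> dual_ball S \<Longrightarrow> - \<phi> \<in> dual_ball S"
  using dual_ball_abs_le[of S \<phi>] by (auto simp: dual_ball_iff functional_on_def abs_le_iff)

text \<open>The image of a segment through a preimage of \<open>\<phi>\<close> is a segment through
  \<open>\<phi>\<close>; extremality collapses it to a point, so the ends are preimages too.\<close>

lemma face_of_preimage:
  assumes D: "convex D" and ext: "\<phi> extreme_point_of D'" and R: "\<And>\<sigma>. \<sigma> \<in> D \<Longrightarrow> R \<sigma> \<in> D'"
    and aff: "\<And>\<alpha> \<beta> u. R ((1 - u) *\<^sub>R \<alpha> + u *\<^sub>R \<beta>) = (1 - u) *\<^sub>R R \<alpha> + u *\<^sub>R R \<beta>"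
  shows "{\<sigma>\<in>D. R \<sigma> = \<phi>} face_of D"
  unfolding face_of_def
proof (intro conjI ballI impI)
  show "convex {\<sigma>\<in>D. R \<sigma> = \<phi>}"
    unfolding convex_alt
  proof (intro ballI allI impI)
    fix \<alpha> \<beta> and u :: real
    assume ab: "\<alpha> \<in> {\<sigma>\<in>D. R \<sigma> = \<phi>}" "\<beta> \<in> {\<sigma>\<in>D. R \<sigma> = \<phi>}" and u: "0 \<le> u \<and> u \<le> 1"
    then have "(1 - u) *\<^sub>R \<alpha> + u *\<^sub>R \<beta> \<in> D" using D by (simp add: convex_alt)
    moreover have "R ((1 - u) *\<^sub>R \<alpha> + u *\<^sub>R \<beta>) = (1 - u) *\<^sub>R \<phi> + u *\<^sub>R \<phi>" using ab aff by simp
    ultimately show "(1 - u) *\<^sub>R \<alpha> + u *\<^sub>R \<beta> \<in> {\<sigma>\<in>D. R \<sigma> = \<phi>}"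
      by (simp add: scaleR_left_diff_distrib)
  qed
  fix \<alpha> \<beta> \<sigma> assume ab: "\<alpha> \<in> D" "\<beta> \<in> D" and s: "\<sigma> \<in> {\<sigma>\<in>D. R \<sigma> = \<phi>}" "\<sigma> \<in> open_segment \<alpha> \<beta>"
  then obtain u where u: "0 < u" "u < 1" "\<sigma> = (1 - u) *\<^sub>R \<alpha> + u *\<^sub>R \<beta>" by (auto simp: in_segment)
  have dec: "\<phi> = (1 - u) *\<^sub>R R \<alpha> + u *\<^sub>R R \<beta>" using s(1) by (simp add: u(3) aff)
  have eq: "R \<alpha> = R \<beta>"
  proof (rule ccontr)
    assume "R \<alpha> \<noteq> R \<beta>"
    then have "\<phi> \<in> open_segment (R \<alpha>) (R \<beta>)" using dec u by (auto simp: in_segment)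
    then show False using ext R ab by (auto simp: extreme_point_of_def)
  qed
  then have "\<phi> = R \<alpha>" using dec by (simp add: scaleR_left_diff_distrib)
  then show "\<alpha> \<in> {\<sigma>\<in>D. R \<sigma> = \<phi>}" "\<beta> \<in> {\<sigma>\<in>D. R \<sigma> = \<phi>}" using ab eq by auto
qed auto

lemma eval_functional_dual_ball:
  assumes "subspace A"
  shows "eval_functional A y \<in> dual_ball A"
proof -
  have "norm (blinfun_scaleR_left (1::real)) \<le> 1" by (intro norm_blinfun_bound) auto
  from eval_at_dual_ball[OF assms this, of y] show ?thesis
    by (simp add: eval_at_def eval_functional_def cong: if_cong)
qed

text \<open>An extreme point of the face is an evaluation at some \<open>y0\<close>, but
  \<open>y0\<close> itself need not lie in the Choquet boundary, which is defined through the scalar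
  space. The point is therefore exchanged: among the functionals on the scalar space that represent
  the same \<open>\<phi>\<close> there is an extreme one, and it is plus or minus an evaluation at a
  boundary point.\<close>

theorem closed_face_meets_choquet_boundary:
  fixes H :: "('k::topological_space \<Rightarrow>\<^sub>C 'e::real_normed_vector) set"
  assumes H: "subspace H" "H \<subseteq> C0"
    and \<Phi>: "\<Phi> face_of dual_ball H" "closed \<Phi>" "\<Phi> \<noteq> {}" "0 \<notin> \<Phi>"
  obtains e y where "y \<in> choquet_boundary H" "norm e \<le> 1" "eval_at H e y \<in> \<Phi>"
proof -
  let ?A = "scalar_space H"
  have A: "subspace ?A" "?A \<subseteq> C0" using subspace_scalar_space scalar_space_C0[OF H(2)] by auto
  obtain \<phi> where p: "\<phi> \<in> \<Phi>" "\<phi> extreme_point_of dual_ball H"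
    using closed_face_has_extreme_point[OF H(1) \<Phi>(1-3)] .
  have "\<phi> \<noteq> 0" using p \<Phi> by blast
  then obtain e y0 where e: "norm e \<le> 1" and \<phi>: "\<phi> = eval_at H e y0"
    using extreme_functional_is_eval[OF H p(2)] by blast
  \<comment> \<open>\<open>R\<close> is the adjoint of \<open>scalarize e\<close>. Its fibre over
    \<open>\<phi>\<close> is a closed face of the scalar dual ball and contains the evaluation at
    \<open>y0\<close>.\<close>
  define R where "R \<sigma> = (\<lambda>h. if h \<in> H then \<sigma> (scalarize e h) else 0)" for \<sigma> :: "_ \<Rightarrow> real"
  define \<Psi> where "\<Psi> = {\<sigma>\<in>dual_ball ?A. R \<sigma> = \<phi>}"
  have \<Psi>D: "\<phi> h = \<sigma> (scalarize e h)" if "\<sigma> \<in> \<Psi>" "h \<in> H" for \<sigma> h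
    using that by (auto simp: \<Psi>_def R_def)
  have RD: "R \<sigma> \<in> dual_ball H" if s: "\<sigma> \<in> dual_ball ?A" for \<sigma>
    unfolding dual_ball_iff[OF H(1)] R_def
  proof (intro conjI allI impI ballI)
    have add: "scalarize e (g + h) = scalarize e g + scalarize e h" for g h
      by (rule bcontfun_eqI) (simp add: blinfun.add_right)
    have scale: "scalarize e (c *\<^sub>R h) = c *\<^sub>R scalarize e h" for c h
      by (rule bcontfun_eqI) (simp add: blinfun.scaleR_right)
    have lin: "functional_on ?A \<sigma>" by (rule dual_ball_linear[OF A(1) s])
    show "functional_on H (\<lambda>h. if h \<in> H then \<sigma> (scalarize e h) else 0)"
      unfolding functional_on_def
      using H(1) functional_on_add[OF lin scalarize_in scalarize_in]
        functional_on_scale[OF lin scalarize_in]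
      by (simp add: add scale subspace_add subspace_scale)
    fix h assume h: "h \<in> H"
    have "\<sigma> (scalarize e h) \<le> norm (scalarize e h)"
      by (rule dual_ball_le[OF A(1) s scalarize_in[OF h]])
    also have "\<dots> \<le> norm h" by (rule norm_scalarize_le[OF e])
    finally show "(if h \<in> H then \<sigma> (scalarize e h) else 0) \<le> norm h" using h by simp
  qed simp
  have "\<Psi> face_of dual_ball ?A"
    unfolding \<Psi>_def using convex_dual_ball[OF A(1)] p(2) RD
    by (rule face_of_preimage) (auto simp: R_def fun_eq_iff scaleR_fun_def)
  moreover have "closed \<Psi>"
  proof -
    have "\<Psi> = dual_ball ?A \<inter> (\<Inter>h\<in>H. {\<sigma>. \<sigma> (scalarize e h) = \<phi> h})"
      by (auto simp: \<Psi>_def R_def fun_eq_iff \<phi> eval_at_def)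
    then show ?thesis
      by (simp only:) (intro closed_Int closed_INT ballI closed_Collect_eq continuous_intros
          compact_closed_fun compact_dual_ball A)
  qed
  moreover have "eval_functional ?A y0 \<in> \<Psi>"
    using eval_functional_dual_ball[OF A(1)]
    by (auto simp: \<Psi>_def R_def \<phi> eval_at_def eval_functional_def scalarize_in)
  ultimately obtain \<sigma> where s: "\<sigma> \<in> \<Psi>" "\<sigma> extreme_point_of dual_ball ?A"
    using closed_face_has_extreme_point[OF A(1), of \<Psi>] by blast
  have "\<sigma> \<noteq> 0"
  proof
    assume "\<sigma> = 0"
    then have "\<phi> h = 0" if "h \<in> H" for h using \<Psi>D[OF s(1) that] by simp
    then have "\<phi> = 0" by (auto simp: fun_eq_iff \<phi> eval_at_def split: if_splits)
    then show False using \<open>\<phi> \<noteq> 0\<close> by simp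
  qed
  then obtain t y where t: "norm t \<le> 1" and \<sigma>: "\<sigma> = eval_at ?A t y"
    using extreme_functional_is_eval[OF A s(2)] by blast
  \<comment> \<open>A functional on the reals is multiplication by a number. Its modulus is 1, since
    otherwise \<open>\<sigma>\<close> would lie strictly between \<open>- ?d\<close> and
    \<open>?d\<close>; the sign is finally absorbed into \<open>e\<close>.\<close>
  define c where "c = blinfun_apply t 1"
  have tc: "t r = c * r" for r
    using blinfun.scaleR_right[of t r 1] by (simp add: c_def)
  have c1: "\<bar>c\<bar> \<le> 1" using abs_blinfun_le[OF t, of 1] by (simp add: c_def)
  let ?d = "eval_functional ?A y"
  have \<sigma>': "\<sigma> = (\<lambda>a. c * ?d a)" by (simp add: \<sigma> eval_at_def eval_functional_def tc fun_eq_iff)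
  have d: "?d \<in> dual_ball ?A" by (rule eval_functional_dual_ball[OF A(1)])
  have "\<bar>c\<bar> = 1"
  proof (rule ccontr)
    assume "\<bar>c\<bar> \<noteq> 1"
    then have c: "- 1 < c" "c < 1" using c1 by auto
    have "\<sigma> = (1 - (1 + c) / 2) *\<^sub>R (- ?d) + ((1 + c) / 2) *\<^sub>R ?d"
      by (simp add: \<sigma>' fun_eq_iff scaleR_fun_def field_simps)
    moreover have "- ?d \<noteq> ?d" using \<open>\<sigma> \<noteq> 0\<close> by (auto simp: \<sigma>' fun_eq_iff)
    ultimately have "\<sigma> \<in> open_segment (- ?d) ?d"
      using c by (auto simp: in_segment intro!: exI[of _ "(1 + c) / 2"])
    then show False using s(2) d uminus_dual_ball[OF A(1) d] by (auto simp: extreme_point_of_def)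
  qed
  then have cc: "c = 1 \<or> c = - 1" by auto
  have "?d extreme_point_of dual_ball ?A"
    using cc
  proof
    assume "c = 1"
    then show ?thesis using s(2) by (simp add: \<sigma>')
  next
    assume "c = - 1"
    then have eq: "- ?d = \<sigma>" by (simp add: \<sigma>' fun_eq_iff)
    \<comment> \<open>Negation is an affine self-map of the ball, so the preimage of the extreme
      point \<open>\<sigma>\<close> under it is a face with one element.\<close>
    have "{\<tau>\<in>dual_ball ?A. - \<tau> = \<sigma>} face_of dual_ball ?A"
      using convex_dual_ball[OF A(1)] s(2) uminus_dual_ball[OF A(1)]
      by (rule face_of_preimage) (auto simp: fun_eq_iff scaleR_fun_def)
    moreover have "{\<tau>\<in>dual_ball ?A. - \<tau> = \<sigma>} = {?d}" using d by (auto simp flip: eq)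
    ultimately show ?thesis by (simp add: face_of_singleton)
  qed
  then have "y \<in> choquet_boundary H" by (simp add: choquet_boundary_def)
  moreover have "norm (c *\<^sub>R e) \<le> 1" using e \<open>\<bar>c\<bar> = 1\<close> by simp
  moreover have "\<phi> = eval_at H (c *\<^sub>R e) y"
  proof
    fix h show "\<phi> h = eval_at H (c *\<^sub>R e) y h"
    proof (cases "h \<in> H")
      case True
      then show ?thesis
        using \<Psi>D[OF s(1)] by (simp add: \<sigma> eval_at_def tc scalarize_in scaleR_blinfun.rep_eq)
    qed (simp add: \<phi> eval_at_def)
  qed
  ultimately show ?thesis using that p(1) by metis
qed

text \<open>The functionals of the dual ball that norm \<open>f\<close> form a nonempty closed face
  without 0, so an evaluation at a boundary point is among them.\<close>

theorem choquet_boundary_norming: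
  fixes H :: "('k::topological_space \<Rightarrow>\<^sub>C 'e::real_normed_vector) set"
  assumes H: "subspace H" "H \<subseteq> C0" and f: "f \<in> H" "f \<noteq> 0"
  obtains y where "y \<in> choquet_boundary H" "norm (f y) = norm f"
proof -
  let ?F = "{\<phi>\<in>dual_ball H. \<phi> f = norm f}"
  have 1: "?F face_of dual_ball H"
    using dual_ball_le[OF H(1) _ f(1)]
    by (intro face_of_maximum[where L = "\<lambda>\<phi>. \<phi> f"] convex_dual_ball H) (auto simp: scaleR_fun_def)
  have "?F = dual_ball H \<inter> {\<phi>. \<phi> f = norm f}" by auto
  then have 2: "closed ?F"
    by (simp only:) (intro closed_Int closed_Collect_eq continuous_intros
          compact_closed_fun compact_dual_ball H)
  obtain y where y: "norm (f y) = norm f" using C0_attains_norm f H by blast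
  obtain e where e: "norm e \<le> 1" "blinfun_apply e (f y) = norm (f y)"
    using norming_functional by blast
  have "eval_at H e y \<in> ?F" using eval_at_dual_ball[OF H(1) e(1)] e y f by (simp add: eval_at_def)
  then have 3: "?F \<noteq> {}" by blast
  have 4: "0 \<notin> ?F" using f by simp
  obtain e z where z: "z \<in> choquet_boundary H" "norm e \<le> 1" "eval_at H e z \<in> ?F"
    using closed_face_meets_choquet_boundary[OF H 1 2 3 4] by blast
  then have "norm f = e (f z)" using f by (simp add: eval_at_def)
  also have "\<dots> \<le> norm (f z)"
    using abs_blinfun_le[OF z(2), of "f z"] by simp
  finally have "norm (f z) = norm f" using norm_bounded[of f z] by simp
  then show ?thesis using that z(1) by blast
qed

text \<open>Weak peak functions are known to be small only at boundary points off \<open>U\<close>;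
  this makes such estimates sufficient for the supremum norm.\<close>

corollary norm_le_on_boundary:
  fixes H :: "('k::topological_space \<Rightarrow>\<^sub>C 'e::real_normed_vector) set"
  assumes H: "subspace H" "H \<subseteq> C0" and f: "f \<in> H" and C: "0 \<le> C"
    and le: "\<And>y. y \<in> choquet_boundary H \<Longrightarrow> norm (f y) \<le> C"
  shows "norm f \<le> C"
proof (cases "f = 0")
  case False
  then obtain y where "y \<in> choquet_boundary H" "norm (f y) = norm f"
    using choquet_boundary_norming[OF H f] by blast
  then show ?thesis using le by metis
qed (use C in simp)

section \<open>Peak functions\<close>

lemma tensor_add: "tensor (a + b) e = tensor a e + tensor b e"
  by (rule bcontfun_eqI) (simp add: scaleR_add_left)

lemma tensor_scaleR: "tensor (r *\<^sub>R a) e = r *\<^sub>R tensor a e"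
  by (rule bcontfun_eqI) simp

lemma tensor_diff: "tensor (a - b) e = tensor a e - tensor b e"
  by (rule bcontfun_eqI) (simp add: scaleR_diff_left)

lemma tensor_zero: "tensor 0 e = 0"
  by (rule bcontfun_eqI) simp

lemma norm_tensor: "norm e = 1 \<Longrightarrow> norm (tensor a e) = norm a"
proof (rule antisym)
  assume e: "norm e = 1"
  show "norm (tensor a e) \<le> norm a"
    by (rule norm_bound) (use e norm_bounded[of a] in simp)
  show "norm a \<le> norm (tensor a e)"
  proof (rule norm_bound)
    fix x show "norm (a x) \<le> norm (tensor a e)"
      using norm_bounded[of "tensor a e" x] e by simp
  qed
qed

text \<open>The weak peak condition places \<open>tensor h e\<close> in \<open>H\<close> only for
  the \<open>e\<close> given in advance, so the admissible scalar functions form a space that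
  depends on \<open>e\<close>.\<close>

definition tensor_space ::
    "('k::topological_space \<Rightarrow>\<^sub>C 'e::real_normed_vector) set \<Rightarrow> 'e \<Rightarrow> ('k \<Rightarrow>\<^sub>C real) set" where
  "tensor_space H e = {a \<in> scalar_space H. tensor a e \<in> H}"

definition peaks ::
    "('k::topological_space \<Rightarrow>\<^sub>C 'e::real_normed_vector) set \<Rightarrow> 'e \<Rightarrow> 'k \<Rightarrow> 'k set \<Rightarrow> real \<Rightarrow> ('k \<Rightarrow>\<^sub>C real) set" where
  "peaks H e x U \<delta> = {h \<in> tensor_space H e. 1 - \<delta> < h x \<and>
     (\<forall>y \<in> choquet_boundary H - U. h y < \<delta>) \<and>
     (\<forall>y. 0 \<le> h y \<and> h y \<le> 1)}"

text \<open>Neighbourhood and tolerance shrink together. A boundary point need not have a countable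
  neighbourhood base, so limits are taken along a filter.\<close>

definition peak_filter ::
    "('k::topological_space \<Rightarrow>\<^sub>C 'e::real_normed_vector) set \<Rightarrow> 'e \<Rightarrow> 'k \<Rightarrow> ('k \<Rightarrow>\<^sub>C real) filter" where
  "peak_filter H e x =
     (INF (U, \<delta>) \<in> {U. open U \<and> x \<in> U} \<times> {0<..<1}. principal (peaks H e x U \<delta>))"

lemma
  assumes "h \<in> peaks H e x U \<delta>"
  shows peaks_in: "h \<in> tensor_space H e"
    and peaks_at: "1 - \<delta> < h x"
    and peaks_off: "y \<in> choquet_boundary H \<Longrightarrow> y \<notin> U \<Longrightarrow> h y < \<delta>"
    and peaks_nonneg: "0 \<le> h y"
    and peaks_le_1: "h y \<le> 1"
  using assms by (auto simp: peaks_def)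

lemma peaks_mono:
  assumes "U \<subseteq> U'" "\<delta> \<le> \<delta>'"
  shows "peaks H e x U \<delta> \<subseteq> peaks H e x U' \<delta>'"
proof
  fix h assume h: "h \<in> peaks H e x U \<delta>"
  have "h y < \<delta>'" if "y \<in> choquet_boundary H - U'" for y
  proof -
    have "h y < \<delta>" by (rule peaks_off[OF h]) (use that assms in auto)
    then show ?thesis using assms by simp
  qed
  then show "h \<in> peaks H e x U' \<delta>'"
    using peaks_at[OF h] assms(2) h by (simp add: peaks_def)
qed

lemma norm_peak_le: "h \<in> peaks H e x U \<delta> \<Longrightarrow> norm h \<le> 1"
  by (rule norm_bound) (simp add: peaks_nonneg peaks_le_1)

lemma eventually_peak_filter:
  "eventually P (peak_filter H e x) \<longleftrightarrow>
     (\<exists>U \<delta>. open U \<and> x \<in> U \<and> 0 < \<delta> \<and> \<delta> < 1 \<and> (\<forall>h \<in> peaks H e x U \<delta>. P h))"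
proof -
  let ?B = "{U. open U \<and> x \<in> U} \<times> {0<..<1::real}"
  have "eventually P (peak_filter H e x) \<longleftrightarrow>
      (\<exists>b\<in>?B. eventually P (case b of (U, \<delta>) \<Rightarrow> principal (peaks H e x U \<delta>)))"
    unfolding peak_filter_def
  proof (rule eventually_INF_base)
    have "(UNIV, 1/2) \<in> ?B" by simp
    then show "?B \<noteq> {}" by blast
    fix a b assume ab: "a \<in> ?B" "b \<in> ?B"
    obtain U \<delta> V \<eta> where a: "a = (U, \<delta>)" and b: "b = (V, \<eta>)" by (cases a, cases b) auto
    have "(U \<inter> V, min \<delta> \<eta>) \<in> ?B" using ab by (auto simp: a b)
    moreover have "peaks H e x (U \<inter> V) (min \<delta> \<eta>) \<subseteq> peaks H e x U \<delta> \<inter> peaks H e x V \<eta>"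
      by (intro Int_greatest peaks_mono) auto
    then have "principal (peaks H e x (U \<inter> V) (min \<delta> \<eta>)) \<le>
        inf (principal (peaks H e x U \<delta>)) (principal (peaks H e x V \<eta>))"
      by (simp only: inf_principal principal_le_iff)
    ultimately show "\<exists>c\<in>?B. (case c of (U, \<delta>) \<Rightarrow> principal (peaks H e x U \<delta>)) \<le>
        inf (case a of (U, \<delta>) \<Rightarrow> principal (peaks H e x U \<delta>))
            (case b of (U, \<delta>) \<Rightarrow> principal (peaks H e x U \<delta>))"
      unfolding a b by (intro bexI[of _ "(U \<inter> V, min \<delta> \<eta>)"]) (simp_all only: prod.case)
  qed
  also have "\<dots> \<longleftrightarrow> (\<exists>U \<delta>. open U \<and> x \<in> U \<and> 0 < \<delta> \<and> \<delta> < 1 \<and> (\<forall>h \<in> peaks H e x U \<delta>. P h))"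
    (is "?L \<longleftrightarrow> ?R")
  proof
    assume ?L
    then obtain U \<delta> where "(U, \<delta>) \<in> ?B" "\<forall>h \<in> peaks H e x U \<delta>. P h"
      by (auto simp: eventually_principal)
    then show ?R by (intro exI[of _ U] exI[of _ \<delta>]) simp
  next
    assume ?R
    then obtain U \<delta> where "open U" "x \<in> U" "0 < \<delta>" "\<delta> < 1" "\<forall>h \<in> peaks H e x U \<delta>. P h" by blast
    then show ?L by (intro bexI[of _ "(U, \<delta>)"]) (simp_all add: eventually_principal)
  qed
  finally show ?thesis .
qed

lemma eventually_peaks:
  "open U \<Longrightarrow> x \<in> U \<Longrightarrow> 0 < \<delta> \<Longrightarrow> \<delta> < 1 \<Longrightarrow> eventually (\<lambda>h. h \<in> peaks H e x U \<delta>) (peak_filter H e x)"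
  unfolding eventually_peak_filter by blast

locale peak_space =
  fixes H :: "('k::t2_space \<Rightarrow>\<^sub>C 'e::banach_lattice) set"
  assumes subspace: "subspace H" and closed: "closed H" and C0: "H \<subseteq> C0"
    and weak_peak: "\<And>x. x \<in> choquet_boundary H \<Longrightarrow> weak_peak_point H x"
begin

lemma peaks_nonempty:
  assumes "x \<in> choquet_boundary H" "0 \<le> e" "open U" "x \<in> U" "0 < \<delta>" "\<delta> < 1"
  shows "peaks H e x U \<delta> \<noteq> {}"
proof -
  have "x \<in> interior U" using assms by (simp add: interior_open)
  then show ?thesis
    using weak_peak[OF assms(1)] assms unfolding weak_peak_point_def peaks_def tensor_space_def by blast
qed

lemma peak_filter_ne_bot:
  assumes "x \<in> choquet_boundary H" "0 \<le> e"
  shows "peak_filter H e x \<noteq> bot"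
  unfolding trivial_limit_def eventually_peak_filter using peaks_nonempty[OF assms] by blast

lemma subspace_tensor: "subspace (tensor_space H e)"
  using subspace subspace_scalar_space[of H]
  by (auto simp: subspace_def tensor_space_def tensor_add tensor_scaleR tensor_zero)

text \<open>Tensoring with \<open>e\<close> is continuous for the supremum norms. Closedness keeps
  the limit of the iterated perturbations in the space.\<close>

lemma closed_tensor_space: "closed (tensor_space H e)"
proof -
  have "a \<in> tensor_space H e"
    if a: "\<And>n. f n \<in> tensor_space H e" and lim: "f \<longlonglongrightarrow> a" for f :: "nat \<Rightarrow> 'k \<Rightarrow>\<^sub>C real" and a
  proof -
    have "a \<in> scalar_space H"
      using closed_sequentially[OF closed_scalar_space, of f] a lim by (auto simp: tensor_space_def)
    moreover have "(\<lambda>n. tensor (f n) e) \<longlonglongrightarrow> tensor a e"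
    proof (rule LIM_zero_cancel, rule Lim_null_comparison)
      have "norm (tensor (f n) e - tensor a e) \<le> norm (f n - a) * norm e" for n
        unfolding tensor_diff[symmetric]
        by (rule norm_bound) (auto intro!: mult_right_mono simp: norm_bounded[of "f n - a", simplified])
      then show "eventually (\<lambda>n. norm (tensor (f n) e - tensor a e) \<le> norm (f n - a) * norm e) sequentially"
        by simp
      have "(\<lambda>n. norm (f n - a)) \<longlonglongrightarrow> 0" using lim by (intro tendsto_norm_zero LIM_zero)
      then show "(\<lambda>n. norm (f n - a) * norm e) \<longlonglongrightarrow> 0" by (rule tendsto_mult_left_zero)
    qed
    then have "tensor a e \<in> H"
      using closed_sequentially[OF closed, of "\<lambda>n. tensor (f n) e"] a by (auto simp: tensor_space_def)
    ultimately show ?thesis by (simp add: tensor_space_def)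
  qed
  then show ?thesis unfolding closed_sequential_limits by blast
qed

lemma convex_peaks: "convex (peaks H e x U \<delta>)"
proof (rule convexI)
  fix g h and u v :: real
  assume g: "g \<in> peaks H e x U \<delta>" and h: "h \<in> peaks H e x U \<delta>" and uv: "0 \<le> u" "0 \<le> v" "u + v = 1"
  have "u *\<^sub>R g + v *\<^sub>R h \<in> tensor_space H e"
    using g h subspace_tensor[of e] by (intro subspace_add subspace_scale) (auto simp: peaks_in)
  moreover have lt: "u * p + v * q < r" if "p < r" "q < r" for p q r :: real
    using uv that by (intro convex_bound_lt)
  moreover have "r < u * p + v * q" if "r < p" "r < q" for p q r :: real
    using lt[of "- p" "- r" "- q"] that by simp
  moreover have "u * p + v * q \<le> r" if "p \<le> r" "q \<le> r" for p q r :: real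
    using uv that by (intro convex_bound_le)
  ultimately show "u *\<^sub>R g + v *\<^sub>R h \<in> peaks H e x U \<delta>"
    using g h uv by (auto simp: peaks_def)
qed

lemma norm_le_tensor_space:
  assumes e: "norm e = 1" and a: "a \<in> tensor_space H e" and "0 \<le> C"
    and le: "\<And>y. y \<in> choquet_boundary H \<Longrightarrow> \<bar>a y\<bar> \<le> C"
  shows "norm a \<le> C"
proof -
  have "norm (tensor a e) \<le> C"
    using a assms(3) le e
    by (intro norm_le_on_boundary[OF subspace C0]) (auto simp: tensor_space_def)
  then show ?thesis by (simp add: norm_tensor[OF e])
qed

text \<open>Peak functions chosen over rapidly shrinking neighbourhoods have pairwise differences whose
  sums stay bounded, so no bounded functional can oscillate along the filter.\<close>

lemma peak_filter_Cauchy: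
  assumes e: "norm e = 1"
    and lin: "functional_on (tensor_space H e) \<phi>"
    and bnd: "\<And>a. a \<in> tensor_space H e \<Longrightarrow> \<bar>\<phi> a\<bar> \<le> c * norm a"
    and "0 < \<eta>"
  obtains (oscillation) U \<delta> where "open U" "x \<in> U" "0 < \<delta>" "\<delta> < 1"
    "\<And>h h'. h \<in> peaks H e x U \<delta> \<Longrightarrow> h' \<in> peaks H e x U \<delta> \<Longrightarrow> \<phi> h - \<phi> h' < \<eta>"
proof (rule ccontr)
  let ?V = "tensor_space H e"
  assume no: "\<not> thesis"
  have "\<exists>h h'. h \<in> peaks H e x U \<delta> \<and> h' \<in> peaks H e x U \<delta> \<and> \<eta> \<le> \<phi> h - \<phi> h'"
    if U: "open U" "x \<in> U" "0 < \<delta>" "\<delta> < 1" for U \<delta>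
  proof (rule ccontr)
    assume "\<not> ?thesis"
    then have "\<phi> h - \<phi> h' < \<eta>" if "h \<in> peaks H e x U \<delta>" "h' \<in> peaks H e x U \<delta>" for h h'
      using that by (meson not_le)
    then show False using no oscillation[OF U] by blast
  qed
  then obtain g g' where g: "\<And>U \<delta>. open U \<Longrightarrow> x \<in> U \<Longrightarrow> 0 < \<delta> \<Longrightarrow> \<delta> < 1 \<Longrightarrow>
      g U \<delta> \<in> peaks H e x U \<delta> \<and> g' U \<delta> \<in> peaks H e x U \<delta> \<and> \<eta> \<le> \<phi> (g U \<delta>) - \<phi> (g' U \<delta>)"
    by metis
  \<comment> \<open>The tolerances sum to less than 1/2, so doubling them costs at most 1 and the
    partial sums below stay bounded by 2.\<close>
  define \<delta> :: "nat \<Rightarrow> real" where "\<delta> n = (1/2) ^ (n + 2)" for n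
  have \<delta>: "0 < \<delta> n" "\<delta> n < 1" for n
    using power_Suc_less_one[of "1/2::real" "n + 1"] by (simp_all add: \<delta>_def)
  have sum\<delta>: "(\<Sum>n<N. \<delta> n) \<le> 1 / 2 - 2 * \<delta> N" for N
    by (induction N) (auto simp: \<delta>_def)
  define d where "d U n = g U (\<delta> n) - g' U (\<delta> n)" for U n
  \<comment> \<open>The pair with index \<open>n\<close> peaks inside \<open>W n\<close>, where all
    earlier differences are small. If a boundary point leaves these decreasing sets after stage
    \<open>n\<close>, the earlier differences there are at most twice their tolerance, the later
    ones at most their tolerance, and only difference \<open>n\<close> may be as large as 1.\<close>
  define W where "W = rec_nat UNIV (\<lambda>n U. U \<inter> {z. \<bar>(d U n) z\<bar> < 2 * \<delta> n})"
  have W0: "W 0 = UNIV" and WSuc: "W (Suc n) = W n \<inter> {z. \<bar>(d (W n) n) z\<bar> < 2 * \<delta> n}" for n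
    by (simp_all add: W_def)
  have dx: "\<bar>(d U n) x\<bar> < 2 * \<delta> n" if "open U" "x \<in> U" for U n
  proof -
    have "g U (\<delta> n) \<in> peaks H e x U (\<delta> n)" "g' U (\<delta> n) \<in> peaks H e x U (\<delta> n)"
      using g[OF that \<delta>] by blast+
    from peaks_at[OF this(1)] peaks_at[OF this(2)] peaks_le_1[OF this(1), of x] peaks_le_1[OF this(2), of x]
    show ?thesis using \<delta>(1)[of n] by (simp add: d_def)
  qed
  have W: "open (W n) \<and> x \<in> W n" for n
  proof (induction n)
    case (Suc n)
    have "open {z. \<bar>(d (W n) n) z\<bar> < 2 * \<delta> n}"
      by (intro open_Collect_less continuous_intros)
    then show ?case using Suc dx by (auto simp: WSuc)
  qed (simp add: W0)
  define s where "s N = (\<Sum>n<N. d (W n) n)" for N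
  have dV: "d (W n) n \<in> ?V" for n
    using g[of "W n" "\<delta> n"] W \<delta>
    unfolding d_def by (intro subspace_diff[OF subspace_tensor]) (auto intro: peaks_in)
  have sV: "s N \<in> ?V" for N
    unfolding s_def by (intro subspace_sum subspace_tensor dV)
  have est: "\<bar>(s N) z\<bar> \<le> 1 + 2 * (\<Sum>n<N. \<delta> n) \<and>
      (z \<in> W N \<longrightarrow> \<bar>(s N) z\<bar> \<le> 2 * (\<Sum>n<N. \<delta> n))" if z: "z \<in> choquet_boundary H" for z N
  proof (induction N)
    case 0
    then show ?case by (simp add: s_def)
  next
    case (Suc N)
    have p: "g (W N) (\<delta> N) \<in> peaks H e x (W N) (\<delta> N)" "g' (W N) (\<delta> N) \<in> peaks H e x (W N) (\<delta> N)"
      using g[of "W N" "\<delta> N"] W \<delta> by blast+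
    let ?d = "(d (W N) N) z"
    have sS: "(s (Suc N)) z = (s N) z + ?d"
      by (simp add: s_def)
    have d1: "\<bar>?d\<bar> \<le> 1"
      using peaks_nonneg[OF p(1), of z] peaks_nonneg[OF p(2), of z]
        peaks_le_1[OF p(1), of z] peaks_le_1[OF p(2), of z]
      by (simp add: d_def)
    have d2: "\<bar>?d\<bar> \<le> \<delta> N" if "z \<notin> W N"
      using peaks_nonneg[OF p(1), of z] peaks_nonneg[OF p(2), of z]
        peaks_off[OF p(1) z that] peaks_off[OF p(2) z that]
      by (simp add: d_def)
    have d3: "\<bar>?d\<bar> < 2 * \<delta> N \<and> z \<in> W N" if "z \<in> W (Suc N)" using that by (simp add: WSuc)
    show ?case
    proof (cases "z \<in> W N")
      case True
      then show ?thesis using Suc d1 d3 \<delta>(1)[of N] unfolding sS by auto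
    next
      case False
      then show ?thesis using Suc d2 d3 \<delta>(1)[of N] unfolding sS by auto
    qed
  qed
  have sn: "norm (s N) \<le> 2" for N
  proof (rule norm_le_tensor_space[OF e sV])
    fix z assume "z \<in> choquet_boundary H"
    then show "\<bar>(s N) z\<bar> \<le> 2"
      using est[of z N] sum\<delta>[of N] \<delta>(1)[of N] by linarith
  qed simp
  \<comment> \<open>Every difference adds at least \<open>\<eta>\<close> to the value of
    \<open>\<phi>\<close> while the norms stay below 2, which a bounded functional cannot do
    forever.\<close>
  have low: "real N * \<eta> \<le> \<phi> (s N)" for N
  proof (induction N)
    case 0
    then show ?case
      using sublinear_on_zero[OF subspace_tensor functional_on_sublinear[OF lin]]
      by (simp add: s_def)
  next
    case (Suc N)
    have p: "g (W N) (\<delta> N) \<in> ?V" "g' (W N) (\<delta> N) \<in> ?V" "\<eta> \<le> \<phi> (g (W N) (\<delta> N)) - \<phi> (g' (W N) (\<delta> N))"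
      using g[of "W N" "\<delta> N"] W \<delta> peaks_in by blast+
    have "\<phi> (s (Suc N)) = \<phi> (s N) + \<phi> (d (W N) N)"
      using functional_on_add[OF lin sV dV] by (simp add: s_def)
    also have "\<phi> (d (W N) N) = \<phi> (g (W N) (\<delta> N)) - \<phi> (g' (W N) (\<delta> N))"
      unfolding d_def by (rule functional_on_diff[OF subspace_tensor lin p(1,2)])
    finally show ?case using Suc p(3) by (simp add: algebra_simps)
  qed
  have "real N * \<eta> \<le> \<bar>c\<bar> * 2" for N
  proof -
    have "real N * \<eta> \<le> c * norm (s N)" using low[of N] bnd[OF sV, of N] by linarith
    also have "\<dots> \<le> \<bar>c\<bar> * norm (s N)" by (intro mult_right_mono) auto
    also have "\<dots> \<le> \<bar>c\<bar> * 2" using sn by (intro mult_left_mono) auto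
    finally show ?thesis .
  qed
  moreover obtain N where "\<bar>c\<bar> * 2 < real N * \<eta>"
    using reals_Archimedean3[OF \<open>0 < \<eta>\<close>] by blast
  ultimately show False by (meson not_le)
qed

text \<open>Boundedness gives a cluster point in a compact interval, and the oscillation bound makes
  a cluster point the limit.\<close>

lemma peak_filter_converges:
  assumes e: "norm e = 1" "0 \<le> e" and x: "x \<in> choquet_boundary H"
    and lin: "functional_on (tensor_space H e) \<phi>"
    and bnd: "\<And>a. a \<in> tensor_space H e \<Longrightarrow> \<bar>\<phi> a\<bar> \<le> c * norm a"
  obtains l where "(\<phi> \<longlongrightarrow> l) (peak_filter H e x)"
proof -
  let ?F = "peak_filter H e x"
  have ev1: "eventually (\<lambda>h. h \<in> peaks H e x UNIV (1/2)) ?F" by (intro eventually_peaks) auto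
  have b: "\<bar>\<phi> h\<bar> \<le> \<bar>c\<bar>" if h: "h \<in> peaks H e x UNIV (1/2)" for h
  proof -
    have "\<bar>\<phi> h\<bar> \<le> c * norm h" by (rule bnd[OF peaks_in[OF h]])
    also have "\<dots> \<le> \<bar>c\<bar> * norm h" by (intro mult_right_mono) auto
    also have "\<dots> \<le> \<bar>c\<bar>" using norm_peak_le[OF h] by (simp add: mult_left_le)
    finally show ?thesis .
  qed
  have "filtermap \<phi> ?F \<noteq> bot" using peak_filter_ne_bot[OF x e(2)] by (simp add: filtermap_bot_iff)
  moreover have "eventually (\<lambda>r. r \<in> {- \<bar>c\<bar>..\<bar>c\<bar>}) (filtermap \<phi> ?F)"
    unfolding eventually_filtermap
  proof (rule eventually_mono[OF ev1])
    fix h assume "h \<in> peaks H e x UNIV (1/2)"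
    from b[OF this] show "\<phi> h \<in> {- \<bar>c\<bar>..\<bar>c\<bar>}" by auto
  qed
  ultimately obtain l where l: "inf (nhds l) (filtermap \<phi> ?F) \<noteq> bot"
    using compact_Icc[of "- \<bar>c\<bar>" "\<bar>c\<bar>"] unfolding compact_filter by blast
  have "(\<phi> \<longlongrightarrow> l) ?F"
  proof (rule tendstoI)
    fix \<eta> :: real assume \<eta>: "0 < \<eta>"
    then have "\<eta> / 2 > 0" by simp
    then obtain U \<delta> where U: "open U" "x \<in> U" "0 < \<delta>" "\<delta> < 1"
      "\<And>h h'. h \<in> peaks H e x U \<delta> \<Longrightarrow> h' \<in> peaks H e x U \<delta> \<Longrightarrow> \<phi> h - \<phi> h' < \<eta> / 2"
      using peak_filter_Cauchy[OF e(1) lin bnd] by blast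
    have "eventually (\<lambda>r. r \<in> ball l (\<eta> / 2)) (nhds l)"
      using \<eta> by (intro eventually_nhds_in_open) auto
    then have 1: "eventually (\<lambda>r. r \<in> ball l (\<eta> / 2)) (inf (nhds l) (filtermap \<phi> ?F))"
      by (rule filter_leD[OF inf_le1])
    have "eventually (\<lambda>r. r \<in> \<phi> ` peaks H e x U \<delta>) (filtermap \<phi> ?F)"
      unfolding eventually_filtermap
      by (rule eventually_mono[OF eventually_peaks[OF U(1-4)]]) simp
    then have 2: "eventually (\<lambda>r. r \<in> \<phi> ` peaks H e x U \<delta>) (inf (nhds l) (filtermap \<phi> ?F))"
      by (rule filter_leD[OF inf_le2])
    obtain h0 where h0: "h0 \<in> peaks H e x U \<delta>" "\<phi> h0 \<in> ball l (\<eta> / 2)"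
      using eventually_happens'[OF l eventually_conj[OF 1 2]] by blast
    show "eventually (\<lambda>h. dist (\<phi> h) l < \<eta>) ?F"
    proof (rule eventually_mono[OF eventually_peaks[OF U(1-4)]])
      fix h assume h: "h \<in> peaks H e x U \<delta>"
      show "dist (\<phi> h) l < \<eta>"
        using U(5)[OF h h0(1)] U(5)[OF h0(1) h] h0(2)
        unfolding mem_ball dist_real_def abs_less_iff by linarith
    qed
  qed
  then show ?thesis using that by blast
qed

end

section \<open>Positions where the image of a peak stays large\<close>

lemma Cauchy_bcontfun_convergent:
  fixes f :: "nat \<Rightarrow> 'k::topological_space \<Rightarrow>\<^sub>C 'e::complete_space"
  assumes "Cauchy f"
  obtains l where "f \<longlonglongrightarrow> l"
proof -
  have "uniformly_Cauchy_on UNIV (\<lambda>n. apply_bcontfun (f n))"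
    unfolding uniformly_Cauchy_on_def
  proof (intro allI impI)
    fix \<eta> :: real assume "\<eta> > 0"
    then obtain N where "\<And>m n. m \<ge> N \<Longrightarrow> n \<ge> N \<Longrightarrow> dist (f m) (f n) < \<eta>"
      using assms unfolding Cauchy_def by blast
    then show "\<exists>M. \<forall>z\<in>UNIV. \<forall>m\<ge>M. \<forall>n\<ge>M. dist ((f m) z) ((f n) z) < \<eta>"
      by (intro exI[of _ N] ballI allI impI dist_fun_lt_imp_dist_val_lt) auto
  qed
  then obtain g where "uniform_limit UNIV (\<lambda>n. apply_bcontfun (f n)) g sequentially"
    using Cauchy_uniformly_convergent uniformly_convergent_on_def by metis
  from uniform_limit_bcontfunE[OF this sequentially_bot] show ?thesis using that by metis
qed

text \<open>Normalizing the lower bound to 1 puts the whole distortion into \<open>c\<close>. An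
  isomorphism and its inverse, each suitably scaled, satisfy this with the same
  \<open>c\<close>.\<close>

locale lower_bounded_map = peak_space H1
  for H1 :: "('k1::t2_space \<Rightarrow>\<^sub>C 'e1::banach_lattice) set" +
  fixes H2 :: "('k2::t2_space \<Rightarrow>\<^sub>C 'e2::banach_lattice) set"
    and J :: "('k1 \<Rightarrow>\<^sub>C 'e1) \<Rightarrow> ('k2 \<Rightarrow>\<^sub>C 'e2)" and c :: real
  assumes H2: "subspace H2" "H2 \<subseteq> C0"
    and J_in: "f \<in> H1 \<Longrightarrow> J f \<in> H2"
    and J_add: "f \<in> H1 \<Longrightarrow> g \<in> H1 \<Longrightarrow> J (f + g) = J f + J g"
    and J_scale: "f \<in> H1 \<Longrightarrow> J (r *\<^sub>R f) = r *\<^sub>R J f"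
    and J_lower: "f \<in> H1 \<Longrightarrow> norm f \<le> norm (J f)"
    and J_upper: "f \<in> H1 \<Longrightarrow> norm (J f) \<le> c * norm f"
    and c: "1 \<le> c"

locale peak_embedding = lower_bounded_map H1 H2 J c
  for H1 :: "('k1::t2_space \<Rightarrow>\<^sub>C 'e1::banach_lattice) set"
    and H2 :: "('k2::t2_space \<Rightarrow>\<^sub>C 'e2::banach_lattice) set" and J c +
  fixes x :: 'k1 and e :: 'e1
  assumes x: "x \<in> choquet_boundary H1" and e: "norm e = 1" "0 \<le> e"
begin

abbreviation "V \<equiv> tensor_space H1 e"
abbreviation "D \<equiv> dual_ball H2"
abbreviation "F \<equiv> peak_filter H1 e x"

definition ev :: "(('k2 \<Rightarrow>\<^sub>C 'e2) \<Rightarrow> real) \<Rightarrow> ('k1 \<Rightarrow>\<^sub>C real) \<Rightarrow> real" where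
  "ev \<psi> a = \<psi> (J (tensor a e))"

text \<open>The value at \<open>\<psi>\<close> of the image in the bidual of the limit of the peaks.
  It arises as a pointwise limit of weak-star continuous functions, which is why semicontinuity is
  not automatic.\<close>

definition Q :: "(('k2 \<Rightarrow>\<^sub>C 'e2) \<Rightarrow> real) \<Rightarrow> real" where
  "Q \<psi> = Lim F (ev \<psi>)"

text \<open>Since \<open>D\<close> is symmetric, \<open>S a\<close> is the bidual norm of the image
  of the peak limit plus \<open>a\<close>; \<open>a\<close> is the variable of the variational
  argument.\<close>

definition S :: "('k1 \<Rightarrow>\<^sub>C real) \<Rightarrow> real" where
  "S a = (SUP \<psi>\<in>D. Q \<psi> + ev \<psi> a)"

definition slice :: "('k1 \<Rightarrow>\<^sub>C real) \<Rightarrow> real \<Rightarrow> (('k2 \<Rightarrow>\<^sub>C 'e2) \<Rightarrow> real) set" where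
  "slice a \<tau> = {\<psi>\<in>D. S a - \<tau> \<le> Q \<psi> + ev \<psi> a}"

lemma V_tensor: "a \<in> V \<Longrightarrow> tensor a e \<in> H1"
  by (simp add: tensor_space_def)

lemma V_J: "a \<in> V \<Longrightarrow> J (tensor a e) \<in> H2"
  by (simp add: J_in V_tensor)

lemma V_subspace: "subspace V"
  by (rule subspace_tensor)

lemma V_zero: "0 \<in> V"
  by (rule subspace_0[OF V_subspace])

lemma ev_linear:
  assumes p: "\<psi> \<in> D"
  shows "functional_on V (ev \<psi>)"
proof -
  have l: "functional_on H2 \<psi>" by (rule dual_ball_linear[OF H2(1) p])
  show ?thesis
    unfolding functional_on_def
  proof (intro conjI ballI allI)
    fix a b assume "a \<in> V" "b \<in> V"
    then show "ev \<psi> (a + b) = ev \<psi> a + ev \<psi> b"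
      using functional_on_add[OF l V_J V_J] by (simp add: ev_def tensor_add J_add V_tensor)
  next
    fix r a assume "a \<in> V"
    then show "ev \<psi> (r *\<^sub>R a) = r * ev \<psi> a"
      using functional_on_scale[OF l V_J] by (simp add: ev_def tensor_scaleR J_scale V_tensor)
  qed
qed

lemma norm_J_tensor: "a \<in> V \<Longrightarrow> norm a \<le> norm (J (tensor a e)) \<and> norm (J (tensor a e)) \<le> c * norm a"
  using J_lower[OF V_tensor] J_upper[OF V_tensor] by (simp add: norm_tensor[OF e(1)])

lemma ev_le_J: "\<psi> \<in> D \<Longrightarrow> a \<in> V \<Longrightarrow> \<bar>ev \<psi> a\<bar> \<le> norm (J (tensor a e))"
  unfolding ev_def by (rule dual_ball_abs_le[OF H2(1) _ V_J])

lemma ev_bound: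
  assumes "\<psi> \<in> D" "a \<in> V"
  shows "\<bar>ev \<psi> a\<bar> \<le> c * norm a"
  using ev_le_J[OF assms] norm_J_tensor[OF assms(2)] by linarith

lemma continuous_on_ev: "continuous_on A (\<lambda>\<psi>. ev \<psi> a)"
  unfolding ev_def by (rule continuous_on_eval)

lemma F_ne_bot: "F \<noteq> bot"
  by (rule peak_filter_ne_bot[OF x e(2)])

lemma Q_tendsto:
  assumes p: "\<psi> \<in> D"
  shows "(ev \<psi> \<longlongrightarrow> Q \<psi>) F"
proof -
  obtain l where l: "(ev \<psi> \<longlongrightarrow> l) F"
    using peak_filter_converges[OF e x ev_linear[OF p] ev_bound[OF p]] by blast
  then have "Q \<psi> = l" unfolding Q_def by (intro tendsto_Lim F_ne_bot)
  then show ?thesis using l by simp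
qed

lemma Q_ge:
  assumes p: "\<psi> \<in> D" and U: "open U" "x \<in> U" "0 < \<delta>" "\<delta> < 1"
    and le: "\<And>h. h \<in> peaks H1 e x U \<delta> \<Longrightarrow> r \<le> ev \<psi> h"
  shows "r \<le> Q \<psi>"
  using tendsto_lowerbound[OF Q_tendsto[OF p] eventually_mono[OF eventually_peaks[OF U]] F_ne_bot] le
  by blast

lemma Q_le:
  assumes p: "\<psi> \<in> D" and U: "open U" "x \<in> U" "0 < \<delta>" "\<delta> < 1"
    and le: "\<And>h. h \<in> peaks H1 e x U \<delta> \<Longrightarrow> ev \<psi> h \<le> r"
  shows "Q \<psi> \<le> r"
  using tendsto_upperbound[OF Q_tendsto[OF p] eventually_mono[OF eventually_peaks[OF U]] F_ne_bot] le
  by blast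

lemma Q_le_c: "\<psi> \<in> D \<Longrightarrow> Q \<psi> \<le> c"
proof (rule Q_le[of \<psi> UNIV "1/2"])
  fix h assume p: "\<psi> \<in> D" and h: "h \<in> peaks H1 e x UNIV (1/2)"
  have "ev \<psi> h \<le> c * norm h" using ev_bound[OF p peaks_in[OF h]] by simp
  also have "\<dots> \<le> c" using norm_peak_le[OF h] c by (simp add: mult_left_le)
  finally show "ev \<psi> h \<le> c" .
qed auto

lemma Q_affine:
  assumes p: "\<psi> \<in> D" "\<psi>' \<in> D" and u: "0 \<le> u" "u \<le> 1"
  shows "Q ((1 - u) *\<^sub>R \<psi> + u *\<^sub>R \<psi>') = (1 - u) * Q \<psi> + u * Q \<psi>'"
proof -
  have "(1 - u) *\<^sub>R \<psi> + u *\<^sub>R \<psi>' \<in> D"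
    using p u by (intro convexD[OF convex_dual_ball[OF H2(1)]]) auto
  from Q_tendsto[OF this]
  have "((\<lambda>h. (1 - u) * ev \<psi> h + u * ev \<psi>' h) \<longlongrightarrow> Q ((1 - u) *\<^sub>R \<psi> + u *\<^sub>R \<psi>')) F"
    by (simp add: ev_def[abs_def] scaleR_fun_def)
  moreover have "((\<lambda>h. (1 - u) * ev \<psi> h + u * ev \<psi>' h) \<longlongrightarrow> (1 - u) * Q \<psi> + u * Q \<psi>') F"
    using p by (intro tendsto_intros Q_tendsto)
  ultimately show ?thesis using tendsto_unique[OF F_ne_bot] by blast
qed

lemma D_zero: "0 \<in> D"
  by (auto simp: dual_ball_iff[OF H2(1)] functional_on_def)

lemma S_upper:
  assumes "\<psi> \<in> D" "a \<in> V"
  shows "Q \<psi> + ev \<psi> a \<le> S a"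
  unfolding S_def
proof (rule cSUP_upper[OF assms(1)], rule bdd_aboveI2)
  fix \<psi> assume p: "\<psi> \<in> D"
  then show "Q \<psi> + ev \<psi> a \<le> c + c * norm a"
    using Q_le_c[OF p] ev_bound[OF p assms(2)] by linarith
qed

lemma S_approx:
  assumes "a \<in> V" "0 < \<tau>"
  obtains \<psi> where "\<psi> \<in> slice a \<tau>"
proof -
  have "\<exists>\<psi>\<in>D. S a - \<tau> < Q \<psi> + ev \<psi> a"
  proof (rule ccontr)
    assume "\<not> ?thesis"
    then have "S a \<le> S a - \<tau>" unfolding S_def using D_zero
      by (intro cSUP_least) (auto simp: not_less)
    then show False using assms by simp
  qed
  then show ?thesis using that by (auto simp: slice_def intro: less_imp_le)
qed

lemma S_lipschitz:
  assumes a: "a \<in> V" and b: "b \<in> V"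
  shows "S a \<le> S b + c * norm (a - b)"
  unfolding S_def[of a]
proof (rule cSUP_least)
  show "D \<noteq> {}" using D_zero by blast
  fix \<psi> assume p: "\<psi> \<in> D"
  have "ev \<psi> a - ev \<psi> b = ev \<psi> (a - b)"
    using functional_on_diff[OF V_subspace ev_linear[OF p] a b] by simp
  also have "\<dots> \<le> c * norm (a - b)"
    using ev_bound[OF p subspace_diff[OF V_subspace a b]] by simp
  finally show "Q \<psi> + ev \<psi> a \<le> S b + c * norm (a - b)"
    using S_upper[OF p b] by simp
qed

lemma slice_subset: "slice a \<tau> \<subseteq> D"
  by (auto simp: slice_def)

lemma closure_slice_subset: "closure (slice a \<tau>) \<subseteq> D"
  by (intro closure_minimal slice_subset compact_closed_fun compact_dual_ball H2)

text \<open>The images of the peaks for a fixed \<open>U\<close> and \<open>\<delta>\<close> form a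
  convex set at distance at least \<open>d\<close> from 0. A functional separating it from 0 is at
  least \<open>d\<close> on all of them, and so is its limit.\<close>

lemma le_S_zero:
  assumes U: "open U" "x \<in> U" "0 < \<delta>" "\<delta> < 1"
    and le: "\<And>h. h \<in> peaks H1 e x U \<delta> \<Longrightarrow> d \<le> norm (J (tensor h e))"
  shows "d \<le> S 0"
proof -
  let ?C = "(\<lambda>h. J (tensor h e)) ` peaks H1 e x U \<delta>"
  have "convex ?C"
    unfolding convex_alt
  proof (intro ballI allI impI)
    fix p q and u :: real assume "p \<in> ?C" "q \<in> ?C" and u: "0 \<le> u \<and> u \<le> 1"
    then obtain g h where gh: "g \<in> peaks H1 e x U \<delta>" "h \<in> peaks H1 e x U \<delta>"
      "p = J (tensor g e)" "q = J (tensor h e)" by blast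
    have "(1 - u) *\<^sub>R g + u *\<^sub>R h \<in> peaks H1 e x U \<delta>"
      using gh u by (intro convexD[OF convex_peaks]) auto
    moreover have "J (tensor ((1 - u) *\<^sub>R g + u *\<^sub>R h) e) = (1 - u) *\<^sub>R p + u *\<^sub>R q"
      using V_tensor[OF peaks_in[OF gh(1)]] V_tensor[OF peaks_in[OF gh(2)]]
      unfolding gh(3,4) tensor_add tensor_scaleR
      by (simp add: J_add J_scale subspace_scale[OF subspace])
    ultimately show "(1 - u) *\<^sub>R p + u *\<^sub>R q \<in> ?C" by (metis image_eqI)
  qed
  moreover have "?C \<noteq> {}" using peaks_nonempty[OF x e(2) U] by simp
  moreover have "d \<le> norm g" if "g \<in> ?C" for g using le that by blast
  ultimately obtain f :: "('k2 \<Rightarrow>\<^sub>C 'e2) \<Rightarrow>\<^sub>L real" where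
    f: "norm f \<le> 1" "\<And>g. g \<in> ?C \<Longrightarrow> d \<le> f g"
    using separate_convex_from_zero by blast
  define \<psi> where "\<psi> = (\<lambda>g. if g \<in> H2 then f g else 0)"
  have p: "\<psi> \<in> D"
    unfolding dual_ball_iff[OF H2(1)]
  proof (intro conjI allI impI ballI)
    show "functional_on H2 \<psi>"
      using H2(1) by (auto simp: functional_on_def \<psi>_def subspace_add subspace_scale
          blinfun.add_right blinfun.scaleR_right)
    fix g assume "g \<in> H2"
    then show "\<psi> g \<le> norm g" using abs_blinfun_le[OF f(1), of g] by (simp add: \<psi>_def)
  qed (simp add: \<psi>_def)
  have "d \<le> Q \<psi>"
  proof (rule Q_ge[OF p U])
    fix h assume h: "h \<in> peaks H1 e x U \<delta>"
    then show "d \<le> ev \<psi> h"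
      using f(2) V_J[OF peaks_in[OF h]] by (simp add: ev_def \<psi>_def)
  qed
  also have "\<dots> \<le> S 0"
    using S_upper[OF p V_zero] functional_on_scale[OF ev_linear[OF p] V_zero, of 0] by simp
  finally show ?thesis .
qed

lemma S_zero_ge_1: "1 \<le> S 0"
proof (rule field_le_epsilon)
  fix \<eta> :: real assume e0: "0 < \<eta>"
  let ?d = "min \<eta> (1/2)"
  have "1 - ?d \<le> S 0"
  proof (rule le_S_zero[of UNIV ?d])
    fix h assume h: "h \<in> peaks H1 e x UNIV ?d"
    have "1 - ?d \<le> norm h" using peaks_at[OF h] norm_bounded[of h x] by simp
    then show "1 - ?d \<le> norm (J (tensor h e))"
      using norm_J_tensor[OF peaks_in[OF h]] by linarith
  qed (use e0 in auto)
  then show "1 \<le> S 0 + \<eta>" by simp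
qed

text \<open>If all peaks over \<open>U\<close> had larger images, \<open>le_S_zero\<close> would
  push \<open>S 0\<close> above itself. The limit norm is thus approached by norms of actual images
  over every neighbourhood.\<close>

lemma peak_of_almost_minimal_norm:
  assumes U: "open U" "x \<in> U" "0 < \<delta>" "\<delta> < 1" and "0 < \<eta>"
  obtains h where "h \<in> peaks H1 e x U \<delta>" "norm (J (tensor h e)) \<le> S 0 + \<eta>"
proof -
  have "\<not> (\<forall>h\<in>peaks H1 e x U \<delta>. S 0 + \<eta> \<le> norm (J (tensor h e)))"
    using le_S_zero[OF U, of "S 0 + \<eta>"] \<open>0 < \<eta>\<close> by force
  then show ?thesis using that by (meson not_le less_imp_le)
qed

text \<open>Among the near-maximizers of \<open>Q + a\<close> the dual norm on \<^term>\<open>V\<close> is almost constant and almost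
  attained at a single \<open>b\<close> once one perturbs \<open>a\<close> in the direction of \<open>b\<close>.\<close>

lemma perturb_to_norming:
  assumes a0: "a0 \<in> V" and \<eta>: "0 < \<eta>" "\<eta> \<le> 1"
  obtains b \<kappa> where "b \<in> V" "norm b \<le> 1" "0 < \<kappa>" "\<kappa> \<le> \<eta>" "c * \<kappa> \<le> 1/8"
    "\<And>\<psi> b'. \<psi> \<in> slice (a0 + \<kappa> *\<^sub>R b) (\<kappa>\<^sup>2) \<Longrightarrow> b' \<in> V \<Longrightarrow> norm b' \<le> 1 \<Longrightarrow> ev \<psi> b' \<le> ev \<psi> b + 4 * \<eta>"
proof -
  define B where "B = {b\<in>V. norm b \<le> 1}"
  \<comment> \<open>\<open>L \<tau>\<close> is the largest dual norm on \<open>V\<close> among the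
    near-maximizers with error \<open>\<tau>\<close>. It decreases with \<open>\<tau>\<close>, and
    \<open>\<tau>0\<close> is chosen where less than \<open>\<eta>\<close> of a further decrease is
    left.\<close>
  define L where "L \<tau> = (SUP (\<psi>, b)\<in>slice a0 \<tau> \<times> B. ev \<psi> b)" for \<tau>
  have evc: "ev \<psi> b \<le> c" "- c \<le> ev \<psi> b" if "\<psi> \<in> D" "b \<in> B" for \<psi> b
  proof -
    have "\<bar>ev \<psi> b\<bar> \<le> c * norm b" using ev_bound that by (simp add: B_def)
    also have "\<dots> \<le> c" using that c by (simp add: B_def mult_left_le)
    finally show "ev \<psi> b \<le> c" "- c \<le> ev \<psi> b" by auto
  qed
  have B0: "0 \<in> B" using V_zero by (simp add: B_def)
  have bdd: "bdd_above ((\<lambda>(\<psi>, b). ev \<psi> b) ` (slice a0 \<tau> \<times> B))" for \<tau>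
  proof (rule bdd_aboveI2)
    fix z assume "z \<in> slice a0 \<tau> \<times> B"
    then show "(case z of (\<psi>, b) \<Rightarrow> ev \<psi> b) \<le> c" using evc(1)[of "fst z" "snd z"] slice_subset[of a0 \<tau>] by (auto simp: case_prod_beta)
  qed
  have ne: "slice a0 \<tau> \<times> B \<noteq> {}" if \<tau>: "0 < \<tau>" for \<tau>
  proof -
    obtain \<psi> where "\<psi> \<in> slice a0 \<tau>" using S_approx[OF a0 \<tau>] .
    then have "(\<psi>, 0) \<in> slice a0 \<tau> \<times> B" using B0 by simp
    then show ?thesis by blast
  qed
  have L_upper: "ev \<psi> b \<le> L \<tau>" if "\<psi> \<in> slice a0 \<tau>" "b \<in> B" for \<psi> b \<tau>
    unfolding L_def using cSUP_upper[OF _ bdd, of "(\<psi>, b)"] that by simp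
  have L_approx: "\<exists>\<psi>\<in>slice a0 \<tau>. \<exists>b\<in>B. L \<tau> - \<eta> \<le> ev \<psi> b" if "0 < \<tau>" for \<tau>
  proof (rule ccontr)
    assume no: "\<not> ?thesis"
    have "L \<tau> \<le> L \<tau> - \<eta>" unfolding L_def[of \<tau>]
    proof (rule cSUP_least[OF ne[OF that]])
      fix z assume "z \<in> slice a0 \<tau> \<times> B"
      then show "(case z of (\<psi>, b) \<Rightarrow> ev \<psi> b) \<le> (SUP (\<psi>, b)\<in>slice a0 \<tau> \<times> B. ev \<psi> b) - \<eta>"
        using no unfolding L_def by force
    qed
    then show False using \<eta> by simp
  qed
  have L_low: "- c \<le> L \<tau>" if \<tau>: "0 < \<tau>" for \<tau>
  proof -
    obtain \<psi> where p: "\<psi> \<in> slice a0 \<tau>" using S_approx[OF a0 \<tau>] by blast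
    then show ?thesis using L_upper[OF p B0] evc(2)[OF _ B0, of \<psi>] slice_subset by force
  qed
  have bddL: "bdd_below (L ` {0<..1/4})" using L_low by (intro bdd_belowI2[of _ "- c"]) auto
  define s where "s = (INF \<tau>\<in>{0<..1/4}. L \<tau>)"
  have s_le: "s \<le> L \<tau>" if "0 < \<tau>" "\<tau> \<le> 1/4" for \<tau>
    unfolding s_def using that by (intro cINF_lower bddL) auto
  obtain \<tau>0 where \<tau>0: "0 < \<tau>0" "\<tau>0 \<le> 1/4" "L \<tau>0 < s + \<eta>"
  proof -
    have "\<exists>\<tau>\<in>{0<..1/4}. L \<tau> < s + \<eta>"
    proof (rule ccontr)
      assume "\<not> ?thesis"
      then have "s + \<eta> \<le> (INF \<tau>\<in>{0<..1/4}. L \<tau>)" by (intro cINF_greatest) (auto simp: not_less)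
      then show False using \<eta> by (simp add: s_def)
    qed
    then show ?thesis using that by auto
  qed
  \<comment> \<open>\<open>\<kappa> * (2 * c + 1) \<le> \<tau>0\<close> places the slice of the
    perturbed function with error \<open>\<kappa>\<^sup>2\<close> inside the slice of
    \<open>a0\<close> with error \<open>\<tau>0\<close>; as \<open>\<tau>0 \<le> 1/4\<close>, it
    also gives \<open>c * \<kappa> \<le> 1/8\<close>.\<close>
  define \<kappa> where "\<kappa> = min \<eta> (\<tau>0 / (2 * c + 1))"
  have \<kappa>: "0 < \<kappa>" "\<kappa> \<le> \<eta>" "\<kappa> \<le> 1" using \<eta> \<tau>0 c by (auto simp: \<kappa>_def)
  have "\<kappa> * (2 * c + 1) \<le> \<tau>0 / (2 * c + 1) * (2 * c + 1)"
    unfolding \<kappa>_def using c by (intro mult_right_mono) auto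
  also have "\<dots> = \<tau>0" using c by simp
  finally have \<kappa>c: "2 * (c * \<kappa>) + \<kappa> \<le> \<tau>0" by (simp add: algebra_simps)
  have \<kappa>2: "\<kappa>\<^sup>2 \<le> \<kappa>" "0 < \<kappa>\<^sup>2" using \<kappa> by (auto simp: power2_eq_square mult_left_le)
  have "0 < c * \<kappa>" using \<kappa> c by simp
  then have \<kappa>\<tau>: "\<kappa>\<^sup>2 \<le> \<tau>0" using \<kappa>c \<kappa>2 by linarith
  obtain \<psi>0 b where p0: "\<psi>0 \<in> slice a0 (\<kappa>\<^sup>2)" and b: "b \<in> B" and pb: "L (\<kappa>\<^sup>2) - \<eta> \<le> ev \<psi>0 b"
    using L_approx[OF \<kappa>2(2)] by blast
  have bV: "b \<in> V" "norm b \<le> 1" using b by (auto simp: B_def)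
  have low: "L \<tau>0 - 2 * \<eta> \<le> ev \<psi>0 b"
    using pb \<tau>0 s_le[of "\<kappa>\<^sup>2"] \<kappa>2 \<kappa>\<tau> by linarith
  let ?a = "a0 + \<kappa> *\<^sub>R b"
  have aV: "?a \<in> V" using a0 bV V_subspace by (intro subspace_add subspace_scale)
  have eva: "ev \<psi> ?a = ev \<psi> a0 + \<kappa> * ev \<psi> b" if "\<psi> \<in> D" for \<psi>
    using functional_on_add[OF ev_linear[OF that] a0 subspace_scale[OF V_subspace bV(1)]]
      functional_on_scale[OF ev_linear[OF that] bV(1)] by simp
  have Sa: "S a0 \<le> S ?a + c * \<kappa>"
  proof -
    have "norm (a0 - ?a) \<le> \<kappa>" using \<kappa> bV by (simp add: mult_left_le)
    then have "c * norm (a0 - ?a) \<le> c * \<kappa>" using c by (intro mult_left_mono) auto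
    then show ?thesis using S_lipschitz[OF a0 aV] by linarith
  qed
  show ?thesis
  proof (rule that[OF bV \<kappa>(1,2)])
    show "c * \<kappa> \<le> 1/8" using \<kappa>c \<kappa> \<tau>0 by linarith
    fix \<psi> b' assume p: "\<psi> \<in> slice ?a (\<kappa>\<^sup>2)" and b': "b' \<in> V" "norm b' \<le> 1"
    have pD: "\<psi> \<in> D" and p0D: "\<psi>0 \<in> D" using p p0 slice_subset by auto
    have 1: "S ?a - \<kappa>\<^sup>2 \<le> Q \<psi> + ev \<psi> a0 + \<kappa> * ev \<psi> b"
      using p eva[OF pD] by (simp add: slice_def)
    have 2: "Q \<psi> + ev \<psi> a0 \<le> S a0" by (rule S_upper[OF pD a0])
    have "\<kappa> * ev \<psi> b \<le> \<kappa> * c" using \<kappa> evc(1)[OF pD b] by (intro mult_left_mono) auto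
    then have "\<kappa> * ev \<psi> b \<le> c * \<kappa>" by (simp only: mult.commute)
    then have "S a0 - \<tau>0 \<le> Q \<psi> + ev \<psi> a0" using 1 Sa \<kappa>c \<kappa>2 by linarith
    then have "\<psi> \<in> slice a0 \<tau>0" using pD by (simp add: slice_def)
    then have up: "ev \<psi> b' \<le> L \<tau>0" using b' by (intro L_upper) (auto simp: B_def)
    have "S a0 - \<kappa>\<^sup>2 + \<kappa> * ev \<psi>0 b \<le> S ?a"
      using S_upper[OF p0D aV] eva[OF p0D] p0 by (simp add: slice_def)
    \<comment> \<open>Both functionals are near-maximizers with error
      \<open>\<kappa>\<^sup>2\<close>, while \<open>b\<close> enters with weight
      \<open>\<kappa>\<close>; division leaves a loss of \<open>2 * \<kappa>\<close> at
      \<open>b\<close>. This is why the error is quadratic in the weight.\<close>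
    then have "\<kappa> * (ev \<psi>0 b - ev \<psi> b) \<le> \<kappa> * (2 * \<kappa>)"
      using 1 2 by (simp add: power2_eq_square algebra_simps)
    then have "ev \<psi>0 b - ev \<psi> b \<le> 2 * \<kappa>" using \<kappa> by (simp only: mult_le_cancel_left_pos)
    then show "ev \<psi> b' \<le> ev \<psi> b + 4 * \<eta>" using up low \<kappa> by linarith
  qed
qed

text \<open>A functional almost attaining its norm at \<open>b\<close> is almost positive near \<open>x\<close>, since \<open>b x\<close> must
  be close to \<open>1\<close>; this makes \<^term>\<open>Q\<close> almost upper semicontinuous on the slice.\<close>

lemma almost_continuous_slice:
  assumes a0: "a0 \<in> V" "c * norm a0 \<le> 1/8" and \<eta>: "0 < \<eta>" "\<eta> \<le> 1/8"
  obtains a \<tau> where "a \<in> V" "norm (a - a0) \<le> \<eta>" "0 < \<tau>" "\<tau> \<le> \<eta>"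
    "\<And>\<psi>. \<psi> \<in> closure (slice a \<tau>) \<Longrightarrow> S a - \<eta> \<le> Q \<psi> + ev \<psi> a"
proof -
  \<comment> \<open>Chosen so that the error \<open>K\<close> in the comparison \<open>small\<close>
    becomes \<open>\<eta> / 8\<close>.\<close>
  define \<epsilon> where "\<epsilon> = \<eta> / (8 * (c + 8))"
  have \<epsilon>: "0 < \<epsilon>" "\<epsilon> \<le> \<eta> / 72" using \<eta> c by (auto simp: \<epsilon>_def divide_simps)
  define K where "K = (c + 8) * \<epsilon>"
  have "c + 8 \<noteq> 0" using c by simp
  then have K: "K = \<eta> / 8" by (simp add: K_def \<epsilon>_def field_simps)
  have "\<epsilon> \<le> 1" using \<epsilon> \<eta> by simp
  then obtain b \<kappa> where b: "b \<in> V" "norm b \<le> 1" and \<kappa>: "0 < \<kappa>" "\<kappa> \<le> \<epsilon>" "c * \<kappa> \<le> 1/8"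
    and norming: "\<And>\<psi> b'. \<psi> \<in> slice (a0 + \<kappa> *\<^sub>R b) (\<kappa>\<^sup>2) \<Longrightarrow> b' \<in> V \<Longrightarrow> norm b' \<le> 1 \<Longrightarrow>
      ev \<psi> b' \<le> ev \<psi> b + 4 * \<epsilon>"
    using perturb_to_norming[OF a0(1) \<epsilon>(1)] by metis
  define a where "a = a0 + \<kappa> *\<^sub>R b"
  define \<tau> where "\<tau> = \<kappa>\<^sup>2"
  have \<kappa>1: "\<kappa> \<le> 1" using \<kappa> \<open>\<epsilon> \<le> 1\<close> by simp
  have "\<kappa> * \<kappa> \<le> \<kappa>" using \<kappa> \<kappa>1 by (simp add: mult_left_le)
  then have \<tau>: "0 < \<tau>" "\<tau> \<le> \<epsilon>" using \<kappa> unfolding \<tau>_def power2_eq_square by (simp, linarith)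
  have aV: "a \<in> V" unfolding a_def using a0 b V_subspace by (intro subspace_add subspace_scale)
  have aa0: "norm (a - a0) \<le> \<kappa>" using b \<kappa> by (simp add: a_def mult_left_le)
  have "c * norm a \<le> c * (norm a0 + \<kappa>)"
    using aa0 norm_triangle_sub[of a a0] c by (intro mult_left_mono) auto
  then have ca: "c * norm a \<le> 1/4" using a0 \<kappa> by (simp add: distrib_left)
  have Sa: "3/4 \<le> S a" using S_lipschitz[OF V_zero aV] S_zero_ge_1 ca by simp
  let ?\<Sigma> = "closure (slice a \<tau>)"
  have \<Sigma>D: "\<psi> \<in> D" if "\<psi> \<in> ?\<Sigma>" for \<psi> using that closure_slice_subset by blast
  have norm': "ev \<psi> b' \<le> ev \<psi> b + 4 * \<epsilon>" if "\<psi> \<in> ?\<Sigma>" "b' \<in> V" "norm b' \<le> 1" for \<psi> b'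
  proof -
    have "?\<Sigma> \<subseteq> {\<psi>. ev \<psi> b' \<le> ev \<psi> b + 4 * \<epsilon>}"
      using norming that unfolding a_def \<tau>_def
      by (intro closure_minimal closed_Collect_le continuous_intros continuous_on_ev) auto
    then show ?thesis using that by blast
  qed
  \<comment> \<open>The dual norm is almost attained at \<open>b\<close>, so a \<open>w\<close> that
    can be added to \<open>b\<close> without leaving the ball of radius
    \<open>1 + \<epsilon>\<close> cannot raise the value noticeably. Peaks and differences of peaks
    are tested this way.\<close>
  have small: "ev \<psi> w \<le> K" if p: "\<psi> \<in> ?\<Sigma>" and w: "w \<in> V" "norm (b + w) \<le> 1 + \<epsilon>" for \<psi> w
  proof -
    let ?b = "(1 / (1 + \<epsilon>)) *\<^sub>R (b + w)"
    have bw: "b + w \<in> V" using b w V_subspace by (intro subspace_add)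
    have "ev \<psi> ?b \<le> ev \<psi> b + 4 * \<epsilon>"
    proof (rule norm'[OF p])
      show "?b \<in> V" using bw V_subspace by (intro subspace_scale)
      show "norm ?b \<le> 1" using w \<epsilon> by simp
    qed
    moreover have "ev \<psi> ?b = (ev \<psi> b + ev \<psi> w) / (1 + \<epsilon>)"
      using functional_on_scale[OF ev_linear[OF \<Sigma>D[OF p]] bw]
        functional_on_add[OF ev_linear[OF \<Sigma>D[OF p]] b(1) w(1)] by simp
    ultimately have "ev \<psi> b + ev \<psi> w \<le> (ev \<psi> b + 4 * \<epsilon>) * (1 + \<epsilon>)"
      using \<epsilon> by (simp add: pos_divide_le_eq)
    then have le: "ev \<psi> w \<le> \<epsilon> * ev \<psi> b + 4 * \<epsilon> + 4 * \<epsilon> * \<epsilon>" by (simp add: algebra_simps)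
    have "ev \<psi> b \<le> c * norm b" using ev_bound[OF \<Sigma>D[OF p] b(1)] by simp
    also have "\<dots> \<le> c" using b c by (simp add: mult_left_le)
    finally have "\<epsilon> * ev \<psi> b \<le> \<epsilon> * c" using \<epsilon> by (intro mult_left_mono) auto
    moreover have "4 * \<epsilon> * \<epsilon> \<le> 4 * \<epsilon>" using \<epsilon> \<open>\<epsilon> \<le> 1\<close> by (simp add: mult_left_le)
    ultimately show ?thesis using le by (simp add: K_def algebra_simps)
  qed
  define \<beta> where "\<beta> = b x"
  have b1: "\<bar>b z\<bar> \<le> 1" for z using norm_bounded[of b z] b by simp
  define U where "U = {z. \<bar>b z - \<beta>\<bar> < \<epsilon>}"
  have U: "open U" "x \<in> U"
    unfolding U_def using \<epsilon>
    by (auto intro!: open_Collect_less continuous_intros simp: \<beta>_def)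
  have Ub: "\<beta> - \<epsilon> \<le> b z" "b z \<le> \<beta> + \<epsilon>" if "z \<in> U" for z
    using that by (auto simp: U_def)
  define \<delta> where "\<delta> = \<epsilon> / 2"
  have \<delta>: "0 < \<delta>" "\<delta> < 1" using \<epsilon> \<open>\<epsilon> \<le> 1\<close> by (auto simp: \<delta>_def)
  have \<beta>1: "\<bar>\<beta>\<bar> \<le> 1" using b1 by (simp add: \<beta>_def)
  obtain \<psi>1 where p1: "\<psi>1 \<in> slice a \<tau>" using S_approx[OF aV \<tau>(1)] by blast
  then have p1\<Sigma>: "\<psi>1 \<in> ?\<Sigma>" and p1D: "\<psi>1 \<in> D" using closure_subset slice_subset by blast+
  have Q1: "1/4 \<le> Q \<psi>1"
    using p1 ev_bound[OF p1D aV] ca Sa \<tau> \<epsilon> \<eta> by (simp add: slice_def abs_le_iff)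
  \<comment> \<open>There is room \<open>1 - \<beta>\<close> between \<open>b\<close> and 1 near
    \<open>x\<close>, so this multiple of a peak may be added to \<open>b\<close>. Because
    \<open>Q \<psi>1 \<ge> 1/4\<close>, the room must be at most \<open>4 * K\<close>.\<close>
  have "(1 - \<beta>) * Q \<psi>1 \<le> K"
  proof (cases "\<beta> = 1")
    case True
    then show ?thesis using K \<eta> by simp
  next
    case False
    then have \<beta>lt: "0 < 1 - \<beta>" using \<beta>1 by auto
    have "Q \<psi>1 \<le> K / (1 - \<beta>)"
    proof (rule Q_le[OF p1D U \<delta>])
      fix h assume h: "h \<in> peaks H1 e x U \<delta>"
      let ?w = "(1 - \<beta>) *\<^sub>R h"
      have wV: "?w \<in> V" using peaks_in[OF h] V_subspace by (intro subspace_scale)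
      have "norm (b + ?w) \<le> 1 + \<epsilon>"
      proof (rule norm_le_tensor_space[OF e(1)])
        show "b + ?w \<in> V" using b wV V_subspace by (intro subspace_add)
        fix z assume z: "z \<in> choquet_boundary H1"
        let ?h = "h z"
        have h0: "0 \<le> (1 - \<beta>) * ?h" using \<beta>lt peaks_nonneg[OF h] by simp
        have "b z + (1 - \<beta>) * ?h \<le> 1 + \<epsilon>"
        proof (cases "z \<in> U")
          case True
          have "(1 - \<beta>) * ?h \<le> 1 - \<beta>" using \<beta>lt peaks_le_1[OF h] by (simp add: mult_left_le)
          then show ?thesis using Ub[OF True] by simp
        next
          case False
          have "(1 - \<beta>) * ?h \<le> 2 * \<delta>"
            using peaks_off[OF h z False] peaks_nonneg[OF h, of z] \<beta>1 \<beta>lt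
            by (intro mult_mono) auto
          then show ?thesis using b1[of z] by (simp add: \<delta>_def abs_le_iff)
        qed
        then show "\<bar>(b + ?w) z\<bar> \<le> 1 + \<epsilon>"
          using h0 b1[of z] \<epsilon> by (simp add: abs_le_iff)
      qed (use \<epsilon> in simp)
      then have "ev \<psi>1 ?w \<le> K" by (rule small[OF p1\<Sigma> wV])
      then show "ev \<psi>1 h \<le> K / (1 - \<beta>)"
        using functional_on_scale[OF ev_linear[OF p1D] peaks_in[OF h]] \<beta>lt
        by (simp add: pos_le_divide_eq mult.commute)
    qed
    then show ?thesis using \<beta>lt by (simp add: pos_le_divide_eq mult.commute)
  qed
  moreover have "(1 - \<beta>) * (1/4) \<le> (1 - \<beta>) * Q \<psi>1"
    using Q1 \<beta>1 by (intro mult_left_mono) auto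
  ultimately have "1 - \<beta> \<le> 4 * K" by simp
  then have \<beta>\<epsilon>: "0 \<le> \<beta> - \<epsilon>" using K \<eta> \<epsilon> by simp
  \<comment> \<open>\<open>h'\<close> lives where \<open>h\<close> is almost 1, so on the boundary
    \<open>h' - h\<close> is at most \<open>\<delta>\<close>, and it falls below
    \<open>- \<delta>\<close> only inside \<open>U\<close>, where \<open>b\<close> is nonnegative.
    Adding it to \<open>b\<close> therefore keeps the norm below
    \<open>1 + \<epsilon>\<close>.\<close>
  have upper: "Q \<psi> \<le> ev \<psi> h + K" if p: "\<psi> \<in> ?\<Sigma>" and h: "h \<in> peaks H1 e x U \<delta>" for \<psi> h
  proof -
    define U2 where "U2 = U \<inter> {z. 1 - \<delta> < h z}"
    have "open U2" unfolding U2_def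
      by (intro open_Int U open_Collect_less continuous_intros)
    moreover have "x \<in> U2" using U peaks_at[OF h] by (simp add: U2_def)
    ultimately show ?thesis
    proof (rule Q_le[OF \<Sigma>D[OF p] _ _ \<delta>])
      fix h' assume h': "h' \<in> peaks H1 e x U2 \<delta>"
      let ?w = "h' - h"
      have wV: "?w \<in> V"
        using peaks_in[OF h] peaks_in[OF h'] V_subspace by (intro subspace_diff)
      have "norm (b + ?w) \<le> 1 + \<epsilon>"
      proof (rule norm_le_tensor_space[OF e(1)])
        show "b + ?w \<in> V" using b wV V_subspace by (intro subspace_add)
        fix z assume z: "z \<in> choquet_boundary H1"
        let ?h = "h z" and ?h' = "h' z" and ?b = "b z"
        have bd: "0 \<le> ?h" "?h \<le> 1" "0 \<le> ?h'" "?h' \<le> 1"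
          using peaks_nonneg[OF h] peaks_nonneg[OF h'] peaks_le_1[OF h] peaks_le_1[OF h'] by auto
        have b1z: "?b \<le> 1" "- 1 \<le> ?b" using b1[of z] by auto
        have dh: "?h' - ?h \<le> \<delta>"
        proof (cases "z \<in> U2")
          case True
          then show ?thesis using bd by (simp add: U2_def)
        next
          case False
          then show ?thesis using peaks_off[OF h' z False] bd by simp
        qed
        have "- (1 + \<epsilon>) \<le> ?b + (?h' - ?h)"
        proof (cases "z \<in> U")
          case True
          then show ?thesis using Ub(1)[OF True] \<beta>\<epsilon> bd \<epsilon> by linarith
        next
          case False
          then have "- \<delta> \<le> ?h' - ?h" using peaks_off[OF h z False] bd by simp
          then show ?thesis using b1z \<epsilon> by (simp add: \<delta>_def)
        qed
        moreover have "?b + (?h' - ?h) \<le> 1 + \<epsilon>" using dh b1z \<epsilon> by (simp add: \<delta>_def)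
        ultimately show "\<bar>(b + ?w) z\<bar> \<le> 1 + \<epsilon>"
          by (simp add: abs_le_iff)
      qed (use \<epsilon> in simp)
      then have "ev \<psi> ?w \<le> K" by (rule small[OF p wV])
      then show "ev \<psi> h' \<le> ev \<psi> h + K"
        using functional_on_diff[OF V_subspace ev_linear[OF \<Sigma>D[OF p]]
            peaks_in[OF h'] peaks_in[OF h]] by simp
    qed
  qed
  show ?thesis
  proof (rule that[OF aV])
    show "norm (a - a0) \<le> \<eta>" using aa0 \<kappa> \<epsilon> \<eta> by simp
    show "0 < \<tau>" "\<tau> \<le> \<eta>" using \<tau> \<epsilon> \<eta> by auto
    fix \<psi> assume p: "\<psi> \<in> ?\<Sigma>"
    have "S a - \<eta> - ev \<psi> a \<le> Q \<psi>"
    proof (rule Q_ge[OF \<Sigma>D[OF p] U \<delta>])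
      fix h assume h: "h \<in> peaks H1 e x U \<delta>"
      \<comment> \<open>For a fixed \<open>h\<close> the inequality involves only evaluations, so it
        passes to the closure; the limit over \<open>h\<close> is taken afterwards and restores
        \<open>Q\<close>.\<close>
      have "?\<Sigma> \<subseteq> {\<psi>. S a - \<eta> - ev \<psi> a \<le> ev \<psi> h}"
      proof (intro closure_minimal closed_Collect_le continuous_intros continuous_on_ev subsetI CollectI)
        fix \<psi>' assume "\<psi>' \<in> slice a \<tau>"
        moreover from this have "Q \<psi>' \<le> ev \<psi>' h + K" using upper h closure_subset by blast
        ultimately show "S a - \<eta> - ev \<psi>' a \<le> ev \<psi>' h" using K \<tau> \<epsilon> \<eta> by (simp add: slice_def)
      qed
      then show "S a - \<eta> - ev \<psi> a \<le> ev \<psi> h" using p by blast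
    qed
    then show "S a - \<eta> \<le> Q \<psi> + ev \<psi> a" by simp
  qed
qed

text \<open>A variational principle with geometric steps: the closed slices decrease, compactness
  gives them a common point, and almost continuity makes the closure of each slice consist of
  near-maximizers. Their intersection is exactly the set of maximizers for the limit
  \<open>a\<close>, which is therefore closed and nonempty.\<close>

lemma attaining_perturbation:
  assumes t: "0 < t" "t \<le> 1/8"
  obtains a where "a \<in> V" "c * norm a \<le> t"
    "closed {\<psi>\<in>D. Q \<psi> + ev \<psi> a = S a}" "{\<psi>\<in>D. Q \<psi> + ev \<psi> a = S a} \<noteq> {}"
proof -
  \<comment> \<open>The second component is both the error of the slice and the remaining budget: a
    step costs one sixteenth of it, and the next budget is at most another sixteenth, so
    \<open>t\<close> is never exceeded.\<close>
  define good where "good p \<longleftrightarrow> fst p \<in> V \<and> 0 < snd p \<and> c * norm (fst p) + snd p \<le> t"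
    for p :: "('k1 \<Rightarrow>\<^sub>C real) \<times> real"
  define next_slice where "next_slice p q \<longleftrightarrow> norm (fst q - fst p) \<le> snd p / (16 * c) \<and> snd q \<le> snd p / 16 \<and>
      (\<forall>\<psi>\<in>closure (slice (fst q) (snd q)). S (fst q) - snd p / 16 \<le> Q \<psi> + ev \<psi> (fst q))"
    for p q :: "('k1 \<Rightarrow>\<^sub>C real) \<times> real"
  have "\<exists>s. \<forall>n. good (s n) \<and> next_slice (s n) (s (Suc n))"
  proof (rule dependent_nat_choice)
    show "\<exists>p. good p" using t V_zero by (intro exI[of _ "(0, t)"]) (simp add: good_def)
    fix p :: "('k1 \<Rightarrow>\<^sub>C real) \<times> real" and n :: nat assume p: "good p"
    obtain a0 \<tau>0 where p': "p = (a0, \<tau>0)" by (cases p)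
    have a0: "a0 \<in> V" "0 < \<tau>0" "c * norm a0 + \<tau>0 \<le> t" using p by (auto simp: good_def p')
    let ?\<eta> = "\<tau>0 / (16 * c)"
    have "0 \<le> c * norm a0" using c by simp
    then have \<tau>t: "\<tau>0 \<le> 1/8" "c * norm a0 \<le> 1/8" using a0 t by auto
    have \<eta>: "0 < ?\<eta>" "?\<eta> \<le> \<tau>0 / 16" using a0 c by (auto simp: field_simps)
    then have "?\<eta> \<le> 1/8" using \<tau>t by simp
    then obtain a \<tau> where a: "a \<in> V" "norm (a - a0) \<le> ?\<eta>" "0 < \<tau>" "\<tau> \<le> ?\<eta>"
      "\<And>\<psi>. \<psi> \<in> closure (slice a \<tau>) \<Longrightarrow> S a - ?\<eta> \<le> Q \<psi> + ev \<psi> a"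
      using almost_continuous_slice[OF a0(1) \<tau>t(2) \<eta>(1)] by metis
    have "c * norm a \<le> c * (norm a0 + ?\<eta>)"
      using a(2) norm_triangle_sub[of a a0] c by (intro mult_left_mono) auto
    then have "c * norm a \<le> c * norm a0 + \<tau>0 / 16" using c by (simp add: distrib_left)
    then have "good (a, \<tau>)" using a a0 \<eta> by (simp add: good_def)
    moreover have "next_slice p (a, \<tau>)"
      unfolding next_slice_def p' fst_conv snd_conv
    proof (intro conjI ballI)
      show "norm (a - a0) \<le> ?\<eta>" by (rule a(2))
      show "\<tau> \<le> \<tau>0 / 16" using a(4) \<eta>(2) by linarith
      fix \<psi> assume "\<psi> \<in> closure (slice a \<tau>)"
      from a(5)[OF this] show "S a - \<tau>0 / 16 \<le> Q \<psi> + ev \<psi> a" using \<eta>(2) by linarith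
    qed
    ultimately show "\<exists>q. good q \<and> next_slice p q" by blast
  qed
  then obtain s where s: "\<And>n. good (s n)" "\<And>n. next_slice (s n) (s (Suc n))" by blast
  define \<alpha> where "\<alpha> n = fst (s n)" for n
  define \<tau> where "\<tau> n = snd (s n)" for n
  have \<alpha>V: "\<alpha> n \<in> V" and \<tau>0: "0 < \<tau> n" and \<alpha>t: "c * norm (\<alpha> n) + \<tau> n \<le> t" for n
    using s(1)[of n] by (auto simp: good_def \<alpha>_def \<tau>_def)
  have step: "norm (\<alpha> (Suc n) - \<alpha> n) \<le> \<tau> n / (16 * c)" and \<tau>16: "\<tau> (Suc n) \<le> \<tau> n / 16"
    and cont: "\<psi> \<in> closure (slice (\<alpha> (Suc n)) (\<tau> (Suc n))) \<Longrightarrow>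
      S (\<alpha> (Suc n)) - \<tau> n / 16 \<le> Q \<psi> + ev \<psi> (\<alpha> (Suc n))" for n \<psi>
    using s(2)[of n] by (auto simp: next_slice_def \<alpha>_def \<tau>_def)
  have cstep: "c * norm (\<alpha> (Suc n) - \<alpha> n) \<le> \<tau> n / 16" for n
  proof -
    have "c * norm (\<alpha> (Suc n) - \<alpha> n) \<le> c * (\<tau> n / (16 * c))"
      using c by (intro mult_left_mono step) auto
    then show ?thesis using c by simp
  qed
  have diff: "c * norm (\<alpha> (n + k) - \<alpha> n) \<le> (\<tau> n - \<tau> (n + k)) / 8" for n k
  proof (induction k)
    case (Suc k)
    have "c * norm (\<alpha> (n + Suc k) - \<alpha> n) \<le> c * (norm (\<alpha> (Suc (n + k)) - \<alpha> (n + k)) + norm (\<alpha> (n + k) - \<alpha> n))"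
      using c norm_triangle_ineq[of "\<alpha> (Suc (n + k)) - \<alpha> (n + k)" "\<alpha> (n + k) - \<alpha> n"]
      by (intro mult_left_mono) auto
    also have "\<dots> \<le> \<tau> (n + k) / 16 + (\<tau> n - \<tau> (n + k)) / 8"
      unfolding distrib_left using cstep[of "n + k"] Suc by (rule add_mono)
    also have "\<dots> \<le> (\<tau> n - \<tau> (Suc (n + k))) / 8" using \<tau>16[of "n + k"] \<tau>0[of "n + k"]
      unfolding diff_divide_distrib by linarith
    finally show ?case by simp
  qed simp
  have diff': "c * norm (\<alpha> m - \<alpha> n) \<le> \<tau> n / 8" if "n \<le> m" for m n
    using diff[of n "m - n"] that \<tau>0[of m] by simp
  have \<tau>pow: "\<tau> n \<le> t * (1/16) ^ n" for n
  proof (induction n)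
    case 0
    have "0 \<le> c * norm (\<alpha> 0)" using c by simp
    then show ?case using \<alpha>t[of 0] by simp
  next
    case (Suc n)
    then show ?case using \<tau>16[of n] by simp
  qed
  have \<tau>lim: "\<tau> \<longlonglongrightarrow> 0"
  proof (rule tendsto_sandwich[of "\<lambda>_. 0" \<tau> sequentially "\<lambda>n. t * (1/16) ^ n"])
    show "(\<lambda>n. t * (1/16) ^ n) \<longlonglongrightarrow> 0" by (intro tendsto_mult_right_zero LIMSEQ_power_zero) simp
    show "eventually (\<lambda>n. 0 \<le> \<tau> n) sequentially" using \<tau>0 by (simp add: less_imp_le)
    show "eventually (\<lambda>n. \<tau> n \<le> t * (1/16) ^ n) sequentially" using \<tau>pow by simp
  qed simp
  have "Cauchy \<alpha>"
  proof (rule CauchyI')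
    fix \<epsilon> :: real assume "0 < \<epsilon>"
    then obtain N where N: "\<tau> N < \<epsilon>"
      using order_tendstoD(2)[OF \<tau>lim] eventually_happens'[OF sequentially_bot] by blast
    have \<tau>m: "\<tau> m \<le> \<tau> N" if "N \<le> m" for m
      using that
    proof (induction m rule: dec_induct)
      case (step m)
      then show ?case using \<tau>16[of m] \<tau>0[of m] by linarith
    qed simp
    have "dist (\<alpha> m) (\<alpha> n) < \<epsilon>" if "N \<le> m" "m < n" for m n
    proof -
      have "norm (\<alpha> n - \<alpha> m) \<le> c * norm (\<alpha> n - \<alpha> m)"
        using mult_right_mono[OF c norm_ge_zero, of "\<alpha> n - \<alpha> m"] by simp
      also have "\<dots> \<le> \<tau> m / 8" using diff' that by simp
      also have "\<dots> < \<epsilon>" using \<tau>m[OF that(1)] N \<tau>0[of m] by simp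
      finally show ?thesis by (simp add: dist_norm norm_minus_commute)
    qed
    then show "\<exists>M. \<forall>m\<ge>M. \<forall>n>m. dist (\<alpha> m) (\<alpha> n) < \<epsilon>" by blast
  qed
  then obtain a where lim: "\<alpha> \<longlonglongrightarrow> a"
    using Cauchy_bcontfun_convergent by blast
  have aV: "a \<in> V" using closed_sequentially[OF closed_tensor_space _ lim] \<alpha>V by blast
  have an: "c * norm (a - \<alpha> n) \<le> \<tau> n / 8" for n
  proof (rule tendsto_upperbound)
    show "(\<lambda>m. c * norm (\<alpha> m - \<alpha> n)) \<longlonglongrightarrow> c * norm (a - \<alpha> n)" by (intro tendsto_intros lim)
    show "eventually (\<lambda>m. c * norm (\<alpha> m - \<alpha> n) \<le> \<tau> n / 8) sequentially"
      using diff' by (auto intro!: eventually_sequentiallyI[of n])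
  qed simp
  have evd: "\<bar>ev \<psi> a - ev \<psi> (\<alpha> n)\<bar> \<le> \<tau> n / 8" if p: "\<psi> \<in> D" for \<psi> n
    using functional_on_diff[OF V_subspace ev_linear[OF p] aV \<alpha>V[of n]]
      ev_bound[OF p subspace_diff[OF V_subspace aV \<alpha>V[of n]]] an[of n] by simp
  have Sd: "\<bar>S a - S (\<alpha> n)\<bar> \<le> \<tau> n / 8" for n
    using S_lipschitz[OF aV \<alpha>V[of n]] S_lipschitz[OF \<alpha>V[of n] aV] an[of n]
    unfolding norm_minus_commute[of "\<alpha> n"] abs_le_iff by linarith
  let ?C = "\<lambda>n. closure (slice (\<alpha> (Suc n)) (\<tau> (Suc n)))"
  \<comment> \<open>Passing from \<open>\<alpha> (Suc n)\<close> to \<open>a\<close> changes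
    \<open>ev\<close> and \<open>S\<close> by at most an eighth of the slice error each, so an exact
    maximizer for \<open>a\<close> lies in every slice. Conversely, a point of all closures misses
    the maximum by at most \<open>\<tau> n\<close> for every \<open>n\<close>.\<close>
  have eq: "{\<psi>\<in>D. Q \<psi> + ev \<psi> a = S a} = (\<Inter>n. ?C n)"
  proof (intro equalityI subsetI INT_I)
    fix \<psi> n assume "\<psi> \<in> {\<psi>\<in>D. Q \<psi> + ev \<psi> a = S a}"
    then have p: "\<psi> \<in> D" "Q \<psi> + ev \<psi> a = S a" by auto
    have "S (\<alpha> (Suc n)) - \<tau> (Suc n) \<le> Q \<psi> + ev \<psi> (\<alpha> (Suc n))"
      using evd[OF p(1), of "Suc n"] Sd[of "Suc n"] \<tau>0[of "Suc n"] p(2)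
      unfolding abs_le_iff by linarith
    then have "\<psi> \<in> slice (\<alpha> (Suc n)) (\<tau> (Suc n))" using p(1) by (simp add: slice_def)
    then show "\<psi> \<in> ?C n" using closure_subset by blast
  next
    fix \<psi> assume p: "\<psi> \<in> (\<Inter>n. ?C n)"
    then have pD: "\<psi> \<in> D" using closure_slice_subset by blast
    have le: "S a - (Q \<psi> + ev \<psi> a) \<le> \<tau> n" for n
    proof -
      have "\<psi> \<in> ?C n" using p by blast
      from cont[OF this] show ?thesis
        using evd[OF pD, of "Suc n"] Sd[of "Suc n"] \<tau>0[of n] \<tau>16[of n]
        unfolding abs_le_iff by linarith
    qed
    have "S a - (Q \<psi> + ev \<psi> a) \<le> 0"
      by (rule tendsto_lowerbound[OF \<tau>lim]) (use le in auto)
    then show "\<psi> \<in> {\<psi>\<in>D. Q \<psi> + ev \<psi> a = S a}" using S_upper[OF pD aV] pD by simp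
  qed
  have sub: "?C (Suc n) \<subseteq> ?C n" for n
  proof (intro closure_mono subsetI)
    fix \<psi> assume p: "\<psi> \<in> slice (\<alpha> (Suc (Suc n))) (\<tau> (Suc (Suc n)))"
    let ?a = "\<alpha> (Suc n)" and ?b = "\<alpha> (Suc (Suc n))"
    have pD: "\<psi> \<in> D" using p slice_subset by blast
    have d: "c * norm (?b - ?a) \<le> \<tau> (Suc n) / 16" by (rule cstep)
    have "\<bar>ev \<psi> ?b - ev \<psi> ?a\<bar> \<le> \<tau> (Suc n) / 16"
      using functional_on_diff[OF V_subspace ev_linear[OF pD] \<alpha>V[of "Suc (Suc n)"] \<alpha>V[of "Suc n"]]
        ev_bound[OF pD subspace_diff[OF V_subspace \<alpha>V[of "Suc (Suc n)"] \<alpha>V[of "Suc n"]]] d by simp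
    moreover have "S ?a \<le> S ?b + \<tau> (Suc n) / 16"
      using S_lipschitz[OF \<alpha>V[of "Suc n"] \<alpha>V[of "Suc (Suc n)"]] d by (simp add: norm_minus_commute)
    moreover have "S ?b - \<tau> (Suc (Suc n)) \<le> Q \<psi> + ev \<psi> ?b" using p by (simp add: slice_def)
    ultimately have "S ?a - \<tau> (Suc n) \<le> Q \<psi> + ev \<psi> ?a"
      using \<tau>16[of "Suc n"] \<tau>0[of "Suc n"] unfolding abs_le_iff by linarith
    then show "\<psi> \<in> slice ?a (\<tau> (Suc n))" using pD by (simp add: slice_def)
  qed
  have "\<Inter>(range ?C) \<noteq> {}"
  proof (rule compact_chain_Inter[OF compact_dual_ball[OF H2(1)]])
    have dec: "decseq ?C" using sub by (rule decseq_SucI)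
    fix X Y assume "X \<in> range ?C" "Y \<in> range ?C"
    then obtain m n where "X = ?C m" "Y = ?C n" by blast
    then show "X \<subseteq> Y \<or> Y \<subseteq> X" using dec nle_le[of m n] by (auto dest: decseqD)
  next
    fix X assume "X \<in> range ?C"
    then obtain n where n: "X = ?C n" by blast
    have "slice (\<alpha> (Suc n)) (\<tau> (Suc n)) \<noteq> {}" using S_approx[OF \<alpha>V \<tau>0] by blast
    then show "closed X \<and> X \<noteq> {} \<and> X \<subseteq> D" using closure_slice_subset by (simp add: n)
  qed simp
  moreover have "closed (\<Inter>n. ?C n)" by (intro closed_INT) simp
  moreover have "c * norm a \<le> t"
  proof -
    have "c * norm a \<le> c * (norm (a - \<alpha> 0) + norm (\<alpha> 0))"
      using c norm_triangle_sub[of a "\<alpha> 0"] by (intro mult_left_mono) auto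
    then show ?thesis using an[of 0] \<alpha>t[of 0] \<tau>0[of 0] by (simp add: distrib_left)
  qed
  ultimately show ?thesis using that[OF aV] unfolding eq by blast
qed

text \<open>The maximizers for a small perturbation form a closed face without 0, because
  \<open>S a\<close> is still positive. The perturbation is paid for twice, in \<open>S\<close> and
  in \<open>ev\<close>, so an evaluation in the face has a \<open>Q\<close> value within
  \<open>2 * t\<close> of \<open>S 0\<close>.\<close>

theorem peak_image_position:
  assumes "0 < \<eta>"
  obtains y e' where "y \<in> choquet_boundary H2" "norm e' \<le> 1"
    "eventually (\<lambda>h. S 0 - \<eta> < blinfun_apply e' (J (tensor h e) y)) F"
proof -
  define t where "t = min (\<eta> / 4) (1/8)"
  have t: "0 < t" "t \<le> 1/8" "t \<le> \<eta> / 4" using assms by (auto simp: t_def)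
  obtain a where a: "a \<in> V" "c * norm a \<le> t" and
    \<Phi>: "closed {\<psi>\<in>D. Q \<psi> + ev \<psi> a = S a}" "{\<psi>\<in>D. Q \<psi> + ev \<psi> a = S a} \<noteq> {}"
    using attaining_perturbation[OF t(1,2)] by blast
  have Sa: "S 0 \<le> S a + t" using S_lipschitz[OF V_zero a(1)] a(2) by simp
  have face: "{\<psi>\<in>D. Q \<psi> + ev \<psi> a = S a} face_of D"
  proof (rule face_of_maximum)
    show "convex D" by (rule convex_dual_ball[OF H2(1)])
    show "Q \<psi> + ev \<psi> a \<le> S a" if "\<psi> \<in> D" for \<psi> by (rule S_upper[OF that a(1)])
    fix \<psi> \<psi>' and u :: real assume "\<psi> \<in> D" "\<psi>' \<in> D" "0 \<le> u" "u \<le> 1"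
    from Q_affine[OF this]
    show "Q ((1 - u) *\<^sub>R \<psi> + u *\<^sub>R \<psi>') + ev ((1 - u) *\<^sub>R \<psi> + u *\<^sub>R \<psi>') a =
        (1 - u) * (Q \<psi> + ev \<psi> a) + u * (Q \<psi>' + ev \<psi>' a)"
      by (simp add: ev_def scaleR_fun_def algebra_simps)
  qed
  have "0 \<notin> {\<psi>\<in>D. Q \<psi> + ev \<psi> a = S a}"
  proof
    assume "0 \<in> {\<psi>\<in>D. Q \<psi> + ev \<psi> a = S a}"
    moreover have "Q 0 \<le> 0"
      by (rule Q_le[OF D_zero, of UNIV "1/2"]) (auto simp: ev_def)
    ultimately have "S a \<le> 0" by (simp add: ev_def)
    then show False using Sa S_zero_ge_1 t by simp
  qed
  then obtain e' y where y: "y \<in> choquet_boundary H2" "norm e' \<le> 1"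
    and p: "eval_at H2 e' y \<in> {\<psi>\<in>D. Q \<psi> + ev \<psi> a = S a}"
    using closed_face_meets_choquet_boundary[OF H2 face \<Phi>] by blast
  let ?p = "eval_at H2 e' y"
  have pD: "?p \<in> D" using p by blast
  have "S 0 - \<eta> < Q ?p" using p ev_bound[OF pD a(1)] a(2) Sa t by (simp add: abs_le_iff)
  then have "eventually (\<lambda>h. S 0 - \<eta> < ev ?p h) F" by (rule order_tendstoD(1)[OF Q_tendsto[OF pD]])
  moreover have "eventually (\<lambda>h. h \<in> peaks H1 e x UNIV (1/2)) F" by (intro eventually_peaks) auto
  ultimately have "eventually (\<lambda>h. S 0 - \<eta> < blinfun_apply e' (J (tensor h e) y)) F"
  proof eventually_elim
    case (elim h)
    then show ?case using V_J[OF peaks_in[OF elim(2)]] by (simp add: ev_def eval_at_def)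
  qed
  then show ?thesis using that y by blast
qed

end

section \<open>Banach lattices\<close>

lemma sup_uminus_nonneg:
  fixes v :: "'e::banach_lattice"
  shows "0 \<le> sup v (- v)"
proof -
  have "v + - v \<le> sup v (- v) + sup v (- v)" by (intro add_mono) auto
  then have "0 \<le> 2 *\<^sub>R sup v (- v)" by (simp add: scaleR_2)
  then have "0 \<le> (1/2::real) *\<^sub>R (2 *\<^sub>R sup v (- v))" by (rule scaleR_nonneg_nonneg[rotated]) simp
  then show ?thesis by simp
qed

lemma sup_uminus_of_nonneg:
  fixes v :: "'e::banach_lattice"
  assumes "0 \<le> v"
  shows "sup v (- v) = v"
proof -
  have "- v \<le> v" using assms by (metis neg_le_0_iff_le order_trans)
  then show ?thesis by (simp add: sup_absorb1)
qed

lemma norm_le_if_abs_le: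
  fixes v w :: "'e::banach_lattice"
  assumes "0 \<le> w" "v \<le> w" "- v \<le> w"
  shows "norm v \<le> norm w"
  using assms by (intro norm_lattice_mono) (simp add: sup_uminus_of_nonneg)

text \<open>For positive \<open>v\<close> the negative part of \<open>w\<close> is dominated by the
  modulus of \<open>v - w\<close>, so its norm is at most the distance from \<open>w\<close> to the
  cone.\<close>

lemma closed_positive_cone:
  shows "closed {v :: 'e::banach_lattice. 0 \<le> v}"
proof -
  have "0 \<le> w" if w: "w \<in> closure {v. 0 \<le> v}" for w :: 'e
  proof -
    have "norm (sup 0 (- w)) \<le> \<eta>" if \<eta>: "0 < \<eta>" for \<eta>
    proof -
      obtain v where v: "0 \<le> v" "dist v w < \<eta>" using w \<eta> unfolding closure_approachable by blast
      have "- w \<le> v - w" using v by simp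
      also have "\<dots> \<le> sup (v - w) (- (v - w))" by simp
      finally have "sup 0 (- w) \<le> sup (v - w) (- (v - w))"
        using sup_uminus_nonneg by (intro sup_least)
      then have "norm (sup 0 (- w)) \<le> norm (v - w)"
        by (intro norm_lattice_mono) (simp add: sup_uminus_of_nonneg)
      then show ?thesis using v by (simp add: dist_norm)
    qed
    then have "norm (sup 0 (- w)) \<le> 0" by (rule field_le_epsilon[of _ 0, simplified])
    then have "sup 0 (- w) = 0" by simp
    then have "- w \<le> 0" by (metis sup.cobounded2)
    then show ?thesis by simp
  qed
  then show ?thesis using closure_subset_eq by blast
qed

lemma ex_positive_unit:
  assumes "(UNIV :: 'e::banach_lattice set) \<noteq> {0}"
  obtains e :: "'e::banach_lattice" where "0 \<le> e" "norm e = 1"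
proof -
  obtain v :: 'e where v: "v \<noteq> 0" using assms by auto
  let ?w = "sup v (- v)"
  have "norm v \<le> norm ?w" using sup_uminus_nonneg by (intro norm_le_if_abs_le) auto
  then have w: "norm ?w > 0" using v by (metis norm_le_zero_iff not_le order_trans)
  have "0 \<le> (1 / norm ?w) *\<^sub>R ?w" using w sup_uminus_nonneg by (intro scaleR_nonneg_nonneg) auto
  moreover have "norm ((1 / norm ?w) *\<^sub>R ?w) = 1" using w by simp
  ultimately show ?thesis using that by blast
qed

text \<open>For positive vectors the modulus of the difference is at most the sum, so the maximum in
  the definition is the norm of the sum.\<close>

lemma lambda_plus_le_norm_add:
  fixes e1 e2 :: "'e::banach_lattice"
  assumes e: "norm e1 = 1" "norm e2 = 1" "0 \<le> e1" "0 \<le> e2"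
  shows "lambda_plus TYPE('e) \<le> norm (e1 + e2)"
proof -
  have "norm (e1 - e2) \<le> norm (e1 + e2)"
  proof (rule norm_le_if_abs_le)
    have "- e1 \<le> e1" "- e2 \<le> e2" using e by (metis neg_le_0_iff_le order_trans)+
    then show "e1 - e2 \<le> e1 + e2" "- (e1 - e2) \<le> e1 + e2" by auto
    show "0 \<le> e1 + e2" using e by simp
  qed
  then have "max (norm (e1 + e2)) (norm (e1 - e2)) = norm (e1 + e2)" by simp
  moreover have "lambda_plus TYPE('e) \<le> max (norm (e1 + e2)) (norm (e1 - e2))"
    unfolding lambda_plus_def
  proof (rule cInf_lower)
    show "bdd_below {max (norm (e1 + e2)) (norm (e1 - e2)) | e1 e2 :: 'e.
      e1 \<in> sphere 0 1 \<and> e2 \<in> sphere 0 1 \<and> 0 \<le> e1 \<and> 0 \<le> e2}"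
      by (rule bdd_belowI[of _ 0]) (auto simp: le_max_iff_disj)
  qed (use e in auto)
  ultimately show ?thesis by simp
qed

text \<open>A positive vector of norm at least \<open>r\<close> dominates \<open>r\<close> times its
  normalization; monotonicity of the norm then reduces the claim to unit vectors.\<close>

lemma lambda_plus_scaled:
  fixes v1 v2 :: "'e::banach_lattice"
  assumes r: "0 < r" and v: "0 \<le> v1" "0 \<le> v2" "r \<le> norm v1" "r \<le> norm v2"
  shows "lambda_plus TYPE('e) * r \<le> norm (v1 + v2)"
proof -
  have u: "norm ((1 / norm v) *\<^sub>R v) = 1" "0 \<le> (1 / norm v) *\<^sub>R v" "0 \<le> r *\<^sub>R ((1 / norm v) *\<^sub>R v)"
    "r *\<^sub>R ((1 / norm v) *\<^sub>R v) \<le> v" if "0 \<le> v" "r \<le> norm v" for v :: 'e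
  proof -
    have v: "norm v > 0" using that(2) r by linarith
    show "norm ((1 / norm v) *\<^sub>R v) = 1" using v by simp
    show *: "0 \<le> (1 / norm v) *\<^sub>R v" using v that by (intro scaleR_nonneg_nonneg) auto
    show "0 \<le> r *\<^sub>R ((1 / norm v) *\<^sub>R v)" by (rule scaleR_nonneg_nonneg[OF less_imp_le[OF r] *])
    have "(r / norm v) *\<^sub>R v \<le> 1 *\<^sub>R v" using that v by (intro scaleR_right_mono) auto
    then show "r *\<^sub>R ((1 / norm v) *\<^sub>R v) \<le> v" by simp
  qed
  let ?e1 = "(1 / norm v1) *\<^sub>R v1" and ?e2 = "(1 / norm v2) *\<^sub>R v2"
  have "lambda_plus TYPE('e) * r \<le> norm (?e1 + ?e2) * r"
    using r by (intro mult_right_mono lambda_plus_le_norm_add u v) auto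
  also have "\<dots> = norm (r *\<^sub>R (?e1 + ?e2))" using r by simp
  also have "\<dots> = norm (r *\<^sub>R ?e1 + r *\<^sub>R ?e2)" by (simp only: scaleR_add_right)
  also have "\<dots> \<le> norm (v1 + v2)"
  proof (rule norm_le_if_abs_le)
    show v12: "0 \<le> v1 + v2" using v by simp
    show "r *\<^sub>R ?e1 + r *\<^sub>R ?e2 \<le> v1 + v2" by (intro add_mono u v)
    have "- (r *\<^sub>R ?e1 + r *\<^sub>R ?e2) \<le> 0"
      unfolding neg_le_0_iff_le by (intro add_nonneg_nonneg u v)
    then show "- (r *\<^sub>R ?e1 + r *\<^sub>R ?e2) \<le> v1 + v2" using v12 by (rule order_trans)
  qed
  finally show ?thesis .
qed

lemma lambda_plus_le_2:
  assumes "(UNIV :: 'e::banach_lattice set) \<noteq> {0}"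
  shows "lambda_plus TYPE('e) \<le> 2"
proof -
  obtain e :: 'e where e: "0 \<le> e" "norm e = 1" using ex_positive_unit[OF assms] .
  have "lambda_plus TYPE('e) \<le> norm (e + e)" by (rule lambda_plus_le_norm_add) (use e in auto)
  also have "\<dots> \<le> 2" using norm_triangle_ineq[of e e] e by simp
  finally show ?thesis .
qed

section \<open>Directed families of convex sets in reflexive spaces\<close>

text \<open>Weak compactness of balls in a reflexive space: directedness gives the finite
  intersection property for the images in the bidual, a common limit there is represented by some
  \<open>w\<close>, and convexity turns weak closures into norm closures.\<close>

lemma reflexive_directed_convex_Inter:
  fixes \<C> :: "'e::real_normed_vector set set"
  assumes refl: "reflexive_space TYPE('e)" and "\<C> \<noteq> {}"
    and C: "\<And>C. C \<in> \<C> \<Longrightarrow> convex C" "\<And>C. C \<in> \<C> \<Longrightarrow> C \<noteq> {}"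
    and bnd: "\<And>C v. C \<in> \<C> \<Longrightarrow> v \<in> C \<Longrightarrow> norm v \<le> R"
    and dir: "\<And>A B. A \<in> \<C> \<Longrightarrow> B \<in> \<C> \<Longrightarrow> \<exists>C\<in>\<C>. C \<subseteq> A \<inter> B"
  obtains w where "\<And>C. C \<in> \<C> \<Longrightarrow> w \<in> closure C"
proof -
  define k where "k v = (\<lambda>f :: 'e \<Rightarrow>\<^sub>L real. f v)" for v
  let ?B = "PiE UNIV (\<lambda>f :: 'e \<Rightarrow>\<^sub>L real. {- (norm f * R)..norm f * R})"
  have B: "compact ?B" by (rule compact_box)
  have kB: "k v \<in> ?B" if "norm v \<le> R" for v
  proof -
    have "\<bar>f v\<bar> \<le> norm f * R" for f :: "'e \<Rightarrow>\<^sub>L real"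
    proof -
      have "\<bar>f v\<bar> \<le> norm f * norm v" using norm_blinfun[of f v] by simp
      also have "\<dots> \<le> norm f * R" using that by (intro mult_left_mono) auto
      finally show ?thesis .
    qed
    then have "- (norm f * R) \<le> f v \<and> f v \<le> norm f * R" for f :: "'e \<Rightarrow>\<^sub>L real"
      by (simp only: abs_le_iff minus_le_iff)
    then show ?thesis by (simp add: k_def PiE_UNIV_domain)
  qed
  have fin: "\<exists>C\<in>\<C>. C \<subseteq> \<Inter>\<B>" if "finite \<B>" "\<B> \<subseteq> \<C>" for \<B>
    using that
  proof (induction \<B>)
    case empty
    then show ?case using \<open>\<C> \<noteq> {}\<close> by auto
  next
    case (insert A \<B>)
    then obtain C where C': "C \<in> \<C>" "C \<subseteq> \<Inter>\<B>" by auto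
    obtain Z where "Z \<in> \<C>" "Z \<subseteq> A \<inter> C" using dir[of A C] C' insert.prems by auto
    then show ?case using C'(2) by (intro bexI[of _ Z]) auto
  qed
  have "?B \<inter> (\<Inter>C\<in>\<C>. closure (k ` C)) \<noteq> {}"
  proof (rule compact_imp_fip_image[OF B])
    fix \<B> assume \<B>: "finite \<B>" "\<B> \<subseteq> \<C>"
    obtain C where C': "C \<in> \<C>" "C \<subseteq> \<Inter>\<B>" using fin[OF \<B>] by blast
    then obtain v where v: "v \<in> C" using C(2) by blast
    have "k v \<in> closure (k ` A)" if "A \<in> \<B>" for A
    proof (rule subsetD[OF closure_subset imageI])
      show "v \<in> A" using v C' that by auto
    qed
    moreover have "k v \<in> ?B" using kB bnd C' v by blast
    ultimately show "?B \<inter> (\<Inter>A\<in>\<B>. closure (k ` A)) \<noteq> {}" by blast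
  qed simp
  then obtain \<phi> where \<phi>B: "\<phi> \<in> ?B" and \<phi>: "\<And>C. C \<in> \<C> \<Longrightarrow> \<phi> \<in> closure (k ` C)" by blast
  obtain C0 where C0: "C0 \<in> \<C>" using \<open>\<C> \<noteq> {}\<close> by blast
  have lin: "\<phi> \<in> {\<phi>. \<phi> (f + g) = \<phi> f + \<phi> g}" for f g
    by (rule subsetD[OF closure_minimal \<phi>[OF C0]])
      (auto simp: k_def blinfun.add_left intro!: closed_Collect_eq continuous_intros)
  have scale: "\<phi> \<in> {\<phi>. \<phi> (c *\<^sub>R f) = c * \<phi> f}" for f c
    by (rule subsetD[OF closure_minimal \<phi>[OF C0]])
      (auto simp: k_def blinfun.scaleR_left intro!: closed_Collect_eq continuous_intros)
  have "\<bar>\<phi> f\<bar> \<le> norm f * R" for f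
    using \<phi>B by (auto simp: PiE_UNIV_domain Pi_def abs_le_iff minus_le_iff)
  then have bl: "bounded_linear \<phi>"
    using lin scale by (intro bounded_linear_intro[of _ R]) auto
  obtain w where w: "\<And>f. (Blinfun \<phi>) f = f w"
    using refl unfolding reflexive_space_def by blast
  have \<phi>w: "\<phi> f = f w" for f using w[of f] by (simp add: bounded_linear_Blinfun_apply[OF bl])
  have "w \<in> closure C" if CC: "C \<in> \<C>" for C
  proof (rule ccontr)
    assume "w \<notin> closure C"
    \<comment> \<open>Mazur's argument: a point at positive distance from a convex set is strictly
      separated from it by a functional, and this separation survives weak limits.\<close>
    then obtain d where d: "0 < d" "\<And>c. c \<in> C \<Longrightarrow> d \<le> dist c w"
      unfolding closure_approachable by (meson not_le)
    let ?C = "(\<lambda>c. c - w) ` C"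
    have "convex ?C" "?C \<noteq> {}" using C[OF CC] by (auto simp: convex_translation_subtract_eq)
    moreover have "d \<le> norm c" if "c \<in> ?C" for c using d(2) that by (auto simp: dist_norm)
    ultimately obtain f :: "'e \<Rightarrow>\<^sub>L real" where f: "\<And>c. c \<in> ?C \<Longrightarrow> d \<le> f c"
      using separate_convex_from_zero[of ?C d] by blast
    have "d + f w \<le> f c" if "c \<in> C" for c
      using f[of "c - w"] that by (simp add: blinfun.diff_right)
    then have "\<phi> \<in> {\<phi>. d + f w \<le> \<phi> f}"
      by (intro subsetD[OF closure_minimal \<phi>[OF CC]])
        (auto simp: k_def intro!: closed_Collect_le continuous_intros)
    then show False using d(1) \<phi>w by simp
  qed
  then show ?thesis using that by blast
qed

section \<open>The correspondence between the Choquet boundaries\<close>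

locale positive_embedding = lower_bounded_map H1 H2 J c + H2: peak_space H2
  for H1 :: "('k1::t2_space \<Rightarrow>\<^sub>C 'e1::banach_lattice) set"
    and H2 :: "('k2::t2_space \<Rightarrow>\<^sub>C 'e2::banach_lattice) set" and J c +
  assumes J_pos: "f \<in> positive_part H1 \<Longrightarrow> J f \<in> positive_part H2"
begin

text \<open>\<open>m\<close> is the bidual norm of the image of the peak limit. The same number is
  approached from above by norms of images over every neighbourhood and from below by all small
  peaks at one boundary point; the reflection argument relies on this match.\<close>

lemma peak_image:
  assumes x: "x \<in> choquet_boundary H1" and e: "norm e = 1" "0 \<le> e"
  obtains m where "1 \<le> m"
    "\<And>U \<delta> \<eta>. open U \<Longrightarrow> x \<in> U \<Longrightarrow> 0 < \<delta> \<Longrightarrow> \<delta> < 1 \<Longrightarrow> 0 < \<eta> \<Longrightarrow>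
      \<exists>h\<in>peaks H1 e x U \<delta>. norm (J (tensor h e)) \<le> m + \<eta>"
    "\<And>\<eta>. 0 < \<eta> \<Longrightarrow> \<exists>y\<in>choquet_boundary H2. \<exists>e'. norm e' \<le> 1 \<and>
      eventually (\<lambda>h. m - \<eta> < blinfun_apply e' (J (tensor h e) y)) (peak_filter H1 e x)"
proof -
  interpret E: peak_embedding H1 H2 J c x e
    by unfold_locales (use x e in auto)
  show ?thesis
  proof (rule that[OF E.S_zero_ge_1])
    fix U and \<delta> \<eta> :: real assume "open U" "x \<in> U" "0 < \<delta>" "\<delta> < 1" "0 < \<eta>"
    from E.peak_of_almost_minimal_norm[OF this]
    show "\<exists>h\<in>peaks H1 e x U \<delta>. norm (J (tensor h e)) \<le> E.S 0 + \<eta>" by blast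
  next
    fix \<eta> :: real assume "0 < \<eta>"
    from E.peak_image_position[OF this]
    show "\<exists>y\<in>choquet_boundary H2. \<exists>e'. norm e' \<le> 1 \<and>
      eventually (\<lambda>h. E.S 0 - \<eta> < blinfun_apply e' (J (tensor h e) y)) (peak_filter H1 e x)"
      by blast
  qed
qed

text \<open>The direction \<open>e\<close> may vary with the pair, so two points related to the same
  \<open>y\<close> are compared through peaks in different directions.\<close>

definition related :: "real \<Rightarrow> 'k1 \<Rightarrow> 'k2 \<Rightarrow> bool" where
  "related r x y \<longleftrightarrow> (\<exists>e. norm e = 1 \<and> 0 \<le> e \<and>
     eventually (\<lambda>h. r < norm (J (tensor h e) y)) (peak_filter H1 e x))"

lemma J_tensor_nonneg:
  assumes "h \<in> peaks H1 e x U \<delta>" "0 \<le> e"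
  shows "0 \<le> J (tensor h e) y"
proof -
  have "tensor h e \<in> positive_part H1"
    using peaks_in[OF assms(1)] peaks_nonneg[OF assms(1)] assms(2)
    by (simp add: positive_part_def tensor_space_def scaleR_nonneg_nonneg)
  then show ?thesis using J_pos by (auto simp: positive_part_def)
qed

text \<open>Two peaks with essentially disjoint supports cannot both have large images at \<open>y\<close>: the
  images are positive, so the norm of their sum would exceed \<open>c\<close>.\<close>

lemma related_localize:
  assumes r: "0 < r" and \<delta>: "0 < \<delta>" "c * (1 + \<delta>) < lambda_plus TYPE('e2) * r"
    and rel: "related r x' y" and x': "x' \<in> choquet_boundary H1"
    and e: "norm e = 1" "0 \<le> e" and h: "h \<in> peaks H1 e x W \<delta>"
    and big: "r < norm (J (tensor h e) y)"
  shows "x' \<in> W"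
proof (rule ccontr)
  assume "x' \<notin> W"
  \<comment> \<open>A peak supported near \<open>U\<close> is complementary to \<open>h\<close>: at
    every boundary point one of the two functions is below \<open>\<delta>\<close>, so the sum has
    norm at most \<open>1 + \<delta>\<close>.\<close>
  define U where "U = {z. h z < \<delta>}"
  have U: "open U" unfolding U_def by (intro open_Collect_less continuous_intros)
  have x'U: "x' \<in> U" using peaks_off[OF h x' \<open>x' \<notin> W\<close>] by (simp add: U_def)
  obtain e' where e': "norm e' = 1" "0 \<le> e'"
    and ev: "eventually (\<lambda>h. r < norm (J (tensor h e') y)) (peak_filter H1 e' x')"
    using rel unfolding related_def by blast
  let ?\<delta> = "min \<delta> (1/2)"
  have "eventually (\<lambda>h. h \<in> peaks H1 e' x' U ?\<delta>) (peak_filter H1 e' x')"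
    using U x'U \<delta> by (intro eventually_peaks) auto
  then obtain h' where h': "h' \<in> peaks H1 e' x' U ?\<delta>" "r < norm (J (tensor h' e') y)"
    using eventually_happens'[OF peak_filter_ne_bot[OF x' e'(2)] eventually_conj[OF _ ev]] by blast
  have in1: "tensor h e \<in> H1" "tensor h' e' \<in> H1"
    using peaks_in[OF h] peaks_in[OF h'(1)] by (auto simp: tensor_space_def)
  let ?f = "tensor h e + tensor h' e'"
  have f: "?f \<in> H1" by (rule subspace_add[OF subspace in1])
  have "norm ?f \<le> 1 + \<delta>"
  proof (rule norm_le_on_boundary[OF subspace C0 f])
    fix z assume z: "z \<in> choquet_boundary H1"
    have "norm (?f z) \<le> norm (h z *\<^sub>R e) + norm (h' z *\<^sub>R e')"
      using norm_triangle_ineq[of "h z *\<^sub>R e" "h' z *\<^sub>R e'"]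
      by (simp only: plus_bcontfun.rep_eq tensor_apply)
    also have "\<dots> = h z + h' z"
      using e e' peaks_nonneg[OF h] peaks_nonneg[OF h'(1)] by simp
    also have "\<dots> \<le> 1 + \<delta>"
    proof (cases "z \<in> U")
      case True
      then show ?thesis using peaks_le_1[OF h'(1), of z] by (simp add: U_def)
    next
      case False
      then show ?thesis using peaks_off[OF h'(1) z False] peaks_le_1[OF h, of z] by simp
    qed
    finally show "norm (?f z) \<le> 1 + \<delta>" .
  qed (use \<delta> in simp)
  then have "c * norm ?f \<le> c * (1 + \<delta>)" using c by (intro mult_left_mono) auto
  then have "norm (J ?f) < lambda_plus TYPE('e2) * r" using J_upper[OF f] \<delta> by linarith
  moreover have "lambda_plus TYPE('e2) * r \<le>
      norm (J (tensor h e) y + J (tensor h' e') y)"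
    using J_tensor_nonneg[OF h e(2)] J_tensor_nonneg[OF h'(1) e'(2)] big h'(2)
    by (intro lambda_plus_scaled[OF r]) auto
  moreover have "\<dots> = norm (J ?f y)"
    by (simp add: J_add[OF in1])
  ultimately show False using norm_bounded[of "J ?f" y] by simp
qed

lemma related_peak:
  assumes rel: "related r x y" and x: "x \<in> choquet_boundary H1" and W: "open W" "x \<in> W" and \<delta>: "0 < \<delta>"
  obtains e h where "norm e = 1" "0 \<le> e" "h \<in> peaks H1 e x W \<delta>"
    "r < norm (J (tensor h e) y)"
proof -
  obtain e where e: "norm e = 1" "0 \<le> e"
    and ev: "eventually (\<lambda>h. r < norm (J (tensor h e) y)) (peak_filter H1 e x)"
    using rel unfolding related_def by blast
  have "eventually (\<lambda>h. h \<in> peaks H1 e x W (min \<delta> (1/2))) (peak_filter H1 e x)"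
    using W \<delta> by (intro eventually_peaks) auto
  then obtain h where h: "h \<in> peaks H1 e x W (min \<delta> (1/2))" "r < norm (J (tensor h e) y)"
    using eventually_happens'[OF peak_filter_ne_bot[OF x e(2)] eventually_conj[OF _ ev]] by blast
  have "peaks H1 e x W (min \<delta> (1/2)) \<subseteq> peaks H1 e x W \<delta>" by (rule peaks_mono) auto
  then show ?thesis using that[OF e _ h(2)] h(1) by blast
qed

lemma ex_small_defect:
  assumes "c < l * r"
  obtains \<delta> where "0 < \<delta>" "c * (1 + \<delta>) < l * r"
proof (rule that)
  show "0 < (l * r - c) / (2 * c)" using assms c by simp
  show "c * (1 + (l * r - c) / (2 * c)) < l * r" using assms c by (simp add: field_simps)
qed

lemma related_unique:
  assumes r: "0 < r" "c < lambda_plus TYPE('e2) * r"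
    and x: "x \<in> choquet_boundary H1" "related r x y" and x': "x' \<in> choquet_boundary H1" "related r x' y"
  shows "x = x'"
proof (rule ccontr)
  assume "x \<noteq> x'"
  then obtain W where W: "open W" "x \<in> W" "x' \<notin> W" using t1_space by blast
  obtain \<delta> where \<delta>: "0 < \<delta>" "c * (1 + \<delta>) < lambda_plus TYPE('e2) * r" using ex_small_defect[OF r(2)] .
  obtain e h where "norm e = 1" "0 \<le> e" "h \<in> peaks H1 e x W \<delta>"
    "r < norm (J (tensor h e) y)"
    using related_peak[OF x(2,1) W(1,2) \<delta>(1)] .
  from related_localize[OF r(1) \<delta> x'(2,1) this] show False using W by simp
qed

text \<open>One peak at \<open>p y\<close> inside \<open>B\<close> has an image of norm above
  \<open>r\<close> on a whole neighbourhood of \<open>y\<close>, and for each boundary point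
  \<open>z\<close> there localization forces \<open>p z\<close> into \<open>B\<close>.\<close>

lemma related_continuous:
  assumes r: "0 < r" "c < lambda_plus TYPE('e2) * r"
    and p: "\<And>y. y \<in> choquet_boundary H2 \<Longrightarrow> p y \<in> choquet_boundary H1 \<and> related r (p y) y"
  shows "continuous_on (choquet_boundary H2) p"
  unfolding continuous_on_topological
proof (intro ballI allI impI)
  fix y B assume y: "y \<in> choquet_boundary H2" and B: "open B" "p y \<in> B"
  obtain \<delta> where \<delta>: "0 < \<delta>" "c * (1 + \<delta>) < lambda_plus TYPE('e2) * r" using ex_small_defect[OF r(2)] .
  obtain e h where eh: "norm e = 1" "0 \<le> e" "h \<in> peaks H1 e (p y) B \<delta>"
    and big: "r < norm (J (tensor h e) y)"
    using related_peak[OF _ _ B \<delta>(1)] p[OF y] by metis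
  let ?A = "{z. r < norm (J (tensor h e) z)}"
  have "open ?A" by (intro open_Collect_less continuous_intros)
  moreover have "p z \<in> B" if "z \<in> choquet_boundary H2" "z \<in> ?A" for z
    using related_localize[OF r(1) \<delta> _ _ eh, of "p z" z] p[OF that(1)] that(2) by simp
  ultimately show "\<exists>A. open A \<and> y \<in> A \<and> (\<forall>z\<in>choquet_boundary H2. z \<in> A \<longrightarrow> p z \<in> B)"
    using big by (intro exI[of _ ?A]) auto
qed

end

text \<open>If \<open>x\<close> is a position where the image of the peaks at \<open>y\<close> is almost maximal, with limit value
  \<open>w\<close>, then reflecting that image at \<open>x\<close> (subtracting \<open>2 w\<close> times a peak at \<open>x\<close>) does not increase
  its norm. If the peaks at \<open>x\<close> in direction \<open>w\<close> were mapped back to a position \<open>y' \<noteq> y\<close>, the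
  reflected function would be mapped to a value of norm about \<open>2 * norm w\<close> at \<open>y'\<close>, and \<open>c < 2\<close>
  excludes that.\<close>

lemma ex_mutually_related:
  fixes H1 :: "('k1::t2_space \<Rightarrow>\<^sub>C 'e1::banach_lattice) set"
    and H2 :: "('k2::t2_space \<Rightarrow>\<^sub>C 'e2::banach_lattice) set"
  assumes A: "positive_embedding H1 H2 J1 c" and B: "positive_embedding H2 H1 J2 c"
    and inv: "\<And>g. g \<in> H2 \<Longrightarrow> J1 (J2 g) = c *\<^sub>R g"
    and refl: "reflexive_space TYPE('e1)" and nz: "(UNIV :: 'e2 set) \<noteq> {0}"
    and c2: "c < 2" and r: "r < 1" and y: "y \<in> choquet_boundary H2"
  obtains x where "x \<in> choquet_boundary H1" "positive_embedding.related H2 J2 r y x"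
    "positive_embedding.related H1 J1 r x y"
proof -
  interpret A: positive_embedding H1 H2 J1 c by (rule A)
  interpret B: positive_embedding H2 H1 J2 c by (rule B)
  \<comment> \<open>\<open>\<eta> \<le> 1 - r\<close> lifts values above \<open>1 - \<eta>\<close>
    over \<open>r\<close>. The last bound defeats the final estimate, which amounts to
    \<open>2 - c \<le> 14 * \<eta>\<close>.\<close>
  define \<eta> where "\<eta> = min (min (1 - r) (1/2)) ((2 - c) / 32)"
  have "\<eta> \<le> (2 - c) / 32" unfolding \<eta>_def by (rule min.cobounded2)
  moreover have "\<eta> \<le> min (1 - r) (1/2)" unfolding \<eta>_def by (rule min.cobounded1)
  ultimately have \<eta>: "0 < \<eta>" "\<eta> \<le> 1 - r" "\<eta> \<le> 1/2" "32 * \<eta> \<le> 2 - c"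
    using r c2 by (auto simp: \<eta>_def)
  obtain u :: 'e2 where u: "0 \<le> u" "norm u = 1" using ex_positive_unit[OF nz] .
  let ?F = "peak_filter H2 u y"
  obtain m where m: "1 \<le> m"
    and small: "\<And>U \<delta> \<eta>. open U \<Longrightarrow> y \<in> U \<Longrightarrow> 0 < \<delta> \<Longrightarrow> \<delta> < 1 \<Longrightarrow> 0 < \<eta> \<Longrightarrow>
      \<exists>h\<in>peaks H2 u y U \<delta>. norm (J2 (tensor h u)) \<le> m + \<eta>"
    and pos: "\<And>\<eta>. 0 < \<eta> \<Longrightarrow> \<exists>x\<in>choquet_boundary H1. \<exists>e'. norm e' \<le> 1 \<and>
      eventually (\<lambda>h. m - \<eta> < blinfun_apply e' (J2 (tensor h u) x)) ?F"
    by (rule B.peak_image[OF y u(2,1)]) blast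
  obtain x \<psi> where x: "x \<in> choquet_boundary H1" and \<psi>: "norm \<psi> \<le> 1"
    and ev: "eventually (\<lambda>h. m - \<eta> < blinfun_apply \<psi> (J2 (tensor h u) x)) ?F"
    using pos[OF \<eta>(1)] by blast
  have rel2: "B.related r y x"
    unfolding B.related_def
  proof (intro exI[of _ u] conjI u, rule eventually_mono[OF ev])
    fix h assume "m - \<eta> < \<psi> (J2 (tensor h u) x)"
    then show "r < norm (J2 (tensor h u) x)"
      using abs_blinfun_le[OF \<psi>, of "J2 (tensor h u) x"] m \<eta> by simp
  qed
  define C where "C V \<delta> = (\<lambda>k. J2 (tensor k u) x) `
      {k\<in>peaks H2 u y V \<delta>. norm (J2 (tensor k u)) \<le> m + \<eta>}" for V \<delta>
  define \<C> where "\<C> = {C V \<delta> | V \<delta>. open V \<and> y \<in> V \<and> 0 < \<delta> \<and> \<delta> < 1}"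
  have in2: "tensor k u \<in> H2" if "k \<in> peaks H2 u y V \<delta>" for k V \<delta>
    using peaks_in[OF that] by (simp add: tensor_space_def)
  have J2_comb: "J2 (tensor (s *\<^sub>R a + t *\<^sub>R b) u) = s *\<^sub>R J2 (tensor a u) + t *\<^sub>R J2 (tensor b u)"
    if "tensor a u \<in> H2" "tensor b u \<in> H2" for a b s t
    using that by (simp add: tensor_add tensor_scaleR B.J_add B.J_scale subspace_scale[OF A.H2.subspace])
  obtain w where w: "\<And>X. X \<in> \<C> \<Longrightarrow> w \<in> closure X"
  proof (rule reflexive_directed_convex_Inter[OF refl, of \<C> "m + \<eta>"])
    have "C UNIV (1/2) \<in> \<C>" unfolding \<C>_def by (intro CollectI exI[of _ UNIV] exI[of _ "1/2"]) auto
    then show "\<C> \<noteq> {}" by blast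
    fix X assume "X \<in> \<C>"
    then obtain V \<delta> where V: "open V" "y \<in> V" "0 < \<delta>" "\<delta> < 1" and X: "X = C V \<delta>"
      unfolding \<C>_def by blast
    show "X \<noteq> {}" using small[OF V \<eta>(1)] by (auto simp: X C_def)
    show "norm v \<le> m + \<eta>" if "v \<in> X" for v
      using that norm_bounded by (force simp: X C_def intro: order_trans)
    show "convex X"
      unfolding convex_def
    proof (intro ballI allI impI)
      fix v1 v2 and s t :: real assume v: "v1 \<in> X" "v2 \<in> X" and st: "0 \<le> s" "0 \<le> t" "s + t = 1"
      obtain a b where ab: "a \<in> peaks H2 u y V \<delta>" "norm (J2 (tensor a u)) \<le> m + \<eta>"
          "v1 = J2 (tensor a u) x"
          "b \<in> peaks H2 u y V \<delta>" "norm (J2 (tensor b u)) \<le> m + \<eta>"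
          "v2 = J2 (tensor b u) x"
        using v by (auto simp: X C_def)
      have eq: "J2 (tensor (s *\<^sub>R a + t *\<^sub>R b) u) = s *\<^sub>R J2 (tensor a u) + t *\<^sub>R J2 (tensor b u)"
        by (rule J2_comb[OF in2[OF ab(1)] in2[OF ab(4)]])
      have "s *\<^sub>R a + t *\<^sub>R b \<in> peaks H2 u y V \<delta>"
        using ab st by (intro convexD[OF A.H2.convex_peaks])
      moreover have "norm (J2 (tensor (s *\<^sub>R a + t *\<^sub>R b) u)) \<le> m + \<eta>"
      proof -
        have "norm (J2 (tensor (s *\<^sub>R a + t *\<^sub>R b) u)) \<le>
            s * norm (J2 (tensor a u)) + t * norm (J2 (tensor b u))"
          unfolding eq using st norm_triangle_ineq[of "s *\<^sub>R J2 (tensor a u)" "t *\<^sub>R J2 (tensor b u)"]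
          by simp
        also have "\<dots> \<le> m + \<eta>" by (rule convex_bound_le[OF ab(2) ab(5) st])
        finally show ?thesis .
      qed
      moreover have "s *\<^sub>R v1 + t *\<^sub>R v2 = (J2 (tensor (s *\<^sub>R a + t *\<^sub>R b) u)) x"
        unfolding eq by (simp add: ab)
      ultimately show "s *\<^sub>R v1 + t *\<^sub>R v2 \<in> X" unfolding X C_def by blast
    qed
    fix Y assume "Y \<in> \<C>"
    then obtain V' \<delta>' where V': "open V'" "y \<in> V'" "0 < \<delta>'" "\<delta>' < 1" and Y: "Y = C V' \<delta>'"
      unfolding \<C>_def by blast
    have "C (V \<inter> V') (min \<delta> \<delta>') \<in> \<C>"
      unfolding \<C>_def using V V' by (intro CollectI exI[of _ "V \<inter> V'"] exI[of _ "min \<delta> \<delta>'"]) auto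
    moreover have "peaks H2 u y (V \<inter> V') (min \<delta> \<delta>') \<subseteq> peaks H2 u y V \<delta>"
      "peaks H2 u y (V \<inter> V') (min \<delta> \<delta>') \<subseteq> peaks H2 u y V' \<delta>'" by (intro peaks_mono; simp)+
    then have "C (V \<inter> V') (min \<delta> \<delta>') \<subseteq> X \<inter> Y"
      unfolding X Y C_def by (intro Int_greatest image_mono) auto
    ultimately show "\<exists>Z\<in>\<C>. Z \<subseteq> X \<inter> Y" by blast
  qed blast
  have wC: "w \<in> closure (C V \<delta>)" if "open V" "y \<in> V" "0 < \<delta>" "\<delta> < 1" for V \<delta>
    using w that unfolding \<C>_def by blast
  have "C UNIV (1/2) \<subseteq> {v. 0 \<le> v}" using B.J_tensor_nonneg u(1) by (auto simp: C_def)
  from subsetD[OF closure_minimal[OF this closed_positive_cone] wC] have w0: "0 \<le> w" by simp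
  have "C UNIV (1/2) \<subseteq> cball 0 (m + \<eta>)"
    using norm_bounded by (force simp: C_def intro: order_trans)
  from subsetD[OF closure_minimal[OF this closed_cball] wC] have w1: "norm w \<le> m + \<eta>" by simp
  have w2: "m - \<eta> \<le> norm w"
  proof -
    obtain V \<delta> where V: "open V" "y \<in> V" "0 < \<delta>" "\<delta> < 1"
      and Vk: "\<And>k. k \<in> peaks H2 u y V \<delta> \<Longrightarrow> m - \<eta> < \<psi> (J2 (tensor k u) x)"
      using ev unfolding eventually_peak_filter by blast
    have "closure (C V \<delta>) \<subseteq> {v. m - \<eta> \<le> \<psi> v}"
      using Vk by (intro closure_minimal closed_Collect_le continuous_intros) (auto simp: C_def less_imp_le)
    then have "m - \<eta> \<le> \<psi> w" using wC[OF V] by blast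
    then show ?thesis using abs_blinfun_le[OF \<psi>, of w] by simp
  qed
  have wpos: "0 < norm w" using w2 m \<eta>(3) by linarith
  define e where "e = (1 / norm w) *\<^sub>R w"
  have e: "norm e = 1" "0 \<le> e" "norm w *\<^sub>R e = w"
    using wpos w0 by (auto simp: e_def intro!: scaleR_nonneg_nonneg)
  obtain m1 y' \<theta> where m1: "1 \<le> m1" and y': "y' \<in> choquet_boundary H2" and \<theta>: "norm \<theta> \<le> 1"
    and ev1: "eventually (\<lambda>h. m1 - \<eta> < blinfun_apply \<theta> (J1 (tensor h e) y')) (peak_filter H1 e x)"
  proof (rule A.peak_image[OF x e(1,2)])
    fix m1 :: real assume m1: "1 \<le> m1" and "\<And>\<eta>. 0 < \<eta> \<Longrightarrow> \<exists>y\<in>choquet_boundary H2. \<exists>e'. norm e' \<le> 1 \<and>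
      eventually (\<lambda>h. m1 - \<eta> < blinfun_apply e' (J1 (tensor h e) y)) (peak_filter H1 e x)"
    from this(2)[OF \<eta>(1)] show thesis using that[OF m1] by blast
  qed
  have rel1: "A.related r x y'"
    unfolding A.related_def
  proof (intro exI[of _ e] conjI e(1,2), rule eventually_mono[OF ev1])
    fix h assume "m1 - \<eta> < \<theta> (J1 (tensor h e) y')"
    then show "r < norm (J1 (tensor h e) y')"
      using abs_blinfun_le[OF \<theta>, of "J1 (tensor h e) y'"] m1 \<eta> by simp
  qed
  have "y' = y"
  proof (rule ccontr)
    assume "y' \<noteq> y"
    then obtain V where V: "open V" "y \<in> V" "y' \<notin> V" using t1_space[of y y'] by blast
    have "\<eta> < 1" using \<eta> by simp
    then obtain k where k: "k \<in> peaks H2 u y V \<eta>" and kn: "norm (J2 (tensor k u)) \<le> m + \<eta>"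
      and kw: "dist (J2 (tensor k u) x) w < \<eta>"
      using wC[OF V(1,2) \<eta>(1)] \<eta>(1) unfolding closure_approachable C_def by blast
    define p where "p = J2 (tensor k u)"
    have p1: "p \<in> H1" unfolding p_def by (rule B.J_in[OF in2[OF k]])
    have pz: "norm (p z) \<le> m + \<eta>" for z
      using norm_bounded[of p z] kn by (simp add: p_def)
    define U where "U = {z. norm (p z - p x) < \<eta>}"
    have U: "open U" "x \<in> U" unfolding U_def using \<eta>
      by (auto intro!: open_Collect_less continuous_intros)
    define \<delta> where "\<delta> = min (1/2) (\<eta> / (2 * (m + \<eta>)))"
    have \<delta>: "0 < \<delta>" "\<delta> < 1" using \<eta> m by (auto simp: \<delta>_def)
    have "\<delta> * (2 * (m + \<eta>)) \<le> \<eta> / (2 * (m + \<eta>)) * (2 * (m + \<eta>))"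
      unfolding \<delta>_def using m \<eta> by (intro mult_right_mono) auto
    also have "\<dots> = \<eta>" using m \<eta> by simp
    finally have \<delta>m: "2 * ((m + \<eta>) * \<delta>) \<le> \<eta>" by (simp add: algebra_simps)
    obtain h where h: "h \<in> peaks H1 e x U \<delta>"
      and hb: "m1 - \<eta> < \<theta> (J1 (tensor h e) y')"
      using eventually_happens'[OF A.peak_filter_ne_bot[OF x e(2)]
          eventually_conj[OF eventually_peaks[OF U \<delta>] ev1]] by blast
    have he: "tensor h e \<in> H1" using peaks_in[OF h] by (simp add: tensor_space_def)
    \<comment> \<open>The summand has the values \<open>- 2 * h z\<close> times \<open>w\<close>. On
      \<open>U\<close>, where \<open>p\<close> is close to \<open>w\<close>, the sum is close to
      \<open>1 - 2 * h z\<close> times \<open>w\<close> with a factor in \<open>[-1, 1]\<close>; off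
      \<open>U\<close> the choice of \<open>\<delta>\<close> limits the change to
      \<open>\<eta>\<close>.\<close>
    define s where "s = - 2 * norm w"
    let ?f = "p + s *\<^sub>R tensor h e"
    have she: "s *\<^sub>R tensor h e \<in> H1" by (rule subspace_scale[OF A.subspace he])
    have f1: "?f \<in> H1" by (rule subspace_add[OF A.subspace p1 she])
    have "norm ?f \<le> m + 4 * \<eta>"
    proof (rule norm_le_on_boundary[OF A.subspace A.C0 f1])
      fix z assume z: "z \<in> choquet_boundary H1"
      let ?h = "h z" and ?p = "p z"
      have h01: "0 \<le> ?h" "?h \<le> 1" using peaks_nonneg[OF h] peaks_le_1[OF h] by auto
      have "s *\<^sub>R (?h *\<^sub>R e) = (- 2 * ?h) *\<^sub>R (norm w *\<^sub>R e)" by (simp add: s_def mult.commute)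
      then have fz: "?f z = ?p + (- 2 * ?h) *\<^sub>R w"
        by (simp add: e(3))
      show "norm (?f z) \<le> m + 4 * \<eta>"
      proof (cases "z \<in> U")
        case True
        have n1: "norm (?p - w) \<le> 2 * \<eta>"
        proof -
          have "norm (?p - w) \<le> norm (?p - p x) + norm (p x - w)"
            using norm_triangle_ineq[of "?p - p x" "p x - w"] by simp
          then show ?thesis using True kw by (simp add: U_def p_def dist_norm)
        qed
        have n2: "norm ((1 - 2 * ?h) *\<^sub>R w) \<le> norm w"
        proof -
          have "\<bar>1 - 2 * ?h\<bar> \<le> 1" using h01 by auto
          then show ?thesis by (simp add: mult_left_le_one_le)
        qed
        have dec: "?p + (- 2 * ?h) *\<^sub>R w = (?p - w) + (1 - 2 * ?h) *\<^sub>R w"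
          by (simp add: algebra_simps)
        have "norm (?p + (- 2 * ?h) *\<^sub>R w) \<le> 2 * \<eta> + norm w"
          unfolding dec by (rule norm_triangle_mono[OF n1 n2])
        then show ?thesis unfolding fz using w1 \<eta> by simp
      next
        case False
        have "?h * norm w \<le> \<delta> * (m + \<eta>)"
          using peaks_off[OF h z False] h01 w1 by (intro mult_mono) auto
        then have "norm ((- 2 * ?h) *\<^sub>R w) \<le> \<eta>"
          using \<delta>m h01 by (simp add: abs_mult mult.commute)
        then show ?thesis
          unfolding fz using norm_triangle_ineq[of ?p "(- 2 * ?h) *\<^sub>R w"] pz[of z] \<eta> by simp
      qed
    qed (use m \<eta> in simp)
    then have "c * norm ?f \<le> c * (m + 4 * \<eta>)" using A.c by (intro mult_left_mono) auto
    then have Jf: "norm (J1 ?f) \<le> c * (m + 4 * \<eta>)" using A.J_upper[OF f1] by linarith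
    have J1p: "J1 p = c *\<^sub>R tensor k u" unfolding p_def by (rule inv[OF in2[OF k]])
    \<comment> \<open>At \<open>y'\<close> the first term is small since \<open>k\<close> peaks at
      \<open>y\<close>, whereas \<open>\<theta>\<close> gives the second term a value of about
      \<open>- 2 * m\<close> or less. The reflected function has norm about \<open>m\<close>, so
      this would require \<open>2 * m\<close> to be at most about \<open>c * m\<close>.\<close>
    have "J1 ?f y' = (c * k y') *\<^sub>R u + s *\<^sub>R J1 (tensor h e) y'"
      by (simp add: A.J_add[OF p1 she] A.J_scale[OF he] J1p)
    then have eq: "\<theta> (J1 ?f y') =
        c * k y' * \<theta> u + s * \<theta> (J1 (tensor h e) y')"
      by (simp add: blinfun.add_right blinfun.scaleR_right)
    have "\<bar>\<theta> u\<bar> \<le> 1" using abs_blinfun_le[OF \<theta>, of u] u by simp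
    then have "c * k y' * \<theta> u \<le> c * k y' * 1"
      using A.c peaks_nonneg[OF k] by (intro mult_left_mono) auto
    also have "\<dots> \<le> c * \<eta>" using peaks_off[OF k y' V(3)] A.c by (simp add: mult_left_mono)
    finally have t1: "c * k y' * \<theta> u \<le> c * \<eta>" .
    have "(m - \<eta>) * (1 - \<eta>) \<le> norm w * \<theta> (J1 (tensor h e) y')"
      using w2 hb m1 m \<eta> by (intro mult_mono) auto
    then have t2: "s * \<theta> (J1 (tensor h e) y') \<le> - 2 * ((m - \<eta>) * (1 - \<eta>))"
      by (simp add: s_def)
    have "- norm (J1 ?f) \<le> \<theta> (J1 ?f y')"
      using abs_blinfun_le[OF \<theta>, of "J1 ?f y'"] norm_bounded[of "J1 ?f" y'] by linarith
    then have "2 * ((m - \<eta>) * (1 - \<eta>)) \<le> c * (m + 4 * \<eta>) + c * \<eta>"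
      using eq t1 t2 Jf by linarith
    then have "2 * ((m - \<eta>) * (1 - \<eta>)) \<le> c * (m + 5 * \<eta>)" by (simp add: algebra_simps)
    moreover have "m * (1 - 2 * \<eta>) \<le> (m - \<eta>) * (1 - \<eta>)"
    proof -
      have "(m - \<eta>) * (1 - \<eta>) - m * (1 - 2 * \<eta>) = (m - 1) * \<eta> + \<eta> * \<eta>"
        by (simp add: algebra_simps)
      then show ?thesis using m \<eta> by (smt (verit) mult_nonneg_nonneg)
    qed
    moreover have "c * (m + 5 * \<eta>) \<le> m * (c * (1 + 5 * \<eta>))"
    proof -
      have "m * (c * (1 + 5 * \<eta>)) - c * (m + 5 * \<eta>) = 5 * (c * (\<eta> * (m - 1)))"
        by (simp add: algebra_simps)
      then show ?thesis using m \<eta> A.c by (smt (verit) mult_nonneg_nonneg)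
    qed
    ultimately have "m * (2 * (1 - 2 * \<eta>)) \<le> m * (c * (1 + 5 * \<eta>))" by linarith
    then have "2 * (1 - 2 * \<eta>) \<le> c * (1 + 5 * \<eta>)" using m by simp
    then have "2 - 4 * \<eta> \<le> c + 5 * (c * \<eta>)" by (simp add: algebra_simps)
    moreover have "c * \<eta> \<le> 2 * \<eta>" using c2 \<eta> by (intro mult_right_mono) auto
    ultimately show False using \<eta>(1,4) by linarith
  qed
  then show ?thesis using that[OF x rel2] rel1 by simp
qed

text \<open>Positions exist for every level below 1; uniqueness and continuity hold above
  \<open>c / l\<close>, and \<open>r\<close> is the midpoint. Both selections are mutual, so
  \<open>x\<close> and \<open>p (q x)\<close> are related to the same \<open>q x\<close> and
  uniqueness identifies them; the other composition is symmetric.\<close>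

theorem homeomorphic_choquet_boundaries:
  fixes H1 :: "('k1::t2_space \<Rightarrow>\<^sub>C 'e1::banach_lattice) set"
    and H2 :: "('k2::t2_space \<Rightarrow>\<^sub>C 'e2::banach_lattice) set"
  assumes A: "positive_embedding H1 H2 J1 c" and B: "positive_embedding H2 H1 J2 c"
    and inv: "\<And>g. g \<in> H2 \<Longrightarrow> J1 (J2 g) = c *\<^sub>R g" "\<And>f. f \<in> H1 \<Longrightarrow> J2 (J1 f) = c *\<^sub>R f"
    and refl: "reflexive_space TYPE('e1)" "reflexive_space TYPE('e2)"
    and nz: "(UNIV :: 'e1 set) \<noteq> {0}" "(UNIV :: 'e2 set) \<noteq> {0}"
    and c: "c < lambda_plus TYPE('e1)" "c < lambda_plus TYPE('e2)"
  shows "choquet_boundary H1 homeomorphic choquet_boundary H2"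
proof -
  interpret A: positive_embedding H1 H2 J1 c by (rule A)
  interpret B: positive_embedding H2 H1 J2 c by (rule B)
  define l where "l = min (lambda_plus TYPE('e1)) (lambda_plus TYPE('e2))"
  have l: "c < l" "0 < l" using c A.c by (auto simp: l_def)
  define q where "q = c / l"
  define r where "r = (1 + q) / 2"
  have cl: "0 < q" "q < 1" using l A.c by (auto simp: q_def)
  then have r: "0 < r" "r < 1" by (auto simp: r_def)
  have "c = l * q" using l by (simp add: q_def)
  also have "q < r" using cl(2) by (simp add: r_def)
  then have "l * q < l * r" using l(2) by (rule mult_strict_left_mono)
  finally have clr: "c < l * r" .
  have "l * r \<le> lambda_plus TYPE('e1) * r" "l * r \<le> lambda_plus TYPE('e2) * r"
    using r by (auto simp: l_def intro!: mult_right_mono)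
  then have r1: "c < lambda_plus TYPE('e1) * r" and r2: "c < lambda_plus TYPE('e2) * r" using clr by auto
  have c2: "c < 2" using c(1) lambda_plus_le_2[OF nz(1)] by linarith
  have "\<forall>y\<in>choquet_boundary H2. \<exists>x. x \<in> choquet_boundary H1 \<and> A.related r x y \<and> B.related r y x"
    using ex_mutually_related[OF A B inv(1) refl(1) nz(2) c2 r(2)] by metis
  then obtain p where p: "\<And>y. y \<in> choquet_boundary H2 \<Longrightarrow>
      p y \<in> choquet_boundary H1 \<and> A.related r (p y) y \<and> B.related r y (p y)" by metis
  have "\<forall>x\<in>choquet_boundary H1. \<exists>y. y \<in> choquet_boundary H2 \<and> B.related r y x \<and> A.related r x y"
    using ex_mutually_related[OF B A inv(2) refl(2) nz(1) c2 r(2)] by metis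
  then obtain q where q: "\<And>x. x \<in> choquet_boundary H1 \<Longrightarrow>
      q x \<in> choquet_boundary H2 \<and> B.related r (q x) x \<and> A.related r x (q x)" by metis
  have "homeomorphism (choquet_boundary H1) (choquet_boundary H2) q p"
  proof (rule homeomorphismI)
    show "continuous_on (choquet_boundary H1) q" by (rule B.related_continuous[OF r(1) r1]) (use q in blast)
    show "continuous_on (choquet_boundary H2) p" by (rule A.related_continuous[OF r(1) r2]) (use p in blast)
    show "p (q x) = x" if "x \<in> choquet_boundary H1" for x
      using A.related_unique[OF r(1) r2, of "p (q x)" "q x" x] p[of "q x"] q[OF that] that by blast
    show "q (p y) = y" if "y \<in> choquet_boundary H2" for y
      using B.related_unique[OF r(1) r1, of "q (p y)" "p y" y] q[of "p y"] p[OF that] that by blast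
  qed (use p q in auto)
  then show ?thesis by (auto simp: homeomorphic_def)
qed

theorem theorem1p1:
  fixes H1 :: "('k1::t2_space \<Rightarrow>\<^sub>C 'e1::banach_lattice) set"
    and H2 :: "('k2::t2_space \<Rightarrow>\<^sub>C 'e2::banach_lattice) set"
    and T :: "('k1 \<Rightarrow>\<^sub>C 'e1) \<Rightarrow> ('k2 \<Rightarrow>\<^sub>C 'e2)"
  assumes "locally_compact_space (euclidean :: 'k1 topology)"
    and "locally_compact_space (euclidean :: 'k2 topology)"
    and "(UNIV :: 'e1 set) \<noteq> {0}" and "(UNIV :: 'e2 set) \<noteq> {0}"
    and "reflexive_space TYPE('e1)" and "reflexive_space TYPE('e2)"
    and "lambda_plus TYPE('e1) > 1" and "lambda_plus TYPE('e2) > 1"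
    and "subspace H1" and "closed H1" and "H1 \<subseteq> C0" and "H1 \<noteq> {0}"
    and "subspace H2" and "closed H2" and "H2 \<subseteq> C0" and "H2 \<noteq> {0}"
    and "\<forall>x \<in> choquet_boundary H1. weak_peak_point H1 x"
    and "\<forall>x \<in> choquet_boundary H2. weak_peak_point H2 x"
    and "isomorphism_between H1 H2 T"
    and "onorm_on H1 T * onorm_on H2 (inv_into H1 T)
           < min (lambda_plus TYPE('e1)) (lambda_plus TYPE('e2))"
    and "\<forall>f \<in> H1. f \<in> positive_part H1 \<longleftrightarrow> T f \<in> positive_part H2"
  shows "choquet_boundary H1 homeomorphic choquet_boundary H2"
proof -
  note H1 = assms(9-12) and H2 = assms(13-16)
  define T' where "T' = inv_into H1 T"
  define a where "a = onorm_on H1 T"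
  define b where "b = onorm_on H2 T'"
  have bij: "bij_betw T H1 H2" and T: "bounded_linear_map_on H1 T" and T': "bounded_linear_map_on H2 T'"
    using assms(19) by (auto simp: isomorphism_between_def T'_def)
  have T_in: "T f \<in> H2" and T'T: "T' (T f) = f" if "f \<in> H1" for f
    using bij that by (auto simp: T'_def bij_betw_def)
  have T'_in: "T' g \<in> H1" and TT': "T (T' g) = g" if "g \<in> H2" for g
    using bij that by (auto simp: T'_def bij_betw_def inv_into_into f_inv_into_f)
  have Ta: "norm (T f) \<le> a * norm f" if "f \<in> H1" for f
    unfolding a_def by (rule onorm_on_bound[OF H1(1) T that])
  have T'b: "norm (T' g) \<le> b * norm g" if "g \<in> H2" for g
    unfolding b_def by (rule onorm_on_bound[OF H2(1) T' that])
  \<comment> \<open>A single nonzero function shows that both operator norms are positive, so that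
    scaling preserves positivity, and that their product is at least 1.\<close>
  obtain f0 where f0: "f0 \<in> H1" "f0 \<noteq> 0" using H1(1,4) subspace_0 by blast
  have low: "norm f \<le> b * norm (T f)" if "f \<in> H1" for f
    using T'b[OF T_in[OF that]] T'T[OF that] by simp
  have low': "norm g \<le> a * norm (T' g)" if "g \<in> H2" for g
    using Ta[OF T'_in[OF that]] TT'[OF that] by simp
  have "0 < b * norm (T f0)" using low[OF f0(1)] f0(2) by (metis less_le_trans zero_less_norm_iff)
  then have b: "0 < b" and Tf0: "0 < norm (T f0)" by (auto simp: zero_less_mult_iff)
  have "0 < a * norm f0" using Ta[OF f0(1)] Tf0 by linarith
  then have a: "0 < a" by (auto simp: zero_less_mult_iff)
  have "norm f0 \<le> b * (a * norm f0)"
    using low[OF f0(1)] mult_left_mono[OF Ta[OF f0(1)], of b] b by linarith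
  then have ab: "1 \<le> a * b" using f0 by (simp add: mult.assoc mult.left_commute)
  have c: "a * b < lambda_plus TYPE('e1)" "a * b < lambda_plus TYPE('e2)"
    using assms(20) by (auto simp: a_def b_def T'_def)
  have scale_pos: "s *\<^sub>R f \<in> positive_part H" if "0 < s" "subspace H" "f \<in> positive_part H"
    for s and f :: "'k::t2_space \<Rightarrow>\<^sub>C 'e::banach_lattice" and H
    using that by (auto simp: positive_part_def subspace_scale
        intro!: scaleR_nonneg_nonneg)
  have P1: "peak_space H1" and P2: "peak_space H2"
    using H1 H2 assms(17,18) by (auto simp: peak_space_def)
  have E1: "positive_embedding H1 H2 (\<lambda>f. b *\<^sub>R T f) (a * b)"
  proof (intro positive_embedding.intro lower_bounded_map.intro lower_bounded_map_axioms.intro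
      positive_embedding_axioms.intro P1 P2 ab H2)
    fix f assume f: "f \<in> H1"
    show "b *\<^sub>R T f \<in> H2" by (intro subspace_scale H2(1) T_in f)
    show "b *\<^sub>R T (f + g) = b *\<^sub>R T f + b *\<^sub>R T g" if "g \<in> H1" for g
      using T f that by (simp add: bounded_linear_map_on_def scaleR_add_right)
    show "b *\<^sub>R T (r *\<^sub>R f) = r *\<^sub>R (b *\<^sub>R T f)" for r
      using T f by (simp add: bounded_linear_map_on_def)
    show "norm f \<le> norm (b *\<^sub>R T f)" using low[OF f] b by simp
    show "norm (b *\<^sub>R T f) \<le> a * b * norm f"
      using mult_left_mono[OF Ta[OF f], of b] b by (simp add: mult.assoc mult.left_commute)
  next
    fix f assume f: "f \<in> positive_part H1"
    then have "f \<in> H1" by (simp add: positive_part_def)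
    then show "b *\<^sub>R T f \<in> positive_part H2" using assms(21) f b H2(1) by (intro scale_pos) auto
  qed
  have E2: "positive_embedding H2 H1 (\<lambda>g. a *\<^sub>R T' g) (a * b)"
  proof (intro positive_embedding.intro lower_bounded_map.intro lower_bounded_map_axioms.intro
      positive_embedding_axioms.intro P1 P2 ab H1)
    fix g assume g: "g \<in> H2"
    show "a *\<^sub>R T' g \<in> H1" by (intro subspace_scale H1(1) T'_in g)
    show "a *\<^sub>R T' (g + h) = a *\<^sub>R T' g + a *\<^sub>R T' h" if "h \<in> H2" for h
      using T' g that by (simp add: bounded_linear_map_on_def scaleR_add_right)
    show "a *\<^sub>R T' (r *\<^sub>R g) = r *\<^sub>R (a *\<^sub>R T' g)" for r
      using T' g by (simp add: bounded_linear_map_on_def)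
    show "norm g \<le> norm (a *\<^sub>R T' g)" using low'[OF g] a by simp
    show "norm (a *\<^sub>R T' g) \<le> a * b * norm g"
      using mult_left_mono[OF T'b[OF g], of a] a by (simp add: mult.assoc)
  next
    fix g assume g: "g \<in> positive_part H2"
    then have "g \<in> H2" by (simp add: positive_part_def)
    then have "T' g \<in> positive_part H1" using assms(21) T'_in TT' g by simp
    then show "a *\<^sub>R T' g \<in> positive_part H1" using a H1(1) by (intro scale_pos)
  qed
  show ?thesis
  proof (rule homeomorphic_choquet_boundaries[OF E1 E2 _ _ assms(5,6,3,4) c])
    show "b *\<^sub>R T (a *\<^sub>R T' g) = (a * b) *\<^sub>R g" if "g \<in> H2" for g
      using T T'_in[OF that] TT'[OF that] by (simp add: bounded_linear_map_on_def mult.commute)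
    show "a *\<^sub>R T' (b *\<^sub>R T f) = (a * b) *\<^sub>R f" if "f \<in> H1" for f
      using T' T_in[OF that] T'T[OF that] by (simp add: bounded_linear_map_on_def)
  qed
qed

end
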